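(* Let $n\ge 1$ be an integer, let $\sigma\ge 1$ and $\delta\in[0,\sigma)$ be real numbers (not necessarily integers), put $\mathtt{k}^-:=\min\{\sigma,2\delta\}$, and assume $n>2\mathtt{k}^-$. Let $u_0=0$ and let $u_1\in L^1(\mathbb{R}^n)$ satisfy $$\int_{\mathbb{R}^n}u_1(x)\,dx>0 .$$ Suppose that $$p\in\Big(1,\;1+\frac{2\sigma}{n-\mathtt{k}^-}\Big).$$ Then there is no global (in time) Sobolev solution $u\in C\big([0,\infty),H^{2\sigma}(\mathbb{R}^n)\big)$ to the Cauchy problem $$\begin{cases}u_{tt}+(-\Delta)^\sigma u+(-\Delta)^\delta u_t=|u|^p, & t>0,\ x\in\mathbb{R}^n,\\ u(0,x)=u_0(x),\quad u_t(0,x)=u_1(x), & x\in\mathbb{R}^n.\end{cases}$$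
   Context: $H^{a}=H^a(\mathbb{R}^n)$, $a\ge 0$, denotes the Bessel potential (Sobolev) space based on $L^2$. For $\gamma\ge 0$, $(-\Delta)^\gamma$ is the operator with Fourier symbol $|\xi|^{2\gamma}$ acting in the spatial variable ($(-\Delta)^0$ is the identity). Solutions are real-valued. A global (in time) Sobolev solution with data $u_0=0$ and $u_1\in L^1$ is a function $u\in C([0,\infty),H^{2\sigma}(\mathbb{R}^n))$ satisfying the equation and the initial conditions in the usual weak sense: $|u|^p\in L^1_{loc}([0,\infty)\times\mathbb{R}^n)$, and for all $\phi\in C_c^\infty([0,\infty)\times\mathbb{R}^n)$ $$\int_0^\infty\!\!\int_{\mathbb{R}^n}|u|^p\phi\,dx\,dt+\int_{\mathbb{R}^n}u_1(x)\phi(0,x)\,dx=\int_0^\infty\!\!\int_{\mathbb{R}^n}u\,\big(\partial_t^2\phi+(-\Delta)^\sigma\phi-(-\Delta)^\delta\partial_t\phi\big)\,dx\,dt,$$ together with $u(0,\cdot)=0$. *)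

theory Defs
  imports "HOL-Analysis.Analysis"
begin

section \<open>Smooth test functions\<close>

text \<open>A function is \<open>C\<^sup>k\<^sup>+\<^sup>1\<close> iff it is differentiable everywhere and all its first-order partial
  derivatives are \<open>C\<^sup>k\<close>.\<close>

primrec C_k :: "nat \<Rightarrow> ('a::euclidean_space \<Rightarrow> real) \<Rightarrow> bool" where
  "C_k 0 f \<longleftrightarrow> continuous_on UNIV f"
| "C_k (Suc k) f \<longleftrightarrow>
     (\<forall>x. f differentiable (at x)) \<and>
     (\<forall>b\<in>Basis. C_k k (\<lambda>x. frechet_derivative f (at x) b))"

definition smooth :: "('a::euclidean_space \<Rightarrow> real) \<Rightarrow> bool" where
  "smooth f \<longleftrightarrow> (\<forall>k. C_k k f)"

text \<open>Elements of \<open>C\<^sub>c\<^sup>\<infinity>([0,\<infinity>) \<times> \<real>\<^sup>n)\<close> are the restrictions to \<open>t \<ge> 0\<close> of functions in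
  \<open>C\<^sub>c\<^sup>\<infinity>(\<real> \<times> \<real>\<^sup>n)\<close>; in particular they need not vanish at \<open>t = 0\<close>. We work with the extended
  functions, of which only the values at \<open>t \<ge> 0\<close> are used below.\<close>

definition test_functions :: "(real \<times> 'a::euclidean_space \<Rightarrow> real) set" where
  "test_functions = {\<phi>. smooth \<phi> \<and> compact (closure {z. \<phi> z \<noteq> 0})}"


section \<open>Fourier transform and the fractional Laplacian\<close>

definition fourier :: "('a::euclidean_space \<Rightarrow> complex) \<Rightarrow> 'a \<Rightarrow> complex" where
  "fourier f \<xi> =
     of_real ((2 * pi) powr (- real DIM('a) / 2)) * (LINT x|lebesgue. cis (- (x \<bullet> \<xi>)) * f x)"

definition inv_fourier :: "('a::euclidean_space \<Rightarrow> complex) \<Rightarrow> 'a \<Rightarrow> complex" where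
  "inv_fourier g x =
     of_real ((2 * pi) powr (- real DIM('a) / 2)) * (LINT \<xi>|lebesgue. cis (x \<bullet> \<xi>) * g \<xi>)"

text \<open>The operator with Fourier symbol \<open>|\<xi>|\<^sup>2\<^sup>\<gamma>\<close>. It maps real test functions to real functions, as
  the symbol is real and even, so taking the real part only adjusts the type. For \<open>\<gamma> = 0\<close> the
  convention \<open>0 powr 0 = 0\<close> changes the symbol \<open>1\<close> only on the null set \<open>{0}\<close>, and the operator
  is the identity on test functions.\<close>

definition frac_laplacian :: "real \<Rightarrow> ('a::euclidean_space \<Rightarrow> real) \<Rightarrow> 'a \<Rightarrow> real" where
  "frac_laplacian \<gamma> f x =
     Re (inv_fourier (\<lambda>\<xi>. of_real (norm \<xi> powr (2 * \<gamma>)) * fourier (\<lambda>y. of_real (f y)) \<xi>) x)"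


section \<open>Bessel potential spaces based on \<open>L\<^sup>2\<close>\<close>

definition L2 :: "('a::euclidean_space \<Rightarrow> complex) set" where
  "L2 = {f. f \<in> borel_measurable lebesgue \<and> integrable lebesgue (\<lambda>x. (norm (f x))\<^sup>2)}"

definition L2_norm :: "('a::euclidean_space \<Rightarrow> complex) \<Rightarrow> real" where
  "L2_norm f = sqrt (LINT x|lebesgue. (norm (f x))\<^sup>2)"

text \<open>Plancherel's definition of the Fourier transform on \<open>L\<^sup>2\<close>: \<open>g\<close> is the limit in \<open>L\<^sup>2\<close>, as
  \<open>R \<rightarrow> \<infinity>\<close>, of the Fourier transforms of the truncations of \<open>f\<close> to the balls of radius \<open>R\<close>
  (which are integrable). It determines \<open>g\<close> up to a null set.\<close>

definition is_L2_fourier ::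
  "('a::euclidean_space \<Rightarrow> complex) \<Rightarrow> ('a \<Rightarrow> complex) \<Rightarrow> bool" where
  "is_L2_fourier f g \<longleftrightarrow> f \<in> L2 \<and> g \<in> L2 \<and>
     ((\<lambda>R. \<integral>\<^sup>+\<xi>. ennreal ((norm (g \<xi> - fourier (\<lambda>x. indicator (cball 0 R) x * f x) \<xi>))\<^sup>2) \<partial>lebesgue)
        \<longlongrightarrow> 0) at_top"

definition bessel_weight :: "real \<Rightarrow> ('a::euclidean_space \<Rightarrow> complex) \<Rightarrow> 'a \<Rightarrow> complex" where
  "bessel_weight s g \<xi> = of_real ((1 + (norm \<xi>)\<^sup>2) powr (s / 2)) * g \<xi>"

definition sobolev_space :: "real \<Rightarrow> ('a::euclidean_space \<Rightarrow> complex) set" where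
  "sobolev_space s = {f. \<exists>g. is_L2_fourier f g \<and> bessel_weight s g \<in> L2}"

definition sobolev_norm :: "real \<Rightarrow> ('a::euclidean_space \<Rightarrow> complex) \<Rightarrow> real" where
  "sobolev_norm s f = L2_norm (bessel_weight s (SOME g. is_L2_fourier f g))"

text \<open>\<open>C([0,\<infinity>), H\<^sup>s)\<close>, for real-valued functions; the values at \<open>t < 0\<close> are irrelevant.\<close>

definition continuous_sobolev :: "real \<Rightarrow> (real \<Rightarrow> 'a::euclidean_space \<Rightarrow> real) \<Rightarrow> bool" where
  "continuous_sobolev s u \<longleftrightarrow>
     (\<forall>t\<ge>0. (\<lambda>x. of_real (u t x)) \<in> sobolev_space s) \<and>
     (\<forall>t\<ge>0. ((\<lambda>r. sobolev_norm s (\<lambda>x. of_real (u r x - u t x))) \<longlongrightarrow> 0) (at t within {0..}))"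


section \<open>Global Sobolev solutions\<close>

text \<open>Global (in time) Sobolev solutions of
  \<open>u\<^sub>t\<^sub>t + (-\<Delta>)\<^sup>\<sigma> u + (-\<Delta>)\<^sup>\<delta> u\<^sub>t = |u|\<^sup>p\<close> with data \<open>u(0) = 0\<close>, \<open>u\<^sub>t(0) = u1\<close>. As \<open>u(t)\<close> is only
  defined up to null sets, \<open>u\<close> stands for a representative measurable in \<open>(t,x)\<close>.\<close>

definition global_sobolev_solution ::
  "real \<Rightarrow> real \<Rightarrow> real \<Rightarrow> ('a::euclidean_space \<Rightarrow> real) \<Rightarrow> (real \<Rightarrow> 'a \<Rightarrow> real) \<Rightarrow> bool" where
  "global_sobolev_solution \<sigma> \<delta> p u1 u \<longleftrightarrow>
     (\<lambda>(t, x). u t x) \<in> borel_measurable (lebesgue_on ({0..} \<times> UNIV)) \<and>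
     continuous_sobolev (2 * \<sigma>) u \<and>
     (\<forall>K. compact K \<and> K \<subseteq> {0..} \<times> UNIV \<longrightarrow>
        set_integrable lebesgue K (\<lambda>(t, x). \<bar>u t x\<bar> powr p)) \<and>
     (AE x in lebesgue. u 0 x = 0) \<and>
     (\<forall>\<phi>\<in>test_functions.
        (LINT t:{0..}|lebesgue. LINT x|lebesgue. \<bar>u t x\<bar> powr p * \<phi> (t, x))
          + (LINT x|lebesgue. u1 x * \<phi> (0, x))
        = (LINT t:{0..}|lebesgue. LINT x|lebesgue. u t x *
             ((deriv ^^ 2) (\<lambda>s. \<phi> (s, x)) t
              + frac_laplacian \<sigma> (\<lambda>y. \<phi> (t, y)) x
              - frac_laplacian \<delta> (\<lambda>y. deriv (\<lambda>s. \<phi> (s, y)) t) x)))"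

end

theory Submission
  imports Defs "HOL-Probability.Probability"
begin

text \<open>Test the equation with \<open>\<eta>(t / R\<^sup>\<alpha>) \<phi>(x / R)\<close>, where \<open>\<alpha> = 2\<sigma> - k\<close>, \<open>\<eta>\<close> is a smooth cutoff with
  \<open>\<bar>\<eta>'\<bar> + \<bar>\<eta>''\<bar> \<le> K \<eta>\<^sup>1\<^sup>/\<^sup>p\<close>, and \<open>\<phi>(x) = (1 + \<bar>x\<bar>\<^sup>2)\<^sup>-\<^sup>q\<^sup>/\<^sup>2\<close> with \<open>q\<close> slightly larger than \<open>n\<close>, so that \<open>\<phi>\<close> is
  integrable and \<open>\<bar>(-\<Delta>)\<^sup>\<gamma>\<phi>\<bar> \<le> C \<phi>\<close> for \<open>\<gamma> = \<sigma>, \<delta>\<close>. All three linear terms are then \<open>O(R\<^sup>-\<^sup>2\<^sup>\<sigma>)\<close>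
  times the test function, and Young's inequality absorbs \<open>\<bar>u\<bar>\<^sup>p\<close> and leaves
  \<open>\<integral>u\<^sub>1(x) \<phi>(x / R) dx \<le> C R\<^sup>e\<close> with \<open>e = n + \<alpha> - 2\<sigma>p / (p - 1) < 0\<close>. Letting \<open>R \<rightarrow> \<infinity>\<close> gives
  \<open>\<integral>u\<^sub>1 \<le> 0\<close>.

  The bound on \<open>(-\<Delta>)\<^sup>\<gamma>\<phi>\<close> comes from writing \<open>\<phi>\<close> as a mixture of Gaussians of all widths and
  \<open>\<bar>\<xi>\<bar>\<^sup>2\<^sup>\<gamma>\<close> as \<open>\<bar>\<xi>\<bar>\<^sup>2\<^sup>m\<close> times a mixture of the functions \<open>exp(-r\<bar>\<xi>\<bar>\<^sup>2)\<close>, with an integer \<open>m > \<gamma>\<close>.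
  As \<open>\<phi>\<close> is not compactly supported, it is approximated in \<open>L\<^sup>2\<close> by test functions; since
  \<open>u(t) \<in> H\<^sup>2\<^sup>\<sigma>\<close>, the pairing of \<open>u(t)\<close> with \<open>(-\<Delta>)\<^sup>\<gamma>f\<close>, moved to the Fourier side, is continuous in
  \<open>f \<in> L\<^sup>2\<close>.\<close>

section \<open>Lebesgue measure and the Fourier transform\<close>

text \<open>Since (-\<Delta>)^\<gamma> is nonlocal, a compactly supported \<phi> cannot in general
  satisfy |(-\<Delta>)^\<gamma> \<phi>| \<le> C \<phi>: for non-integer \<gamma> the left side has a
  tail of order |x|^(-n - 2\<gamma>). This forces a \<phi> with q < n + 2\<gamma> for each positive
  order that occurs, while integrability of \<phi> forces q > n. The compactly supported
  approximants inherit no such bound, hence Young's inequality is applied only after passing to the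
  limit; the term |u|^p, of which only local integrability is known, is carried through that limit
  by Fatou's lemma. The choice of \<alpha> balances the terms with time derivatives: R^(-2\<alpha>)
  \<le> R^(-2\<sigma>) amounts to k \<le> \<sigma>, and R^(-\<alpha> - 2\<delta>) \<le>
  R^(-2\<sigma>) to k \<le> 2\<delta>, so that k = min \<sigma> (2\<delta>) gives the smallest
  admissible \<alpha>; then e < 0 is exactly p < 1 + 2\<sigma> / (n - k). The Fourier analysis rests
  on the multiplication formula for integrable functions and on the explicit transform of a
  Gaussian.\<close>

lemma sigma_finite_lebesgue: "sigma_finite_measure (lebesgue :: 'a::euclidean_space measure)"
proof -
  obtain A :: "'a set set" where A: "countable A" "A \<subseteq> sets lborel" "\<Union>A = space lborel"
    "\<forall>a\<in>A. emeasure lborel a \<noteq> \<infinity>"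
    using lborel.sigma_finite_countable by blast
  then show ?thesis
    by (intro sigma_finite_measure.intro exI[of _ A]) (auto simp: emeasure_completion subset_iff)
qed

interpretation lebesgue: sigma_finite_measure "lebesgue :: 'a::euclidean_space measure"
  by (rule sigma_finite_lebesgue)

text \<open>This product of two completed measures serves for Fubini on kernels. It is not complete,
  so it differs from \<open>lebesgue\<close> on the product type, for which Tonelli's theorem is
  proved separately below.\<close>

interpretation lebesgue_pair: pair_sigma_finite
    "lebesgue :: 'a::euclidean_space measure" "lebesgue :: 'b::euclidean_space measure" ..

lemma fst_lebesgue_borel [measurable]:
  "fst \<in> borel_measurable ((lebesgue :: 'a::euclidean_space measure) \<Otimes>\<^sub>M M)"
  using measurable_compose[OF measurable_fst id_borel_measurable_lebesgue] by (simp add: id_def)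

lemma snd_lebesgue_borel [measurable]:
  "snd \<in> borel_measurable (M \<Otimes>\<^sub>M (lebesgue :: 'a::euclidean_space measure))"
  using measurable_compose[OF measurable_snd id_borel_measurable_lebesgue] by (simp add: id_def)

lemma ident_lebesgue_borel: "(\<lambda>x. x) \<in> borel_measurable lebesgue"
  using id_borel_measurable_lebesgue by (simp add: id_def)

lemma borel_measurable_lebesgueI:
  "f \<in> borel_measurable borel \<Longrightarrow> f \<in> borel_measurable lebesgue"
  by (rule measurable_completion) simp

lemma measurable_cis [measurable]: "cis \<in> borel_measurable borel"
  by (intro borel_measurable_continuous_onI continuous_intros)

lemma integrable_cis_mult:
  assumes "integrable M f" "g \<in> borel_measurable M"
  shows "integrable M (\<lambda>x. cis (g x) * f x)"
  using assms(1)
  by (rule Bochner_Integration.integrable_bound) (use assms in \<open>auto simp: norm_mult\<close>)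

lemma inv_fourier_eq: "inv_fourier g x = fourier g (- x)"
  by (simp add: inv_fourier_def fourier_def inner_commute)

lemma fourier_cong_AE:
  assumes "AE x in lebesgue. f x = g x" "f \<in> borel_measurable lebesgue" "g \<in> borel_measurable lebesgue"
  shows "fourier f = fourier g"
  supply ident_lebesgue_borel [measurable]
  unfolding fourier_def fun_eq_iff
  by (intro allI arg_cong[where f="\<lambda>y. _ * y"] integral_cong_AE)
     (use assms in auto)

lemma norm_fourier_le:
  fixes f :: "'a::euclidean_space \<Rightarrow> complex"
  assumes "integrable lebesgue f"
  shows "norm (fourier f \<xi>) \<le> (2 * pi) powr (- real DIM('a) / 2) * (LINT x|lebesgue. norm (f x))"
proof -
  have "norm (LINT x|lebesgue. cis (- (x \<bullet> \<xi>)) * f x) \<le> (LINT x|lebesgue. norm (cis (- (x \<bullet> \<xi>)) * f x))"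
    by (rule integral_norm_bound)
  then show ?thesis by (auto simp: fourier_def norm_mult intro!: mult_left_mono)
qed

lemma continuous_fourier:
  assumes "integrable lebesgue f"
  shows "continuous_on UNIV (fourier f)"
proof -
  have "isCont (\<lambda>\<xi>. LINT x|lebesgue. cis (- (x \<bullet> \<xi>)) * f x) \<xi>" for \<xi>
    unfolding continuous_at_sequentially comp_def
  proof safe
    note [measurable] = ident_lebesgue_borel
    fix s :: "nat \<Rightarrow> 'a" assume s: "s \<longlonglongrightarrow> \<xi>"
    show "(\<lambda>i. LINT x|lebesgue. cis (- (x \<bullet> s i)) * f x) \<longlonglongrightarrow> (LINT x|lebesgue. cis (- (x \<bullet> \<xi>)) * f x)"
      by (rule integral_dominated_convergence[where w="\<lambda>x. norm (f x)"])
         (use assms in \<open>auto simp: norm_mult intro!: tendsto_intros s\<close>)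
  qed
  then show ?thesis unfolding fourier_def
    by (intro continuous_intros continuous_at_imp_continuous_on) auto
qed

lemma measurable_fourier:
  "integrable lebesgue f \<Longrightarrow> fourier f \<in> borel_measurable borel"
  by (intro borel_measurable_continuous_onI continuous_fourier)

lemma measurable_fourier_lebesgue:
  "integrable lebesgue f \<Longrightarrow> fourier f \<in> borel_measurable lebesgue"
  using measurable_completion[of "fourier f" lborel borel] measurable_fourier[of f] by simp

text \<open>Fubini. It is used for the convolution inside the Plancherel inequality and for mixtures
  of Gaussians.\<close>

lemma fourier_integral:
  fixes w :: "'p \<Rightarrow> 'a::euclidean_space \<Rightarrow> complex"
  assumes M: "sigma_finite_measure M"
    and w: "integrable (M \<Otimes>\<^sub>M lebesgue) (\<lambda>(p, x). w p x)"
  shows "fourier (\<lambda>x. LINT p|M. w p x) \<xi> = (LINT p|M. fourier (w p) \<xi>)"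
proof -
  interpret M: sigma_finite_measure M by fact
  interpret P: pair_sigma_finite M "lebesgue :: 'a measure" ..
  have "integrable (M \<Otimes>\<^sub>M lebesgue) (\<lambda>z. cis (- (snd z \<bullet> \<xi>)) * (\<lambda>(p, x). w p x) z)"
    by (rule integrable_cis_mult[OF w]) auto
  then have *: "integrable (M \<Otimes>\<^sub>M lebesgue) (\<lambda>(p, x). cis (- (x \<bullet> \<xi>)) * w p x)"
    by (simp add: case_prod_unfold)
  have "fourier (\<lambda>x. LINT p|M. w p x) \<xi> = of_real ((2 * pi) powr (- real DIM('a) / 2)) *
      (LINT x|lebesgue. (LINT p|M. cis (- (x \<bullet> \<xi>)) * w p x))"
    unfolding fourier_def by (simp add: integral_mult_right_zero)
  also have "(LINT x|lebesgue. (LINT p|M. cis (- (x \<bullet> \<xi>)) * w p x)) =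
     (LINT p|M. (LINT x|lebesgue. cis (- (x \<bullet> \<xi>)) * w p x))"
    by (rule P.Fubini_integral[OF *])
  finally show ?thesis unfolding fourier_def by simp
qed

lemma integrable_product:
  fixes f :: "'p \<Rightarrow> complex" and g :: "'q \<Rightarrow> complex"
  assumes "sigma_finite_measure M" "sigma_finite_measure N"
    and f: "integrable M f" and g: "integrable N g"
  shows "integrable (M \<Otimes>\<^sub>M N) (\<lambda>(x, y). f x * g y)"
proof -
  interpret pair_sigma_finite M N using assms by (simp add: pair_sigma_finite_def)
  have [measurable]: "f \<in> borel_measurable M" "g \<in> borel_measurable N" using f g by auto
  show ?thesis
    by (rule Fubini_integrable) (use f g in \<open>auto simp: norm_mult\<close>)
qed

text \<open>Multiplication formula: the kernel cis (- (x \<bullet> y)) is symmetric in x and y, so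
  Fubini moves the transform to the other factor. Inversion, the Plancherel inequality and the
  pairing with \<open>L2\<close> functions all start from it.\<close>

lemma fourier_mult_swap:
  fixes f g :: "'a::euclidean_space \<Rightarrow> complex"
  assumes f: "integrable lebesgue f" and g: "integrable lebesgue g"
  shows "(LINT x|lebesgue. f x * fourier g x) = (LINT x|lebesgue. fourier f x * g x)"
proof -
  have "integrable (lebesgue \<Otimes>\<^sub>M lebesgue) (\<lambda>z. cis (- (fst z \<bullet> snd z)) * (\<lambda>(x, y). f x * g y) z)"
    by (intro integrable_cis_mult integrable_product sigma_finite_lebesgue f g) auto
  then have *: "integrable (lebesgue \<Otimes>\<^sub>M lebesgue) (\<lambda>(x, y). cis (- (x \<bullet> y)) * (f x * g y))"
    by (simp add: case_prod_unfold)
  let ?c = "complex_of_real ((2 * pi) powr (- real DIM('a) / 2))"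
  have "(LINT x|lebesgue. f x * fourier g x) =
      (LINT x|lebesgue. ?c * (LINT y|lebesgue. cis (- (x \<bullet> y)) * (f x * g y)))"
  proof (rule Bochner_Integration.integral_cong[OF refl])
    fix x
    have "(LINT y|lebesgue. cis (- (x \<bullet> y)) * (f x * g y)) = (LINT y|lebesgue. f x * (cis (- (y \<bullet> x)) * g y))"
      by (simp only: inner_commute mult_ac)
    then show "f x * fourier g x = ?c * (LINT y|lebesgue. cis (- (x \<bullet> y)) * (f x * g y))"
      by (simp add: fourier_def)
  qed
  also have "\<dots> = ?c * (LINT x|lebesgue. (LINT y|lebesgue. cis (- (x \<bullet> y)) * (f x * g y)))"
    by simp
  also have "(LINT x|lebesgue. (LINT y|lebesgue. cis (- (x \<bullet> y)) * (f x * g y))) =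
     (LINT y|lebesgue. (LINT x|lebesgue. cis (- (x \<bullet> y)) * (f x * g y)))"
    by (rule lebesgue_pair.Fubini_integral[OF *, symmetric])
  also have "?c * \<dots> = (LINT y|lebesgue. ?c * (LINT x|lebesgue. cis (- (x \<bullet> y)) * (f x * g y)))"
    by simp
  also have "\<dots> = (LINT x|lebesgue. fourier f x * g x)"
  proof (rule Bochner_Integration.integral_cong[OF refl])
    fix y
    have "(LINT x|lebesgue. cis (- (x \<bullet> y)) * (f x * g y)) = (LINT x|lebesgue. (cis (- (x \<bullet> y)) * f x) * g y)"
      by (simp only: mult_ac)
    then show "?c * (LINT x|lebesgue. cis (- (x \<bullet> y)) * (f x * g y)) = fourier f y * g y"
      by (simp add: fourier_def)
  qed
  finally show ?thesis .
qed

section \<open>Affine changes of variables for the completed measure\<close>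

lemma lebesgue_affine:
  fixes t :: "'a::euclidean_space"
  assumes "c \<noteq> 0"
  shows "lebesgue = density (distr lebesgue lebesgue (\<lambda>x. t + c *\<^sub>R x)) (\<lambda>_. \<bar>c\<bar> ^ DIM('a))"
    and "(\<lambda>x. t + c *\<^sub>R x) \<in> lebesgue \<rightarrow>\<^sub>M lebesgue"
  using lebesgue_affine_euclidean[of "\<lambda>_::'a. c" t] lebesgue_affine_measurable[of "\<lambda>_::'a. c" t] assms
  unfolding scaleR_scaleR[symmetric] scaleR_sum_right[symmetric] euclidean_representation prod_constant
  by simp_all

lemma integrable_scaleR_right_iff:
  fixes f :: "'a \<Rightarrow> 'b::{banach, second_countable_topology}"
  assumes "c \<noteq> 0"
  shows "integrable M (\<lambda>x. c *\<^sub>R f x) \<longleftrightarrow> integrable M f"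
  using integrable_scaleR_right[of c M f] integrable_scaleR_right[of "1 / c" M "\<lambda>x. c *\<^sub>R f x"] assms
  by auto

lemma integral_affine_aux:
  fixes f :: "'a::euclidean_space \<Rightarrow> 'b::{banach, second_countable_topology}" and t :: 'a
  assumes c: "c \<noteq> 0" and f: "f \<in> borel_measurable lebesgue"
  shows "integral\<^sup>L lebesgue f = \<bar>c\<bar> ^ DIM('a) *\<^sub>R (LINT x|lebesgue. f (t + c *\<^sub>R x))"
    and "integrable lebesgue f \<longleftrightarrow> integrable lebesgue (\<lambda>x. f (t + c *\<^sub>R x))"
proof -
  note [measurable] = lebesgue_affine(2)[OF c, of t] f
  have "integral\<^sup>L lebesgue f = integral\<^sup>L (density (distr lebesgue lebesgue (\<lambda>x. t + c *\<^sub>R x)) (\<lambda>_. ennreal (\<bar>c\<bar> ^ DIM('a)))) f"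
    using lebesgue_affine(1)[OF c, of t] by simp
  also have "\<dots> = \<bar>c\<bar> ^ DIM('a) *\<^sub>R (LINT x|lebesgue. f (t + c *\<^sub>R x))"
    by (subst integral_density) (auto simp: integral_distr)
  finally show "integral\<^sup>L lebesgue f = \<bar>c\<bar> ^ DIM('a) *\<^sub>R (LINT x|lebesgue. f (t + c *\<^sub>R x))" .
  have "integrable lebesgue f \<longleftrightarrow> integrable (density (distr lebesgue lebesgue (\<lambda>x. t + c *\<^sub>R x)) (\<lambda>_. ennreal (\<bar>c\<bar> ^ DIM('a)))) f"
    using lebesgue_affine(1)[OF c, of t] by simp
  also have "\<dots> \<longleftrightarrow> integrable lebesgue (\<lambda>x. f (t + c *\<^sub>R x))"
    using c by (subst integrable_density) (auto simp: integrable_distr_eq integrable_scaleR_right_iff)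
  finally show "integrable lebesgue f \<longleftrightarrow> integrable lebesgue (\<lambda>x. f (t + c *\<^sub>R x))" .
qed

text \<open>Measurability of \<open>f\<close> is recovered from that of the affine pullback by
  composing with the inverse affine map, so both sides fail together for a non-measurable
  \<open>f\<close>.\<close>

lemma integrable_affine:
  fixes f :: "'a::euclidean_space \<Rightarrow> 'b::{banach, second_countable_topology}" and t :: 'a
  assumes c: "c \<noteq> 0"
  shows "integrable lebesgue (\<lambda>x. f (t + c *\<^sub>R x)) \<longleftrightarrow> integrable lebesgue f"
proof (cases "f \<in> borel_measurable lebesgue")
  case True then show ?thesis using integral_affine_aux(2)[OF c True] by blast
next
  case False
  have "f \<in> borel_measurable lebesgue" if "(\<lambda>x. f (t + c *\<^sub>R x)) \<in> borel_measurable lebesgue"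
  proof -
    have "(\<lambda>x. f (t + c *\<^sub>R (((-1/c) *\<^sub>R t) + (1/c) *\<^sub>R x))) \<in> borel_measurable lebesgue"
      using c by (intro measurable_compose[OF lebesgue_affine(2) that]) auto
    then show ?thesis using c by (simp add: algebra_simps)
  qed
  with False show ?thesis by (meson borel_measurable_integrable)
qed

lemma integral_affine:
  fixes f :: "'a::euclidean_space \<Rightarrow> 'b::{banach, second_countable_topology}" and t :: 'a
  assumes c: "c \<noteq> 0"
  shows "(LINT x|lebesgue. f (t + c *\<^sub>R x)) = (1 / \<bar>c\<bar> ^ DIM('a)) *\<^sub>R integral\<^sup>L lebesgue f"
proof (cases "integrable lebesgue f")
  case True
  then show ?thesis using integral_affine_aux(1)[OF c, of f t] c by auto
next
  case False
  then show ?thesis using integrable_affine[OF c, of f t]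
    by (simp add: not_integrable_integral_eq)
qed

lemma fourier_scale:
  fixes f :: "'a::euclidean_space \<Rightarrow> complex"
  assumes c: "c > 0"
  shows "fourier (\<lambda>x. f (c *\<^sub>R x)) \<xi> = of_real (1 / c ^ DIM('a)) * fourier f ((1 / c) *\<^sub>R \<xi>)"
proof -
  have "(LINT x|lebesgue. cis (- (x \<bullet> \<xi>)) * f (c *\<^sub>R x)) =
     (LINT x|lebesgue. (\<lambda>y. cis (- (y \<bullet> ((1 / c) *\<^sub>R \<xi>))) * f y) (0 + c *\<^sub>R x))"
    using c by simp
  also have "\<dots> = (1 / \<bar>c\<bar> ^ DIM('a)) *\<^sub>R (LINT y|lebesgue. cis (- (y \<bullet> ((1 / c) *\<^sub>R \<xi>))) * f y)"
    using c by (intro integral_affine) auto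
  finally show ?thesis using c unfolding fourier_def by (simp add: scaleR_conv_of_real)
qed

section \<open>Gaussians, Fourier inversion and the Plancherel inequality\<close>

text \<open>The integral is the characteristic function of the standard normal distribution at -y,
  up to the normalisation sqrt (2 pi) of its density.\<close>

lemma
  fixes y :: real
  shows integrable_cis_gaussian_1d: "integrable lborel (\<lambda>t. cis (- (t * y)) * complex_of_real (exp (- t\<^sup>2 / 2)))"
    and integral_cis_gaussian_1d: "(LINT t|lborel. cis (- (t * y)) * complex_of_real (exp (- t\<^sup>2 / 2))) = of_real (sqrt (2 * pi) * exp (- y\<^sup>2 / 2))"
proof -
  have *: "cis (- (t * y)) * complex_of_real (exp (- t\<^sup>2 / 2)) = of_real (sqrt (2 * pi)) * (std_normal_density t *\<^sub>R iexp ((- y) * t))" for t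
    by (simp add: std_normal_density_def scaleR_conv_of_real cis_conv_exp mult_ac)
  have "integrable lborel (\<lambda>t. cis ((- y) * t) * complex_of_real (std_normal_density t))"
    by (intro integrable_cis_mult) auto
  then have i: "integrable lborel (\<lambda>t. std_normal_density t *\<^sub>R iexp ((- y) * t))"
    by (simp add: cis_conv_exp scaleR_conv_of_real mult_ac)
  then show "integrable lborel (\<lambda>t. cis (- (t * y)) * complex_of_real (exp (- t\<^sup>2 / 2)))"
    unfolding * by (rule integrable_mult_right)
  have "(LINT t|lborel. std_normal_density t *\<^sub>R iexp ((- y) * t)) = char std_normal_distribution (- y)"
    unfolding char_def by (subst integral_density) auto
  also have "\<dots> = of_real (exp (- y\<^sup>2 / 2))" by (simp add: char_std_normal_distribution)
  finally show "(LINT t|lborel. cis (- (t * y)) * complex_of_real (exp (- t\<^sup>2 / 2))) = of_real (sqrt (2 * pi) * exp (- y\<^sup>2 / 2))"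
    unfolding * by (simp only: integral_mult_right_zero of_real_mult)
qed

lemma norm_power2_Basis: "(norm x)\<^sup>2 = (\<Sum>b\<in>Basis. (x \<bullet> b)\<^sup>2)" for x :: "'a::euclidean_space"
  by (subst power2_norm_eq_inner, subst euclidean_inner) (simp add: power2_eq_square)

text \<open>The integrand is a product of one-dimensional ones over \<open>Basis\<close>, and
  \<open>lborel\<close> is the image of a product measure, so the integral factorises. The constant
  (2 pi)^(-n/2) in \<open>fourier\<close> cancels the powers of sqrt (2 pi), which makes this
  Gaussian its own transform.\<close>

lemma
  fixes \<xi> :: "'a::euclidean_space"
  shows integrable_std_gaussian: "integrable lebesgue (\<lambda>x::'a. complex_of_real (exp (- (norm x)\<^sup>2 / 2)))"
    and fourier_std_gaussian: "fourier (\<lambda>x::'a. complex_of_real (exp (- (norm x)\<^sup>2 / 2))) \<xi> = of_real (exp (- (norm \<xi>)\<^sup>2 / 2))"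
proof -
  interpret product_sigma_finite "\<lambda>_::'a. lborel :: real measure" ..
  define h where "h \<xi> b t = cis (- (t * (\<xi> \<bullet> b))) * complex_of_real (exp (- t\<^sup>2 / 2))" for \<xi> b :: 'a and t
  define g where "g \<xi> x = cis (- (x \<bullet> \<xi>)) * complex_of_real (exp (- (norm x)\<^sup>2 / 2))" for \<xi> x :: 'a
  have g: "g \<xi> x = (\<Prod>b\<in>Basis. h \<xi> b (x \<bullet> b))" for \<xi> x
  proof -
    have "(\<Prod>b\<in>Basis. cis (- ((x \<bullet> b) * (\<xi> \<bullet> b)))) = cis (\<Sum>b\<in>Basis. - ((x \<bullet> b) * (\<xi> \<bullet> b)))"
      by (induction rule: finite_induct[OF finite_Basis]) (auto simp: cis_mult)
    moreover have "(\<Prod>b\<in>Basis. exp (- (x \<bullet> b)\<^sup>2 / 2)) = exp (- (norm x)\<^sup>2 / 2)"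
      by (simp add: exp_sum[symmetric] sum_negf sum_divide_distrib[symmetric] norm_power2_Basis)
    ultimately show ?thesis unfolding g_def h_def
      by (simp add: prod.distrib euclidean_inner[of x \<xi>] sum_negf flip: of_real_prod)
  qed
  have hi: "integrable lborel (h \<xi> b)" for \<xi> b
    unfolding h_def by (rule integrable_cis_gaussian_1d)
  have [measurable]: "g \<xi> \<in> borel_measurable borel" for \<xi> unfolding g_def by measurable
  have *: "g \<xi> (\<Sum>b\<in>Basis. f b *\<^sub>R b) = (\<Prod>b\<in>Basis. h \<xi> b (f b))" for \<xi> f
    unfolding g by (intro prod.cong refl arg_cong[where f="h \<xi> _"]) (simp add: inner_sum_left inner_Basis if_distrib sum.delta cong: if_cong)
  have [measurable]: "(\<lambda>f. \<Sum>b\<in>Basis. f b *\<^sub>R b :: 'a) \<in> borel_measurable (\<Pi>\<^sub>M b\<in>Basis. lborel)"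
    by measurable
  have i: "integrable lborel (g \<xi>)" for \<xi>
    unfolding lborel_eq[where 'a='a]
    by (subst integrable_distr_eq) (auto simp: * intro!: product_integrable_prod hi)
  have "integral\<^sup>L lborel (g \<xi>) = (\<Prod>b\<in>Basis. integral\<^sup>L lborel (h \<xi> b))"
    unfolding lborel_eq[where 'a='a] by (subst integral_distr) (auto simp: * intro!: product_integral_prod hi)
  also have "\<dots> = (\<Prod>b\<in>Basis. of_real (sqrt (2 * pi) * exp (- (\<xi> \<bullet> b)\<^sup>2 / 2)))"
    unfolding h_def by (intro prod.cong refl integral_cis_gaussian_1d)
  also have "\<dots> = of_real (sqrt (2 * pi) ^ DIM('a) * exp (- (norm \<xi>)\<^sup>2 / 2))"
    unfolding of_real_prod[symmetric] 
    by (simp add: prod.distrib exp_sum[symmetric] sum_negf sum_divide_distrib[symmetric] norm_power2_Basis)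
  finally have int: "integral\<^sup>L lborel (g \<xi>) = of_real (sqrt (2 * pi) ^ DIM('a) * exp (- (norm \<xi>)\<^sup>2 / 2))" .
  \<comment> \<open>At frequency 0 the integrand \<open>g\<close> is the Gaussian itself, so its
    integrability is a special case.\<close>
  have "g 0 = (\<lambda>x::'a. complex_of_real (exp (- (norm x)\<^sup>2 / 2)))" by (auto simp: g_def)
  with i[of 0] show "integrable lebesgue (\<lambda>x::'a. complex_of_real (exp (- (norm x)\<^sup>2 / 2)))"
    by (metis borel_measurable_integrable integrable_completion)
  have "integral\<^sup>L lebesgue (g \<xi>) = integral\<^sup>L lborel (g \<xi>)"
    by (rule integral_completion) auto
  moreover have "(2 * pi) powr (- real DIM('a) / 2) * sqrt (2 * pi) ^ DIM('a) = 1"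
    by (simp add: powr_half_sqrt[symmetric] powr_realpow[symmetric] powr_powr powr_add[symmetric])
  ultimately show "fourier (\<lambda>x::'a. complex_of_real (exp (- (norm x)\<^sup>2 / 2))) \<xi> = of_real (exp (- (norm \<xi>)\<^sup>2 / 2))"
    using int unfolding fourier_def g_def[symmetric]
    by (simp add: mult.assoc[symmetric] flip: of_real_mult of_real_power)
qed

lemma integrable_of_real_iff: "integrable M (\<lambda>x. complex_of_real (f x)) \<longleftrightarrow> integrable M f"
  using integrable_Re[of M "\<lambda>x. complex_of_real (f x)"] by auto

lemma
  fixes \<xi> :: "'a::euclidean_space"
  assumes a: "a > 0"
  shows integrable_gaussian: "integrable lebesgue (\<lambda>x::'a. exp (- a * (norm x)\<^sup>2))"
    and fourier_gaussian: "fourier (\<lambda>x::'a. complex_of_real (exp (- a * (norm x)\<^sup>2))) \<xi> =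
       of_real ((2 * a) powr (- real DIM('a) / 2) * exp (- (norm \<xi>)\<^sup>2 / (4 * a)))"
proof -
  define c where "c = sqrt (2 * a)"
  have c: "c > 0" "c\<^sup>2 = 2 * a" using a by (auto simp: c_def)
  have eq: "(\<lambda>x::'a. complex_of_real (exp (- a * (norm x)\<^sup>2))) = (\<lambda>x. complex_of_real (exp (- (norm (0 + c *\<^sub>R x))\<^sup>2 / 2)))"
    using c by (auto simp: power_mult_distrib)
  have "integrable lebesgue (\<lambda>x::'a. complex_of_real (exp (- a * (norm x)\<^sup>2)))"
    unfolding eq using c
    by (subst integrable_affine[where f="\<lambda>x::'a. complex_of_real (exp (- (norm x)\<^sup>2 / 2))"])
       (use integrable_std_gaussian[where 'a='a] in simp_all)
  then show "integrable lebesgue (\<lambda>x::'a. exp (- a * (norm x)\<^sup>2))"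
    by (simp add: integrable_of_real_iff)
  have "1 / c ^ DIM('a) = (2 * a) powr (- real DIM('a) / 2)"
    using a unfolding c_def
    by (simp add: powr_half_sqrt[symmetric] powr_realpow[symmetric] powr_powr powr_minus_divide)
  then show "fourier (\<lambda>x::'a. complex_of_real (exp (- a * (norm x)\<^sup>2))) \<xi> =
       of_real ((2 * a) powr (- real DIM('a) / 2) * exp (- (norm \<xi>)\<^sup>2 / (4 * a)))"
    unfolding eq using c fourier_scale[OF c(1), of "\<lambda>x::'a. complex_of_real (exp (- (norm x)\<^sup>2 / 2))" \<xi>]
      fourier_std_gaussian[of "(1 / c) *\<^sub>R \<xi>"]
    by (simp add: power_divide)
qed

lemma integral_std_gaussian:
  "(LINT x|lebesgue. exp (- (norm (x::'a::euclidean_space))\<^sup>2 / 2)) = (2 * pi) powr (real DIM('a) / 2)"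
proof -
  have "complex_of_real ((2 * pi) powr (- real DIM('a) / 2) * (LINT x|lebesgue. exp (- (norm (x::'a::euclidean_space))\<^sup>2 / 2))) = of_real 1"
    using fourier_std_gaussian[of "0::'a"] unfolding fourier_def by simp
  then have "(2 * pi) powr (- real DIM('a) / 2) * (LINT x|lebesgue. exp (- (norm (x::'a::euclidean_space))\<^sup>2 / 2)) = 1"
    unfolding of_real_eq_iff .
  then show ?thesis by (simp add: powr_minus_divide field_simps)
qed

text \<open>Modulation translates the transform to x and dilation contracts it to width e. The
  result is the heat kernel centred at x, multiplied by (2 pi)^(n/2).\<close>

lemma fourier_modulated_gaussian:
  fixes x y :: "'a::euclidean_space"
  assumes e: "e > 0"
  shows "fourier (\<lambda>\<xi>. cis (x \<bullet> \<xi>) * complex_of_real (exp (- (norm (e *\<^sub>R \<xi>))\<^sup>2 / 2))) y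
    = of_real (1 / e ^ DIM('a) * exp (- (norm ((1 / e) *\<^sub>R (y - x)))\<^sup>2 / 2))"
    and "integrable lebesgue (\<lambda>\<xi>. cis (x \<bullet> \<xi>) * complex_of_real (exp (- (norm (e *\<^sub>R \<xi>))\<^sup>2 / 2)))"
proof -
  have "fourier (\<lambda>\<xi>. cis (x \<bullet> \<xi>) * complex_of_real (exp (- (norm (e *\<^sub>R \<xi>))\<^sup>2 / 2))) y =
    fourier (\<lambda>\<xi>. complex_of_real (exp (- (norm (e *\<^sub>R \<xi>))\<^sup>2 / 2))) (y - x)"
    unfolding fourier_def
    by (simp add: mult.assoc[symmetric] cis_mult inner_diff_right inner_commute)
  then show "fourier (\<lambda>\<xi>. cis (x \<bullet> \<xi>) * complex_of_real (exp (- (norm (e *\<^sub>R \<xi>))\<^sup>2 / 2))) y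
    = of_real (1 / e ^ DIM('a) * exp (- (norm ((1 / e) *\<^sub>R (y - x)))\<^sup>2 / 2))"
    by (simp only: fourier_scale[OF e, of "\<lambda>\<xi>. complex_of_real (exp (- (norm \<xi>)\<^sup>2 / 2))"] fourier_std_gaussian of_real_mult)
  show "integrable lebesgue (\<lambda>\<xi>. cis (x \<bullet> \<xi>) * complex_of_real (exp (- (norm (e *\<^sub>R \<xi>))\<^sup>2 / 2)))"
    using integrable_affine[of e "\<lambda>\<xi>::'a. complex_of_real (exp (- (norm \<xi>)\<^sup>2 / 2))" 0] e integrable_std_gaussian
    by (intro integrable_cis_mult measurable_compose[OF ident_lebesgue_borel]) auto
qed

text \<open>Gaussian summability: damping the inverse integral by exp (- |e \<xi>|^2 / 2) and
  applying the multiplication formula gives an average of \<open>f\<close> around x at scale e. As e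
  tends to 0, one side converges by integrability of \<open>fourier f\<close>, the other by
  continuity and boundedness of \<open>f\<close>.\<close>

theorem fourier_inversion:
  fixes f :: "'a::euclidean_space \<Rightarrow> complex"
  assumes f: "integrable lebesgue f" "continuous_on UNIV f" "\<And>x. norm (f x) \<le> B"
    and ff: "integrable lebesgue (fourier f)"
  shows "inv_fourier (fourier f) x = f x"
proof -
  define e where "e k = 1 / real (Suc k)" for k
  have e: "e k > 0" "e \<longlonglongrightarrow> 0" for k
    unfolding e_def using LIMSEQ_inverse_real_of_nat by (auto simp: inverse_eq_divide)
  define G where "G k \<xi> = cis (x \<bullet> \<xi>) * complex_of_real (exp (- (norm (e k *\<^sub>R \<xi>))\<^sup>2 / 2))" for k \<xi>
  have [measurable]: "f \<in> borel_measurable lebesgue" "fourier f \<in> borel_measurable lebesgue" using f ff by auto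
  note [measurable] = ident_lebesgue_borel
  have mf: "f \<in> borel_measurable borel" using f(2) by (rule borel_measurable_continuous_onI)
  have "(LINT \<xi>|lebesgue. fourier f \<xi> * G k \<xi>) =
      (LINT z|lebesgue. f (x + e k *\<^sub>R z) * complex_of_real (exp (- (norm z)\<^sup>2 / 2)))" for k
  proof -
    have "(LINT \<xi>|lebesgue. fourier f \<xi> * G k \<xi>) = (LINT y|lebesgue. f y * fourier (G k) y)"
      unfolding G_def by (intro fourier_mult_swap[symmetric] f fourier_modulated_gaussian e)
    also have "\<dots> = (LINT y|lebesgue. (1 / e k ^ DIM('a)) *\<^sub>R (f y * complex_of_real (exp (- (norm ((1 / e k) *\<^sub>R (y - x)))\<^sup>2 / 2))))"
      unfolding G_def fourier_modulated_gaussian[OF e(1)] by (simp add: scaleR_conv_of_real mult_ac)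
    also have "\<dots> = (1 / e k ^ DIM('a)) *\<^sub>R (LINT y|lebesgue. f y * complex_of_real (exp (- (norm ((1 / e k) *\<^sub>R (y - x)))\<^sup>2 / 2)))"
      by (simp only: integral_scaleR_right)
    also have "\<dots> = (LINT z|lebesgue. f (x + e k *\<^sub>R z) * complex_of_real (exp (- (norm ((1 / e k) *\<^sub>R (x + e k *\<^sub>R z - x)))\<^sup>2 / 2)))"
      using e(1)[of k] by (subst integral_affine[where c="e k"]) auto
    finally show ?thesis using e(1)[of k] by simp
  qed
  moreover have "AE \<xi> in lebesgue. (\<lambda>k. fourier f \<xi> * G k \<xi>) \<longlonglongrightarrow> fourier f \<xi> * (cis (x \<bullet> \<xi>) * complex_of_real (exp (- (norm (0 *\<^sub>R \<xi>))\<^sup>2 / 2)))"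
    unfolding G_def by (intro AE_I2 tendsto_intros e) auto
  then have "(\<lambda>k. LINT \<xi>|lebesgue. fourier f \<xi> * G k \<xi>) \<longlonglongrightarrow> (LINT \<xi>|lebesgue. fourier f \<xi> * (cis (x \<bullet> \<xi>) * complex_of_real (exp (- (norm (0 *\<^sub>R \<xi>))\<^sup>2 / 2))))"
    unfolding G_def
    by (intro integral_dominated_convergence[where w="\<lambda>\<xi>. norm (fourier f \<xi>)"])
       (use ff in \<open>auto simp: norm_mult simp del: norm_scaleR intro!: mult_left_le\<close>)
  moreover have "(\<lambda>k. LINT z|lebesgue. f (x + e k *\<^sub>R z) * complex_of_real (exp (- (norm z)\<^sup>2 / 2))) \<longlonglongrightarrow>
      (LINT z|lebesgue. f (x + 0 *\<^sub>R z) * complex_of_real (exp (- (norm z)\<^sup>2 / 2)))"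
  proof (rule integral_dominated_convergence[where w="\<lambda>z. B * exp (- (norm z)\<^sup>2 / 2)"])
    show "integrable lebesgue (\<lambda>z::'a. B * exp (- (norm z)\<^sup>2 / 2))"
      using integrable_std_gaussian[where 'a='a] by (simp add: integrable_of_real_iff)
    have "(\<lambda>z::'a. f (x + e k *\<^sub>R z)) \<in> borel_measurable lborel" for k
      by (rule measurable_compose[OF _ mf]) simp
    then have [measurable]: "(\<lambda>z::'a. f (x + e k *\<^sub>R z)) \<in> borel_measurable lebesgue" for k
      by (rule measurable_completion)
    show "(\<lambda>z. f (x + e k *\<^sub>R z) * complex_of_real (exp (- (norm z)\<^sup>2 / 2))) \<in> borel_measurable lebesgue" for k
      by measurable
    show "AE z in lebesgue. (\<lambda>k. f (x + e k *\<^sub>R z) * complex_of_real (exp (- (norm z)\<^sup>2 / 2))) \<longlonglongrightarrow> f (x + 0 *\<^sub>R z) * complex_of_real (exp (- (norm z)\<^sup>2 / 2))"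
      by (intro AE_I2 tendsto_intros continuous_on_tendsto_compose[OF f(2)] e) auto
  qed (auto simp: norm_mult intro!: mult_right_mono f)
  ultimately have "(LINT \<xi>|lebesgue. fourier f \<xi> * cis (x \<bullet> \<xi>)) = f x * (LINT z|lebesgue. complex_of_real (exp (- (norm (z::'a))\<^sup>2 / 2)))"
    using LIMSEQ_unique by fastforce
  also have "(LINT z|lebesgue. complex_of_real (exp (- (norm (z::'a))\<^sup>2 / 2))) = of_real ((2 * pi) powr (real DIM('a) / 2))"
    by (simp only: integral_complex_of_real integral_std_gaussian)
  finally have "(LINT \<xi>|lebesgue. cis (x \<bullet> \<xi>) * fourier f \<xi>) = f x * of_real ((2 * pi) powr (real DIM('a) / 2))"
    by (simp add: mult.commute)
  then show ?thesis unfolding inv_fourier_def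
    by (simp add: powr_minus_divide)
qed

section \<open>The Plancherel inequality for integrable functions\<close>

lemma measurable_cnj [measurable]: "cnj \<in> borel_measurable borel"
  by (intro borel_measurable_continuous_onI continuous_intros)

text \<open>The Schur-type estimate below integrates out each of the two variables in turn, hence
  the two versions. The mass (2 pi)^(n/2) is the inverse of the constant in
  \<open>fourier\<close>.\<close>

lemma nn_integral_heat_kernel:
  fixes x :: "'a::euclidean_space"
  assumes e: "e > 0"
  shows "(\<integral>\<^sup>+y. ennreal (1 / e ^ DIM('a) * exp (- (norm ((1 / e) *\<^sub>R (x - y)))\<^sup>2 / 2)) \<partial>lebesgue) = ennreal ((2 * pi) powr (real DIM('a) / 2))"
    and "(\<integral>\<^sup>+y. ennreal (1 / e ^ DIM('a) * exp (- (norm ((1 / e) *\<^sub>R (y - x)))\<^sup>2 / 2)) \<partial>lebesgue) = ennreal ((2 * pi) powr (real DIM('a) / 2))"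
proof -
  let ?g = "\<lambda>z::'a. 1 / e ^ DIM('a) * exp (- (norm z)\<^sup>2 / 2)"
  have g: "integrable lebesgue ?g"
    using integrable_std_gaussian[where 'a='a, unfolded integrable_of_real_iff] by (rule integrable_mult_right)
  have "integrable lebesgue (\<lambda>y. ?g ((1 / e) *\<^sub>R x + (- 1 / e) *\<^sub>R y))"
    using e integrable_affine[where f="?g" and c="-1/e" and t="(1 / e) *\<^sub>R x"] g by auto
  moreover have "(LINT y|lebesgue. ?g ((1 / e) *\<^sub>R x + (- 1 / e) *\<^sub>R y)) = (2 * pi) powr (real DIM('a) / 2)"
    using e by (subst integral_affine[where f="?g" and c="-1/e" and t="(1 / e) *\<^sub>R x"])
      (use integral_std_gaussian[where 'a='a] in \<open>auto simp: power_divide\<close>)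
  moreover have "(\<lambda>y. ?g ((1 / e) *\<^sub>R (x - y))) = (\<lambda>y. ?g ((1 / e) *\<^sub>R x + (- 1 / e) *\<^sub>R y))"
    by (simp add: scaleR_diff_right)
  ultimately have "integrable lebesgue (\<lambda>y. ?g ((1 / e) *\<^sub>R (x - y)))"
    and "(LINT y|lebesgue. ?g ((1 / e) *\<^sub>R (x - y))) = (2 * pi) powr (real DIM('a) / 2)"
    by (simp_all only:)
  then show *: "(\<integral>\<^sup>+y. ennreal (?g ((1 / e) *\<^sub>R (x - y))) \<partial>lebesgue) = ennreal ((2 * pi) powr (real DIM('a) / 2))"
    using e by (subst nn_integral_eq_integral) auto
  have "norm ((1 / e) *\<^sub>R (y - x)) = norm ((1 / e) *\<^sub>R (x - y))" for y by (simp add: norm_minus_commute)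
  with * show "(\<integral>\<^sup>+y. ennreal (?g ((1 / e) *\<^sub>R (y - x))) \<partial>lebesgue) = ennreal ((2 * pi) powr (real DIM('a) / 2))"
    by (simp only:)
qed

lemma norm_integral_le_nn_integral:
  fixes f :: "'p \<Rightarrow> 'b::{banach, second_countable_topology}"
  shows "ennreal (norm (integral\<^sup>L M f)) \<le> (\<integral>\<^sup>+x. ennreal (norm (f x)) \<partial>M)"
  using integral_norm_bound_ennreal[of M f] by (cases "integrable M f") (auto simp: not_integrable_integral_eq)

text \<open>The damped square of \<open>fourier w\<close> is \<open>fourier w\<close> times a
  superposition of modulated Gaussians. The multiplication formula turns its integral into a double
  integral of w(x) cnj(w(y)) k(x - y) with the heat kernel k, and Schur's test bounds that. The
  damping makes the Fourier side converge for merely integrable \<open>w\<close>; the right side may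
  be infinite.\<close>

lemma norm_fourier_gaussian_le:
  fixes w :: "'a::euclidean_space \<Rightarrow> complex"
  assumes w: "integrable lebesgue w" and e: "e > 0"
  shows "(\<integral>\<^sup>+\<xi>. ennreal ((norm (fourier w \<xi>))\<^sup>2 * exp (- (norm (e *\<^sub>R \<xi>))\<^sup>2 / 2)) \<partial>lebesgue)
    \<le> (\<integral>\<^sup>+x. ennreal ((norm (w x))\<^sup>2) \<partial>lebesgue)"
proof -
  note [measurable] = ident_lebesgue_borel
  have [measurable]: "w \<in> borel_measurable lebesgue" using w by auto
  have [measurable]: "fourier w \<in> borel_measurable lebesgue" by (rule measurable_fourier_lebesgue[OF w])
  define c where "c = (2 * pi) powr (- real DIM('a) / 2)"
  define C where "C = (2 * pi) powr (real DIM('a) / 2)"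
  have c: "c > 0" "C > 0" "c * C = 1" by (auto simp: c_def C_def simp flip: powr_add)
  define G where "G \<xi> = complex_of_real (exp (- (norm (e *\<^sub>R \<xi>))\<^sup>2 / 2))" for \<xi> :: 'a
  define k where "k x = 1 / e ^ DIM('a) * exp (- (norm ((1 / e) *\<^sub>R x))\<^sup>2 / 2)" for x :: 'a
  have k: "k x \<ge> 0" for x using e by (simp add: k_def)
  have mk [measurable]: "k \<in> borel_measurable borel" unfolding k_def by measurable
  have [measurable]: "(\<lambda>y. k (x - y)) \<in> borel_measurable lebesgue" for x
    by (rule measurable_compose[OF _ mk]) measurable
  have G: "integrable lebesgue G"
    using fourier_modulated_gaussian(2)[OF e, of "0::'a"] unfolding G_def by (simp del: norm_scaleR)
  \<comment> \<open>Superposing these modulated Gaussians over y with weights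
    \<open>cnj (w y)\<close> reproduces, up to the constant c, the conjugate of
    \<open>fourier w\<close> times the Gaussian, while the transform of each of them is
    known.\<close>
  define H where "H = (\<lambda>y \<xi>. cnj (w y) * (cis (y \<bullet> \<xi>) * G \<xi>))"
  have "integrable (lebesgue \<Otimes>\<^sub>M lebesgue) (\<lambda>z. cis (fst z \<bullet> snd z) * (\<lambda>(y, \<xi>). cnj (w y) * G \<xi>) z)"
    by (intro integrable_cis_mult integrable_product sigma_finite_lebesgue G) (use w in auto)
  then have H: "integrable (lebesgue \<Otimes>\<^sub>M lebesgue) (\<lambda>(y, \<xi>). H y \<xi>)"
    by (simp add: case_prod_unfold H_def mult_ac)
  define h where "h = (\<lambda>\<xi>. LINT y|lebesgue. H y \<xi>)"
  have hi: "integrable lebesgue h"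
    unfolding h_def by (rule lebesgue_pair.integrable_snd[OF H])
  have h: "of_real c * h \<xi> = cnj (fourier w \<xi>) * G \<xi>" for \<xi>
  proof -
    have "(LINT y|lebesgue. cnj (cis (- (y \<bullet> \<xi>)) * w y)) = cnj (LINT y|lebesgue. cis (- (y \<bullet> \<xi>)) * w y)"
      by (rule Bochner_Integration.integral_cnj)
    moreover have "h \<xi> = (LINT y|lebesgue. cnj (cis (- (y \<bullet> \<xi>)) * w y) * G \<xi>)"
      unfolding h_def H_def by (simp add: cis_cnj mult_ac)
    ultimately show ?thesis by (simp add: fourier_def c_def)
  qed
  have fh: "fourier h x = (LINT y|lebesgue. cnj (w y) * of_real (k (x - y)))" for x
  proof -
    have "fourier (H y) x = cnj (w y) * of_real (k (x - y))" for y
    proof -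
      have "fourier (H y) x = cnj (w y) * fourier (\<lambda>\<xi>. cis (y \<bullet> \<xi>) * G \<xi>) x"
        unfolding fourier_def H_def by (simp add: mult.left_commute[of _ "cnj (w y)"])
      then show ?thesis unfolding G_def fourier_modulated_gaussian(1)[OF e] k_def .
    qed
    then show ?thesis unfolding h_def fourier_integral[OF sigma_finite_lebesgue H] by simp
  qed
  \<comment> \<open>Schur's test: this symmetrises the double integral, after which each square
    meets the kernel integrated in the other variable.\<close>
  have sq: "ennreal (2 * (a * b) * r) \<le> ennreal (a\<^sup>2 * r) + ennreal (b\<^sup>2 * r)" if "r \<ge> 0" for a b r :: real
    using that sum_squares_bound[of a b]
    by (subst ennreal_plus[symmetric]) (auto intro!: ennreal_leI simp flip: distrib_right intro: mult_right_mono)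
  have "ennreal (norm (LINT \<xi>|lebesgue. fourier w \<xi> * h \<xi>)) = ennreal (norm (LINT x|lebesgue. w x * fourier h x))"
    using fourier_mult_swap[OF w hi] by simp
  also have "\<dots> \<le> (\<integral>\<^sup>+x. ennreal (norm (w x * fourier h x)) \<partial>lebesgue)"
    by (rule norm_integral_le_nn_integral)
  also have "\<dots> \<le> (\<integral>\<^sup>+x. (\<integral>\<^sup>+y. ennreal (norm (w x) * norm (w y) * k (x - y)) \<partial>lebesgue) \<partial>lebesgue)"
  proof (intro nn_integral_mono)
    fix x
    have "ennreal (norm (w x * fourier h x)) = ennreal (norm (w x)) * ennreal (norm (fourier h x))"
      by (simp add: norm_mult ennreal_mult')
    also have "\<dots> \<le> ennreal (norm (w x)) * (\<integral>\<^sup>+y. ennreal (norm (cnj (w y) * of_real (k (x - y)))) \<partial>lebesgue)"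
      unfolding fh by (intro mult_left_mono norm_integral_le_nn_integral) auto
    also have "\<dots> = (\<integral>\<^sup>+y. ennreal (norm (w x)) * ennreal (norm (cnj (w y) * of_real (k (x - y)))) \<partial>lebesgue)"
      by (rule nn_integral_cmult[symmetric]) measurable
    finally show "ennreal (norm (w x * fourier h x)) \<le> (\<integral>\<^sup>+y. ennreal (norm (w x) * norm (w y) * k (x - y)) \<partial>lebesgue)"
      using k by (simp add: norm_mult ennreal_mult' mult.assoc)
  qed
  finally have 1: "ennreal (norm (LINT \<xi>|lebesgue. fourier w \<xi> * h \<xi>)) \<le> (\<integral>\<^sup>+x. (\<integral>\<^sup>+y. ennreal (norm (w x) * norm (w y) * k (x - y)) \<partial>lebesgue) \<partial>lebesgue)" .
  have "2 * (\<integral>\<^sup>+x. (\<integral>\<^sup>+y. ennreal (norm (w x) * norm (w y) * k (x - y)) \<partial>lebesgue) \<partial>lebesgue)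
     = (\<integral>\<^sup>+x. (\<integral>\<^sup>+y. 2 * ennreal (norm (w x) * norm (w y) * k (x - y)) \<partial>lebesgue) \<partial>lebesgue)"
    by (simp add: nn_integral_cmult)
  also have "\<dots> \<le> (\<integral>\<^sup>+x. (\<integral>\<^sup>+y. ennreal ((norm (w x))\<^sup>2 * k (x - y)) + ennreal ((norm (w y))\<^sup>2 * k (x - y)) \<partial>lebesgue) \<partial>lebesgue)"
    using sq[OF k] k by (intro nn_integral_mono) (simp add: mult.assoc flip: ennreal_mult'' ennreal_numeral)
  also have "\<dots> = (\<integral>\<^sup>+x. (\<integral>\<^sup>+y. ennreal ((norm (w x))\<^sup>2 * k (x - y)) \<partial>lebesgue) \<partial>lebesgue) + (\<integral>\<^sup>+x. (\<integral>\<^sup>+y. ennreal ((norm (w y))\<^sup>2 * k (x - y)) \<partial>lebesgue) \<partial>lebesgue)"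
    by (subst nn_integral_add[symmetric]) (auto intro!: nn_integral_cong nn_integral_add lebesgue.borel_measurable_nn_integral)
  also have "(\<integral>\<^sup>+x. (\<integral>\<^sup>+y. ennreal ((norm (w y))\<^sup>2 * k (x - y)) \<partial>lebesgue) \<partial>lebesgue) = (\<integral>\<^sup>+y. (\<integral>\<^sup>+x. ennreal ((norm (w y))\<^sup>2 * k (x - y)) \<partial>lebesgue) \<partial>lebesgue)"
    by (rule lebesgue_pair.Fubini') measurable
  also have "\<dots> = (\<integral>\<^sup>+x. ennreal ((norm (w x))\<^sup>2) \<partial>lebesgue) * ennreal C"
    using k nn_integral_heat_kernel(2)[OF e, where 'a='a, folded k_def C_def]
    by (simp add: ennreal_mult'' nn_integral_cmult nn_integral_multc)
  also have "(\<integral>\<^sup>+x. (\<integral>\<^sup>+y. ennreal ((norm (w x))\<^sup>2 * k (x - y)) \<partial>lebesgue) \<partial>lebesgue) = (\<integral>\<^sup>+x. ennreal ((norm (w x))\<^sup>2) \<partial>lebesgue) * ennreal C"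
    using k nn_integral_heat_kernel(1)[OF e, where 'a='a, folded k_def C_def]
    by (simp add: ennreal_mult'' nn_integral_cmult nn_integral_multc)
  finally have 2: "(\<integral>\<^sup>+x. (\<integral>\<^sup>+y. ennreal (norm (w x) * norm (w y) * k (x - y)) \<partial>lebesgue) \<partial>lebesgue) \<le> (\<integral>\<^sup>+x. ennreal ((norm (w x))\<^sup>2) \<partial>lebesgue) * ennreal C"
    unfolding mult_2[symmetric] by (subst (asm) ennreal_mult_le_mult_iff) auto
  \<comment> \<open>The damped square is c times \<open>fourier w \<xi> * h \<xi>\<close>, whose
    integral has just been estimated; c * C = 1 leaves the constant 1.\<close>
  define F where "F \<xi> = (norm (fourier w \<xi>))\<^sup>2 * exp (- (norm (e *\<^sub>R \<xi>))\<^sup>2 / 2)" for \<xi>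
  have F: "of_real (F \<xi>) = of_real c * (fourier w \<xi> * h \<xi>)" for \<xi>
  proof -
    have "of_real (F \<xi>) = fourier w \<xi> * (cnj (fourier w \<xi>) * G \<xi>)"
      by (simp only: F_def G_def of_real_mult complex_norm_square mult.assoc)
    then show ?thesis by (simp only: mult.left_commute[of "of_real c"] h)
  qed
  have "integrable lebesgue (\<lambda>\<xi>. fourier w \<xi> * h \<xi>)"
  proof (rule Bochner_Integration.integrable_bound)
    show "integrable lebesgue (\<lambda>\<xi>. (c * (LINT x|lebesgue. norm (w x))) * norm (h \<xi>))"
      using hi by (intro integrable_mult_right) auto
    show "AE \<xi> in lebesgue. norm (fourier w \<xi> * h \<xi>) \<le> norm ((c * (LINT x|lebesgue. norm (w x))) * norm (h \<xi>))"
      using norm_fourier_le[OF w] c by (intro AE_I2) (auto simp: norm_mult c_def intro!: mult_right_mono)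
  qed (use hi in measurable)
  then have "integrable lebesgue (\<lambda>\<xi>. complex_of_real (F \<xi>))"
    unfolding F by (rule integrable_mult_right)
  then have Fi: "integrable lebesgue F" by (simp only: integrable_of_real_iff)
  have "(\<integral>\<^sup>+\<xi>. ennreal (F \<xi>) \<partial>lebesgue) = ennreal (LINT \<xi>|lebesgue. F \<xi>)"
    by (rule nn_integral_eq_integral[OF Fi]) (auto simp: F_def)
  also have "(LINT \<xi>|lebesgue. F \<xi>) = norm (of_real (LINT \<xi>|lebesgue. F \<xi>) :: complex)"
    unfolding norm_of_real by (rule abs_of_nonneg[symmetric]) (auto simp: F_def)
  also have "of_real (LINT \<xi>|lebesgue. F \<xi>) = of_real c * (LINT \<xi>|lebesgue. fourier w \<xi> * h \<xi>)"
    by (simp only: integral_complex_of_real[symmetric] F integral_mult_right_zero)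
  also have "ennreal (norm \<dots>) = ennreal c * ennreal (norm (LINT \<xi>|lebesgue. fourier w \<xi> * h \<xi>))"
    using c by (simp add: norm_mult ennreal_mult')
  also have "\<dots> \<le> ennreal c * ((\<integral>\<^sup>+x. ennreal ((norm (w x))\<^sup>2) \<partial>lebesgue) * ennreal C)"
    using 1 2 by (intro mult_left_mono) auto
  also have "\<dots> = ennreal (c * C) * (\<integral>\<^sup>+x. ennreal ((norm (w x))\<^sup>2) \<partial>lebesgue)"
    by (simp only: ennreal_mult'[of c C, OF less_imp_le[OF c(1)]]) (simp only: mult_ac)
  finally show ?thesis unfolding F_def c(3) by simp
qed

text \<open>Fatou's lemma as the Gaussian damping is removed.\<close>

lemma nn_integral_fourier_le:
  fixes w :: "'a::euclidean_space \<Rightarrow> complex"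
  assumes w: "integrable lebesgue w"
  shows "(\<integral>\<^sup>+\<xi>. ennreal ((norm (fourier w \<xi>))\<^sup>2) \<partial>lebesgue) \<le> (\<integral>\<^sup>+x. ennreal ((norm (w x))\<^sup>2) \<partial>lebesgue)"
proof -
  note [measurable] = ident_lebesgue_borel measurable_fourier_lebesgue[OF w]
  define e where "e k = 1 / real (Suc k)" for k
  have e: "e k > 0" "e \<longlonglongrightarrow> 0" for k
    unfolding e_def using LIMSEQ_inverse_real_of_nat by (auto simp: inverse_eq_divide)
  define F where "F k \<xi> = ennreal ((norm (fourier w \<xi>))\<^sup>2 * exp (- (norm (e k *\<^sub>R \<xi>))\<^sup>2 / 2))" for k \<xi>
  have [measurable]: "F k \<in> borel_measurable lebesgue" for k unfolding F_def by measurable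
  have "(\<lambda>k. F k \<xi>) \<longlonglongrightarrow> ennreal ((norm (fourier w \<xi>))\<^sup>2 * exp (- (norm (0 *\<^sub>R \<xi>))\<^sup>2 / 2))" for \<xi>
    unfolding F_def by (intro tendsto_intros e) auto
  then have "ennreal ((norm (fourier w \<xi>))\<^sup>2) = liminf (\<lambda>k. F k \<xi>)" for \<xi>
    using lim_imp_Liminf[of sequentially "\<lambda>k. F k \<xi>"] by (metis exp_zero mult.right_neutral norm_zero scaleR_zero_left
        div_0 minus_zero power_zero_numeral sequentially_bot)
  then have "(\<integral>\<^sup>+\<xi>. ennreal ((norm (fourier w \<xi>))\<^sup>2) \<partial>lebesgue) = (\<integral>\<^sup>+\<xi>. liminf (\<lambda>k. F k \<xi>) \<partial>lebesgue)"
    by simp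
  also have "\<dots> \<le> liminf (\<lambda>k. \<integral>\<^sup>+\<xi>. F k \<xi> \<partial>lebesgue)"
    by (rule nn_integral_liminf) measurable
  also have "\<dots> \<le> (\<integral>\<^sup>+x. ennreal ((norm (w x))\<^sup>2) \<partial>lebesgue)"
    by (rule Liminf_le) (unfold F_def, simp, intro always_eventually allI norm_fourier_gaussian_le[OF w e(1)])
  finally show ?thesis .
qed

section \<open>Smooth functions and bump functions\<close>

lemma C_k_continuous: "C_k k f \<Longrightarrow> continuous_on UNIV f"
proof (cases k)
  case (Suc j)
  assume "C_k k f"
  with Suc have "f differentiable_on UNIV" by (auto simp: differentiable_on_def)
  then show ?thesis by (rule differentiable_imp_continuous_on)
qed simp

lemma C_k_SucD: "C_k (Suc k) f \<Longrightarrow> C_k k f"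
proof (induction k arbitrary: f)
  case 0
  then show ?case using C_k_continuous[OF 0] by simp
next
  case (Suc k)
  then show ?case by (metis C_k.simps(2))
qed

lemma C_k_const [simp]: "C_k k (\<lambda>x. c)"
  by (induction k arbitrary: c) (auto simp: frechet_derivative_const)

lemma C_k_add: "C_k k f \<Longrightarrow> C_k k g \<Longrightarrow> C_k k (\<lambda>x. f x + g x)"
proof (induction k arbitrary: f g)
  case (Suc k)
  have "frechet_derivative (\<lambda>x. f x + g x) (at x) = (\<lambda>h. frechet_derivative f (at x) h + frechet_derivative g (at x) h)" for x
    using Suc.prems by (intro frechet_derivative_at[symmetric] derivative_intros) (auto simp: frechet_derivative_works)
  then show ?case using Suc by auto
qed (auto intro: continuous_intros)

lemma C_k_mult: "C_k k f \<Longrightarrow> C_k k g \<Longrightarrow> C_k k (\<lambda>x. f x * g x)"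
proof (induction k arbitrary: f g)
  case (Suc k)
  have "frechet_derivative (\<lambda>x. f x * g x) (at x) = (\<lambda>h. f x * frechet_derivative g (at x) h + frechet_derivative f (at x) h * g x)" for x
    using Suc.prems by (intro frechet_derivative_at[symmetric] derivative_intros) (auto simp: frechet_derivative_works)
  then show ?case using Suc.IH Suc.prems Suc.prems[THEN C_k_SucD] by (auto intro!: C_k_add)
qed (auto intro: continuous_intros)

lemma C_k_bounded_linear:
  fixes f :: "'a::euclidean_space \<Rightarrow> real"
  assumes "bounded_linear f" shows "C_k k f"
proof (cases k)
  case 0 then show ?thesis using assms by (auto intro: linear_continuous_on)
next
  case (Suc k)
  have "frechet_derivative f (at x) = f" for x
    using assms by (intro frechet_derivative_at[symmetric] bounded_linear_imp_has_derivative)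
  then show ?thesis using Suc assms by (auto simp: bounded_linear_imp_differentiable)
qed

lemma smooth_const: "smooth (\<lambda>x. c)" by (simp add: smooth_def)
lemma smooth_add: "smooth f \<Longrightarrow> smooth g \<Longrightarrow> smooth (\<lambda>x. f x + g x)" by (simp add: smooth_def C_k_add)
lemma smooth_mult: "smooth f \<Longrightarrow> smooth g \<Longrightarrow> smooth (\<lambda>x. f x * g x)" by (simp add: smooth_def C_k_mult)
lemma smooth_bounded_linear: "bounded_linear f \<Longrightarrow> smooth f" by (simp add: smooth_def C_k_bounded_linear)
lemma smooth_sum: "(\<And>i. i \<in> I \<Longrightarrow> smooth (f i)) \<Longrightarrow> smooth (\<lambda>x. \<Sum>i\<in>I. f i x)"
  by (induction I rule: infinite_finite_induct) (auto simp: smooth_const smooth_add)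
lemma smooth_power: "smooth f \<Longrightarrow> smooth (\<lambda>x. f x ^ n)"
  by (induction n) (auto simp: smooth_const smooth_mult)

lemma smooth_norm_power2:
  fixes g :: "'a::euclidean_space \<Rightarrow> 'b::euclidean_space"
  assumes "bounded_linear g"
  shows "smooth (\<lambda>x. (norm (g x))\<^sup>2)"
  unfolding norm_power2_Basis
  by (intro smooth_sum smooth_power smooth_bounded_linear bounded_linear_compose[OF bounded_linear_inner_left assms])

text \<open>The outer function comes with all its derivatives as a sequence \<open>h\<close>, so
  that induction on the order, for all j at once, only meets \<open>h (Suc j)\<close> composed with
  f times a derivative of f. The set \<open>S\<close> admits real powers, which are differentiated
  on the positive reals only.\<close>

lemma smooth_compose:
  fixes h :: "nat \<Rightarrow> real \<Rightarrow> real" and f :: "'a::euclidean_space \<Rightarrow> real"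
  assumes h: "\<And>j y. y \<in> S \<Longrightarrow> (h j has_real_derivative h (Suc j) y) (at y)"
    and f: "smooth f" "\<And>x. f x \<in> S"
  shows "smooth (\<lambda>x. h j (f x))"
proof -
  have hc: "isCont (h j) y" if "y \<in> S" for j y using h[OF that] by (rule DERIV_isCont)
  have "C_k k (\<lambda>x. h j (f x))" for k j
  proof (induction k arbitrary: j)
    case 0
    have "continuous_on UNIV f" using f(1) by (auto simp: smooth_def intro: C_k_continuous)
    then show ?case using f hc
      by (auto intro!: continuous_at_imp_continuous_on isCont_o2[where g="h j" and f=f] simp: continuous_on_eq_continuous_at)
  next
    case (Suc k)
    have fd: "(f has_derivative frechet_derivative f (at x)) (at x)" for x
      using f(1) by (auto simp: smooth_def frechet_derivative_works[symmetric] dest: spec[of _ "Suc 0"])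
    have d: "((\<lambda>x. h j (f x)) has_derivative (\<lambda>v. h (Suc j) (f x) * frechet_derivative f (at x) v)) (at x)" for x
      using has_derivative_compose[OF fd[of x] h[OF f(2), unfolded has_field_derivative_def]] by simp
    have "C_k (Suc k) f" using f(1) by (simp add: smooth_def)
    then show ?case using Suc.IH[of "Suc j"] d frechet_derivative_at[OF d, symmetric]
      by (auto intro!: C_k_mult simp: differentiable_def)
  qed
  then show ?thesis by (simp add: smooth_def)
qed

text \<open>Derivatives of \<open>exp (- 1 / t)\<close> are polynomials in \<open>1 / t\<close> times the function itself.\<close>

primrec flat_poly :: "nat \<Rightarrow> real poly" where
  "flat_poly 0 = 1"
| "flat_poly (Suc k) = [:0, 0, 1:] * (flat_poly k - pderiv (flat_poly k))"

definition flat :: "nat \<Rightarrow> real \<Rightarrow> real" where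
  "flat k t = (if t > 0 then poly (flat_poly k) (1 / t) * exp (- 1 / t) else 0)"

lemma tendsto_poly_exp_minus: "((\<lambda>x::real. poly p x * exp (- x)) \<longlongrightarrow> 0) at_top"
proof -
  have "((\<lambda>x::real. coeff p k * (x ^ k * exp (- x))) \<longlongrightarrow> 0) at_top" for k
    using tendsto_power_div_exp_0[of k] by (intro tendsto_mult_right_zero) (simp add: exp_minus field_simps)
  then have "((\<lambda>x::real. \<Sum>i\<le>degree p. coeff p i * (x ^ i * exp (- x))) \<longlongrightarrow> 0) at_top"
    using tendsto_sum[of "{..degree p}" "\<lambda>i x. coeff p i * (x ^ i * exp (- x))" "\<lambda>_. 0"] by simp
  then show ?thesis by (simp add: poly_altdef sum_distrib_right mult.assoc)
qed

text \<open>For t > 0 the recursion of \<open>flat_poly\<close> is the product and chain rule in the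
  variable 1 / t. At t = 0 the difference quotient from the right is again a polynomial in 1 / t,
  with one more factor 1 / t, times exp (- 1 / t), and exponential decay wins.\<close>

lemma DERIV_flat: "(flat k has_real_derivative flat (Suc k) t) (at t)"
proof -
  consider "t < 0" | "t > 0" | "t = 0" by linarith
  then show ?thesis
  proof cases
    case 1
    have "((\<lambda>_. 0) has_real_derivative 0) (at t)" by simp
    then have "(flat k has_real_derivative 0) (at t)"
      by (rule has_field_derivative_transform_within_open[of _ _ _ "{..<0}"]) (use 1 in \<open>auto simp: flat_def\<close>)
    then show ?thesis using 1 by (simp add: flat_def)
  next
    case 2
    have "((\<lambda>t. poly (flat_poly k) (1 / t) * exp (- 1 / t)) has_real_derivative
        poly (pderiv (flat_poly k)) (1 / t) * (- 1 / t\<^sup>2) * exp (- 1 / t) + poly (flat_poly k) (1 / t) * (exp (- 1 / t) * (1 / t\<^sup>2))) (at t)"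
      using 2 by (auto intro!: derivative_eq_intros DERIV_chain2[OF poly_DERIV] simp: power2_eq_square)
    also have "poly (pderiv (flat_poly k)) (1 / t) * (- 1 / t\<^sup>2) * exp (- 1 / t) + poly (flat_poly k) (1 / t) * (exp (- 1 / t) * (1 / t\<^sup>2)) = flat (Suc k) t"
      using 2 by (simp add: flat_def power2_eq_square algebra_simps)
    finally show ?thesis
      by (rule has_field_derivative_transform_within_open[of _ _ _ "{0<..}"]) (use 2 in \<open>auto simp: flat_def\<close>)
  next
    case 3
    have "((\<lambda>t. flat k t / t) \<longlongrightarrow> 0) (at_right 0)"
    proof -
      have "((\<lambda>x::real. poly ([:0, 1:] * flat_poly k) x * exp (- x)) \<longlongrightarrow> 0) at_top"
        by (rule tendsto_poly_exp_minus)
      then have "((\<lambda>t::real. poly ([:0, 1:] * flat_poly k) (inverse t) * exp (- inverse t)) \<longlongrightarrow> 0) (at_right 0)"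
        by (rule filterlim_compose) (rule filterlim_inverse_at_top_right)
      moreover have "\<forall>\<^sub>F t in at_right 0. poly ([:0, 1:] * flat_poly k) (inverse t) * exp (- inverse t) = flat k t / t"
        by (auto simp: eventually_at_right_field flat_def inverse_eq_divide intro!: exI[of _ 1])
      ultimately show ?thesis by (rule Lim_transform_eventually)
    qed
    moreover have "((\<lambda>t. flat k t / t) \<longlongrightarrow> 0) (at_left 0)"
      by (rule Lim_transform_eventually[of "\<lambda>_. 0"]) (auto simp: eventually_at_left_field flat_def intro!: exI[of _ "-1"])
    ultimately have "((\<lambda>t. flat k t / t) \<longlongrightarrow> 0) (at 0)"
      by (simp add: filterlim_split_at)
    then show ?thesis using 3 by (simp add: has_field_derivative_iff flat_def)
  qed
qed

text \<open>The factor \<open>exp 1\<close> normalises the value at the origin to 1, and the squared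
  norm keeps the function smooth there.\<close>

definition bump :: "'a::euclidean_space \<Rightarrow> real" where
  "bump x = exp 1 * flat 0 (1 - (norm x)\<^sup>2)"

lemma flat_0: "flat 0 t = (if t > 0 then exp (- 1 / t) else 0)"
  by (simp add: flat_def)

lemma bump_bounds: "0 \<le> bump x" "bump x \<le> 1"
proof -
  have "exp 1 * exp (- 1 / (1 - (norm x)\<^sup>2)) \<le> exp 0" if "0 < 1 - (norm x)\<^sup>2"
    using that unfolding exp_add[symmetric] exp_le_cancel_iff by (simp add: field_simps)
  then show "0 \<le> bump x" "bump x \<le> 1" by (auto simp: bump_def flat_0)
qed

lemma bump_0 [simp]: "bump 0 = 1"
  by (simp add: bump_def flat_0 flip: exp_add)

lemma bump_eq_0:
  assumes "norm x \<ge> 1" shows "bump x = 0"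
  using one_le_power[OF assms, of 2] by (simp add: bump_def flat_0)

text \<open>The linear map \<open>g\<close> stands for dilations and for the projections of the
  product space, by which cutoffs in t or in x alone become smooth functions of (t, x).\<close>

lemma smooth_bump:
  fixes g :: "'a::euclidean_space \<Rightarrow> 'b::euclidean_space"
  assumes "bounded_linear g"
  shows "smooth (\<lambda>x. bump (g x))"
proof -
  have "smooth (\<lambda>x. 1 + - 1 * (norm (g x))\<^sup>2)"
    by (intro smooth_add smooth_const smooth_mult smooth_norm_power2 assms)
  then have "smooth (\<lambda>x. flat 0 (1 - (norm (g x))\<^sup>2))"
    using smooth_compose[of UNIV flat "\<lambda>x. 1 - (norm (g x))\<^sup>2" 0] DERIV_flat by simp
  then show ?thesis unfolding bump_def by (intro smooth_mult smooth_const)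
qed

lemma smooth_japanese_bracket:
  fixes g :: "'a::euclidean_space \<Rightarrow> 'b::euclidean_space"
  assumes "bounded_linear g"
  shows "smooth (\<lambda>x. (1 + (norm (g x))\<^sup>2) powr a)"
proof -
  \<comment> \<open>This Pochhammer symbol is the falling factorial a (a - 1) ... (a - j + 1), the
    coefficient of the j-th derivative of the power function.\<close>
  define h where "h j y = pochhammer (a - real j + 1) j * y powr (a - real j)" for j and y :: real
  have "(h j has_real_derivative h (Suc j) y) (at y)" if "y \<in> {0<..}" for j y
  proof -
    have "(h j has_real_derivative pochhammer (a - real j + 1) j * ((a - real j) * y powr (a - real j - 1))) (at y)"
      unfolding h_def using that by (intro DERIV_cmult has_real_derivative_powr) auto
    also have "pochhammer (a - real j + 1) j * ((a - real j) * y powr (a - real j - 1)) = h (Suc j) y"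
      unfolding h_def by (simp add: pochhammer_rec algebra_simps)
    finally show ?thesis .
  qed
  moreover have "smooth (\<lambda>x. 1 + (norm (g x))\<^sup>2)"
    by (intro smooth_add smooth_const smooth_norm_power2 assms)
  moreover have "1 + (norm (g x))\<^sup>2 \<in> {0<..}" for x by (auto intro: add_pos_nonneg)
  ultimately have "smooth (\<lambda>x. h 0 (1 + (norm (g x))\<^sup>2))"
    by (rule smooth_compose)
  then show ?thesis by (simp add: h_def)
qed

section \<open>Decay of the Fourier transform\<close>

text \<open>The derivative at parameter s is the derivative at parameter 0 with base point x + s b,
  so a hypothesis at 0 for all x controls the whole line.\<close>

lemma has_vector_derivative_shift:
  fixes g :: "'a::real_normed_vector \<Rightarrow> 'b::real_normed_vector"
  assumes "\<And>x. ((\<lambda>s. g (x + s *\<^sub>R b)) has_vector_derivative g' x) (at 0)"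
  shows "((\<lambda>s. g (x + s *\<^sub>R b)) has_vector_derivative g' (x + s *\<^sub>R b)) (at s)"
proof -
  have "((\<lambda>r. g ((x + s *\<^sub>R b) + r *\<^sub>R b)) \<circ> (\<lambda>r. r - s) has_vector_derivative 1 *\<^sub>R g' (x + s *\<^sub>R b)) (at s)"
  proof (rule vector_diff_chain_at)
    show "((\<lambda>r. r - s) has_vector_derivative 1) (at s)"
      by (auto intro!: derivative_eq_intros)
    show "((\<lambda>r. g ((x + s *\<^sub>R b) + r *\<^sub>R b)) has_vector_derivative g' (x + s *\<^sub>R b)) (at (s - s))"
      using assms[of "x + s *\<^sub>R b"] by simp
  qed
  then show ?thesis by (simp add: o_def algebra_simps)
qed

text \<open>Integrate g(x + b) - g(x), which has integral 0 by translation invariance, and write it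
  as the integral of g' over a unit segment. By Fubini every s in that segment contributes the same
  integral of g'.\<close>

lemma integral_directional_derivative_eq_0:
  fixes g :: "'a::euclidean_space \<Rightarrow> complex"
  assumes g: "\<And>x. ((\<lambda>s. g (x + s *\<^sub>R b)) has_vector_derivative g' x) (at 0)"
    and i: "integrable lebesgue g" "integrable lebesgue g'" and c: "continuous_on UNIV g'"
  shows "(LINT x|lebesgue. g' x) = 0"
proof -
  interpret P: pair_sigma_finite "lborel :: real measure" "lebesgue :: 'a measure" ..
  note gs = has_vector_derivative_shift[of g, OF g]
  have [measurable]: "g' \<in> borel_measurable borel" using c by (rule borel_measurable_continuous_onI)
  have FTC: "(LINT s|lborel. indicator {0..1} s *\<^sub>R g' (x + s *\<^sub>R b)) = g (x + b) - g x" for x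
  proof -
    have "(LINT s|lborel. indicator {0..1} s *\<^sub>R g' (x + s *\<^sub>R b)) = g (x + 1 *\<^sub>R b) - g (x + 0 *\<^sub>R b)"
    proof (rule integral_FTC_Icc)
      show "((\<lambda>s. g (x + s *\<^sub>R b)) has_vector_derivative g' (x + s *\<^sub>R b)) (at s within {0..1})" for s
        using gs by (rule has_vector_derivative_at_within)
      show "continuous_on {0..1} (\<lambda>s. g' (x + s *\<^sub>R b))"
        by (intro continuous_on_compose2[OF c] continuous_intros) auto
    qed simp
    then show ?thesis by simp
  qed
  have tr: "integrable lebesgue (\<lambda>x. f (x + a))" "(LINT x|lebesgue. f (x + a)) = integral\<^sup>L lebesgue f"
    if "integrable lebesgue f" for f :: "'a \<Rightarrow> 'c::{banach, second_countable_topology}" and a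
    using that integrable_affine[of 1 f a] integral_affine[of 1 f a] by (simp_all add: add.commute)
  have "integrable (lborel \<Otimes>\<^sub>M lebesgue) (\<lambda>(s, x). indicator {0..1} s *\<^sub>R g' (x + s *\<^sub>R b))"
  proof (rule P.Fubini_integrable)
    show "(\<lambda>(s, x). indicator {0..1} s *\<^sub>R g' (x + s *\<^sub>R b)) \<in> borel_measurable (lborel \<Otimes>\<^sub>M lebesgue)"
      by measurable
    have "(LINT x|lebesgue. norm (indicator {0..1} s *\<^sub>R g' (x + s *\<^sub>R b))) = indicator {0..1} s * (LINT x|lebesgue. norm (g' x))" for s :: real
      using tr(2)[of "\<lambda>x. norm (g' x)" "s *\<^sub>R b"] i by simp
    then show "integrable lborel (\<lambda>s. LINT x|lebesgue. norm ((\<lambda>(s, x). indicator {0..1} s *\<^sub>R g' (x + s *\<^sub>R b)) (s, x)))"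
      by (simp only: prod.case) simp
    show "AE s in lborel. integrable lebesgue (\<lambda>x. (\<lambda>(s, x). indicator {0..1} s *\<^sub>R g' (x + s *\<^sub>R b)) (s, x))"
      using tr(1)[OF i(2)] by auto
  qed
  from P.Fubini_integral[OF this]
  have "(LINT x|lebesgue. g (x + b) - g x) = (LINT s|lborel. (LINT x|lebesgue. indicator {0..1} s *\<^sub>R g' (x + s *\<^sub>R b)))"
    unfolding FTC .
  also have "(LINT x|lebesgue. g (x + b) - g x) = 0"
    using tr[OF i(1), of b] i(1) by (subst Bochner_Integration.integral_diff) auto
  also have "(LINT s|lborel. (LINT x|lebesgue. indicator {0..1} s *\<^sub>R g' (x + s *\<^sub>R b))) = (LINT x|lebesgue. g' x)"
    using tr(2)[OF i(2)] by simp
  finally show ?thesis by simp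
qed

text \<open>Integration by parts, obtained by applying the vanishing of integrals of derivatives to
  f times the Fourier kernel.\<close>

lemma fourier_directional_derivative:
  fixes f :: "'a::euclidean_space \<Rightarrow> complex"
  assumes f: "\<And>x. ((\<lambda>s. f (x + s *\<^sub>R b)) has_vector_derivative f' x) (at 0)"
    and i: "integrable lebesgue f" "integrable lebesgue f'"
    and c: "continuous_on UNIV f" "continuous_on UNIV f'"
  shows "fourier f' \<xi> = \<i> * of_real (b \<bullet> \<xi>) * fourier f \<xi>"
proof -
  let ?e = "\<lambda>x::'a. cis (- (x \<bullet> \<xi>))"
  define g' where "g' x = ?e x * f' x - \<i> * of_real (b \<bullet> \<xi>) * (?e x * f x)" for x
  have ie: "integrable lebesgue (\<lambda>x. ?e x * f x)" "integrable lebesgue (\<lambda>x. ?e x * f' x)"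
    by (intro integrable_cis_mult i measurable_compose[OF ident_lebesgue_borel]; simp)+
  have "((\<lambda>s. ?e (x + s *\<^sub>R b) * f (x + s *\<^sub>R b)) has_vector_derivative g' x) (at 0)" for x
  proof -
    have "((\<lambda>s. cis (- (x \<bullet> \<xi>) + - (b \<bullet> \<xi>) * s)) has_vector_derivative (- (b \<bullet> \<xi>)) *\<^sub>R (\<i> * cis (- (x \<bullet> \<xi>)))) (at 0)"
    proof -
      have "((\<lambda>z. exp (\<i> * of_real (- (x \<bullet> \<xi>)) + \<i> * of_real (- (b \<bullet> \<xi>)) * z)) has_field_derivative
          exp (\<i> * of_real (- (x \<bullet> \<xi>))) * (\<i> * of_real (- (b \<bullet> \<xi>)))) (at (of_real 0))"
        by (auto intro!: derivative_eq_intros)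
      from has_vector_derivative_real_field[OF this] show ?thesis
        by (simp add: cis_conv_exp scaleR_conv_of_real algebra_simps)
    qed
    moreover have "?e (x + s *\<^sub>R b) = cis (- (x \<bullet> \<xi>) + - (b \<bullet> \<xi>) * s)" for s
      by (simp add: inner_add_left algebra_simps)
    ultimately have "((\<lambda>s. ?e (x + s *\<^sub>R b)) has_vector_derivative (- (b \<bullet> \<xi>)) *\<^sub>R (\<i> * cis (- (x \<bullet> \<xi>)))) (at 0)"
      by simp
    from has_vector_derivative_mult[OF this f[of x]] show ?thesis
      by (simp add: g'_def scaleR_conv_of_real algebra_simps)
  qed
  then have "(LINT x|lebesgue. g' x) = 0"
    by (rule integral_directional_derivative_eq_0)
       (auto simp: g'_def intro!: ie continuous_intros c Bochner_Integration.integrable_diff integrable_mult_right)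
  then have "(LINT x|lebesgue. ?e x * f' x) = \<i> * of_real (b \<bullet> \<xi>) * (LINT x|lebesgue. ?e x * f x)"
    unfolding g'_def using ie by (simp add: Bochner_Integration.integral_diff)
  then show ?thesis by (simp add: fourier_def)
qed

text \<open>A version of the Sobolev space W^(k,1) with continuous classical derivatives, taken one
  basis direction at a time. In contrast to \<open>C_k\<close> it is complex-valued and demands
  integrability at each order, which is what yields decay of the transform.\<close>

primrec W_k :: "nat \<Rightarrow> ('a::euclidean_space \<Rightarrow> complex) \<Rightarrow> bool" where
  "W_k 0 f \<longleftrightarrow> continuous_on UNIV f \<and> integrable lebesgue f"
| "W_k (Suc k) f \<longleftrightarrow> continuous_on UNIV f \<and> integrable lebesgue f \<and>
     (\<forall>b\<in>Basis. \<exists>f'. (\<forall>x. ((\<lambda>s. f (x + s *\<^sub>R b)) has_vector_derivative f' x) (at 0)) \<and> W_k k f')"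

lemma W_kD: assumes "W_k k f" shows "continuous_on UNIV f" "integrable lebesgue f"
  using assms by (cases k; simp)+

text \<open>Each derivative in direction b multiplies the transform by i (b \<bullet> \<xi>), and
  transforms of integrable functions are bounded.\<close>

lemma fourier_coordinate_decay:
  fixes f :: "'a::euclidean_space \<Rightarrow> complex"
  assumes "W_k k f" "b \<in> Basis"
  shows "\<exists>C\<ge>0. \<forall>\<xi>. \<bar>b \<bullet> \<xi>\<bar> ^ k * norm (fourier f \<xi>) \<le> C"
  using assms
proof (induction k arbitrary: f)
  case 0
  then show ?case using norm_fourier_le[of f]
    by (intro exI[of _ "(2 * pi) powr (- real DIM('a) / 2) * (LINT x|lebesgue. norm (f x))"]) auto
next
  case (Suc k)
  then have "\<exists>f'. (\<forall>x. ((\<lambda>s. f (x + s *\<^sub>R b)) has_vector_derivative f' x) (at 0)) \<and> W_k k f'"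
    by simp
  then obtain f' where f': "\<And>x. ((\<lambda>s. f (x + s *\<^sub>R b)) has_vector_derivative f' x) (at 0)" "W_k k f'"
    by blast
  from Suc.IH[OF f'(2) Suc.prems(2)] obtain C where C: "C \<ge> 0" "\<And>\<xi>. \<bar>b \<bullet> \<xi>\<bar> ^ k * norm (fourier f' \<xi>) \<le> C" by auto
  have "fourier f' \<xi> = \<i> * of_real (b \<bullet> \<xi>) * fourier f \<xi>" for \<xi>
    by (intro fourier_directional_derivative f' W_kD[OF Suc.prems(1)] W_kD[OF f'(2)])
  then have "\<bar>b \<bullet> \<xi>\<bar> ^ Suc k * norm (fourier f \<xi>) = \<bar>b \<bullet> \<xi>\<bar> ^ k * norm (fourier f' \<xi>)" for \<xi>
    by (simp add: norm_mult)
  with C show ?case by (intro exI[of _ C] conjI allI) (simp_all only:)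
qed

lemma fourier_decay:
  fixes f :: "'a::euclidean_space \<Rightarrow> complex"
  assumes "W_k k f"
  shows "\<exists>C\<ge>0. \<forall>\<xi>. norm \<xi> ^ k * norm (fourier f \<xi>) \<le> C"
proof -
  from fourier_coordinate_decay[OF assms]
  obtain C where C: "\<And>b. b \<in> Basis \<Longrightarrow> C b \<ge> 0" "\<And>b \<xi>. b \<in> Basis \<Longrightarrow> \<bar>b \<bullet> \<xi>\<bar> ^ k * norm (fourier f \<xi>) \<le> C b"
    by metis
  let ?n = "real DIM('a)"
  have "norm \<xi> ^ k * norm (fourier f \<xi>) \<le> ?n ^ k * (\<Sum>b\<in>Basis. C b)" for \<xi>
  proof -
    \<comment> \<open>Some coordinate carries at least the share 1 / n of the norm; otherwise the
      sum of the absolute coordinates would fall below the norm.\<close>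
    have "\<exists>b\<in>Basis. norm \<xi> \<le> ?n * \<bar>b \<bullet> \<xi>\<bar>"
    proof (rule ccontr)
      assume "\<not> ?thesis"
      then have "(\<Sum>b\<in>(Basis::'a set). \<bar>\<xi> \<bullet> b\<bar>) < (\<Sum>b\<in>(Basis::'a set). norm \<xi> / ?n)"
        by (intro sum_strict_mono) (auto simp: field_simps inner_commute)
      then show False using norm_le_l1[of \<xi>] by simp
    qed
    then obtain b where b: "b \<in> Basis" "norm \<xi> \<le> ?n * \<bar>b \<bullet> \<xi>\<bar>" by auto
    have "norm \<xi> ^ k * norm (fourier f \<xi>) \<le> (?n * \<bar>b \<bullet> \<xi>\<bar>) ^ k * norm (fourier f \<xi>)"
      using b by (intro mult_right_mono power_mono) auto
    also have "\<dots> = ?n ^ k * (\<bar>b \<bullet> \<xi>\<bar> ^ k * norm (fourier f \<xi>))" by (simp add: power_mult_distrib)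
    also have "\<dots> \<le> ?n ^ k * C b" using C b by (intro mult_left_mono) auto
    also have "C b \<le> (\<Sum>b\<in>Basis. C b)" using C b by (intro member_le_sum) auto
    finally show ?thesis by (simp add: mult_left_mono)
  qed
  moreover have "?n ^ k * (\<Sum>b\<in>Basis. C b) \<ge> 0" using C(1) by (intro mult_nonneg_nonneg sum_nonneg) auto
  ultimately show ?thesis by blast
qed

lemma fourier_decay_powr:
  fixes f :: "'a::euclidean_space \<Rightarrow> complex"
  assumes W: "\<And>k. W_k k f" and q: "q \<ge> 0"
  shows "\<exists>C\<ge>0. \<forall>\<xi>. norm \<xi> powr q * norm (fourier f \<xi>) \<le> C"
proof -
  define k where "k = nat \<lceil>q\<rceil>"
  obtain C0 where C0: "C0 \<ge> 0" "\<And>\<xi>. norm (fourier f \<xi>) \<le> C0" using fourier_decay[OF W[of 0]] by auto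
  obtain C1 where C1: "C1 \<ge> 0" "\<And>\<xi>. norm \<xi> ^ k * norm (fourier f \<xi>) \<le> C1" using fourier_decay[OF W[of k]] by auto
  have "norm \<xi> powr q * norm (fourier f \<xi>) \<le> C0 + C1" for \<xi>
  proof (cases "norm \<xi> \<le> 1")
    case True
    then have "norm \<xi> powr q \<le> 1" using powr_mono2[of q "norm \<xi>" 1] q by simp
    then have "norm \<xi> powr q * norm (fourier f \<xi>) \<le> 1 * norm (fourier f \<xi>)" by (intro mult_right_mono) auto
    then show ?thesis using C0(2)[of \<xi>] C1(1) by linarith
  next
    case False
    then have "norm \<xi> powr q \<le> norm \<xi> powr real k" using q by (intro powr_mono) (auto simp: k_def)
    then have "norm \<xi> powr q \<le> norm \<xi> ^ k" using powr_realpow[of "norm \<xi>" k] False by linarith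
    then have "norm \<xi> powr q * norm (fourier f \<xi>) \<le> norm \<xi> ^ k * norm (fourier f \<xi>)" by (intro mult_right_mono) auto
    then show ?thesis using C1(2)[of \<xi>] C0(1) by linarith
  qed
  moreover have "C0 + C1 \<ge> 0" using C0(1) C1(1) by simp
  ultimately show ?thesis by blast
qed

section \<open>Two sources of functions in \<open>W_k\<close> for every k: test functions and
  polynomials times a Gaussian\<close>

lemma integrable_compact_support:
  fixes f :: "'a::euclidean_space \<Rightarrow> 'b::{banach, second_countable_topology}"
  assumes c: "continuous_on UNIV f" and s: "\<And>x. norm x > R \<Longrightarrow> f x = 0"
  shows "integrable lebesgue f"
proof -
  have "integrable lborel (\<lambda>x. indicator (cball 0 R) x *\<^sub>R f x)"
    using c by (intro borel_integrable_compact) (auto intro: continuous_on_subset)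
  moreover have "(\<lambda>x. indicator (cball 0 R) x *\<^sub>R f x) = f"
    using s by (auto simp: indicator_def fun_eq_iff not_le)
  ultimately show ?thesis using integrable_completion[of f lborel] by auto
qed

lemma frechet_derivative_directional:
  assumes "f differentiable (at x)"
  shows "((\<lambda>s. f (x + s *\<^sub>R b)) has_vector_derivative frechet_derivative f (at x) b) (at 0)"
proof -
  have f: "(f has_derivative frechet_derivative f (at x)) (at (x + 0 *\<^sub>R b))"
    using assms by (simp add: frechet_derivative_works)
  have "((\<lambda>s. x + s *\<^sub>R b) has_derivative (\<lambda>s. s *\<^sub>R b)) (at 0)"
    using has_derivative_add[OF has_derivative_const[of x] bounded_linear_imp_has_derivative[OF bounded_linear_scaleR_left[of b]]]
    by simp
  from diff_chain_at[OF this f] show ?thesis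
    using linear_frechet_derivative[OF assms] by (simp add: has_vector_derivative_def linear_cmul o_def)
qed

text \<open>The set norm x > R is open, so the derivatives vanish on it as well and the induction
  keeps the same R.\<close>

lemma W_k_smooth_compact_support:
  fixes f :: "'a::euclidean_space \<Rightarrow> real"
  assumes "C_k k f" "\<And>x. norm x > R \<Longrightarrow> f x = 0"
  shows "W_k k (\<lambda>x. complex_of_real (f x))"
  using assms
proof (induction k arbitrary: f)
  case 0
  then show ?case
    by (auto intro!: continuous_intros integrable_compact_support[where R=R])
next
  case (Suc k)
  have c: "continuous_on UNIV (\<lambda>x. complex_of_real (f x))"
    using C_k_continuous[OF Suc.prems(1)] by (intro continuous_intros)
  have "W_k k (\<lambda>x. complex_of_real (frechet_derivative f (at x) b))" if "b \<in> Basis" for b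
  proof (rule Suc.IH)
    show "C_k k (\<lambda>x. frechet_derivative f (at x) b)" using Suc.prems(1) that by auto
    fix x :: 'a assume x: "norm x > R"
    have "((\<lambda>x. 0::real) has_derivative (\<lambda>_. 0)) (at x)" by simp
    then have "(f has_derivative (\<lambda>_. 0)) (at x)"
      by (rule has_derivative_transform_within_open[of _ _ _ UNIV "- cball 0 R"]) (use x Suc.prems(2) in auto)
    then show "frechet_derivative f (at x) b = 0"
      using frechet_derivative_at by metis
  qed
  moreover have "((\<lambda>s. complex_of_real (f (x + s *\<^sub>R b))) has_vector_derivative complex_of_real (frechet_derivative f (at x) b)) (at 0)" for x b
    using frechet_derivative_directional[of f x b] Suc.prems(1)
    by (intro has_vector_derivative_of_real) (simp add: has_real_derivative_iff_has_vector_derivative)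
  moreover have "integrable lebesgue (\<lambda>x. complex_of_real (f x))"
    using c Suc.prems(2) by (intro integrable_compact_support[where R=R]) auto
  ultimately show ?case using c unfolding W_k.simps
    by (intro conjI ballI exI[of _ "\<lambda>x. complex_of_real (frechet_derivative f (at x) b)" for b] allI)
qed

text \<open>The rate a is arbitrary because the product case gives a / 2 to each factor.\<close>

lemma real_polynomial_le_exp:
  fixes p :: "'a::euclidean_space \<Rightarrow> real"
  assumes "real_polynomial_function p" "a > 0"
  shows "\<exists>C\<ge>0. \<forall>x. \<bar>p x\<bar> \<le> C * exp (a * (norm x)\<^sup>2)"
  using assms
proof (induction arbitrary: a rule: real_polynomial_function.induct)
  case (linear f)
  obtain K where K: "K \<ge> 0" "\<And>x. norm (f x) \<le> norm x * K"
    using bounded_linear.nonneg_bounded[OF linear(1)] by blast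
  have "\<bar>f x\<bar> \<le> K * (1 + 1 / a) * exp (a * (norm x)\<^sup>2)" for x
  proof -
    have "norm x \<le> 1 + (norm x)\<^sup>2" using sum_squares_bound[of "norm x" 1] norm_ge_zero[of x] by (simp del: norm_ge_zero)
    also have "\<dots> \<le> (1 + 1 / a) * (1 + a * (norm x)\<^sup>2)"
      using linear(2) by (simp add: field_simps)
    also have "\<dots> \<le> (1 + 1 / a) * exp (a * (norm x)\<^sup>2)"
      using linear(2) exp_ge_add_one_self[of "a * (norm x)\<^sup>2"] by (intro mult_left_mono) auto
    finally have "K * norm x \<le> K * ((1 + 1 / a) * exp (a * (norm x)\<^sup>2))"
      using K(1) by (rule mult_left_mono)
    then show ?thesis using K(2)[of x] by (simp add: mult_ac)
  qed
  then show ?case using K linear(2) by (intro exI[of _ "K * (1 + 1 / a)"]) auto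
next
  case (const c)
  have "\<bar>c\<bar> \<le> \<bar>c\<bar> * exp (a * (norm x)\<^sup>2)" for x :: 'a
    using const mult_left_mono[of 1 "exp (a * (norm x)\<^sup>2)" "\<bar>c\<bar>"] by simp
  then show ?case by (intro exI[of _ "\<bar>c\<bar>"]) auto
next
  case (add f g)
  from add.IH(1)[OF add.prems] obtain C where C: "C \<ge> 0" "\<And>x. \<bar>f x\<bar> \<le> C * exp (a * (norm x)\<^sup>2)" by auto
  from add.IH(2)[OF add.prems] obtain D where D: "D \<ge> 0" "\<And>x. \<bar>g x\<bar> \<le> D * exp (a * (norm x)\<^sup>2)" by auto
  have "\<bar>f x + g x\<bar> \<le> (C + D) * exp (a * (norm x)\<^sup>2)" for x
    using C(2)[of x] D(2)[of x] by (simp add: distrib_right)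
  moreover have "C + D \<ge> 0" using C(1) D(1) by simp
  ultimately show ?case by blast
next
  case (mult f g)
  have a: "a / 2 > 0" using mult.prems by simp
  from mult.IH(1)[OF a] obtain C where C: "C \<ge> 0" "\<And>x. \<bar>f x\<bar> \<le> C * exp (a / 2 * (norm x)\<^sup>2)" by auto
  from mult.IH(2)[OF a] obtain D where D: "D \<ge> 0" "\<And>x. \<bar>g x\<bar> \<le> D * exp (a / 2 * (norm x)\<^sup>2)" by auto
  have "\<bar>f x * g x\<bar> \<le> (C * D) * exp (a * (norm x)\<^sup>2)" for x
  proof -
    have "\<bar>f x * g x\<bar> \<le> (C * exp (a / 2 * (norm x)\<^sup>2)) * (D * exp (a / 2 * (norm x)\<^sup>2))"
      unfolding abs_mult using C(1) by (intro mult_mono C D) auto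
    also have "\<dots> = (C * D) * (exp (a / 2 * (norm x)\<^sup>2) * exp (a / 2 * (norm x)\<^sup>2))" by simp
    also have "exp (a / 2 * (norm x)\<^sup>2) * exp (a / 2 * (norm x)\<^sup>2) = exp (a * (norm x)\<^sup>2)"
      by (simp flip: exp_add)
    finally show ?thesis .
  qed
  moreover have "C * D \<ge> 0" using C(1) D(1) by simp
  ultimately show ?case by blast
qed

lemma real_polynomial_directional_derivative:
  fixes p :: "'a::euclidean_space \<Rightarrow> real"
  assumes "real_polynomial_function p"
  shows "\<exists>p'. real_polynomial_function p' \<and> (\<forall>x. ((\<lambda>s. p (x + s *\<^sub>R b)) has_real_derivative p' x) (at 0))"
  using assms
proof (induction rule: real_polynomial_function.induct)
  case (linear f)
  have "((\<lambda>s. f (x + s *\<^sub>R b)) has_real_derivative f b) (at 0)" for x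
  proof -
    have "(\<lambda>s. f (x + s *\<^sub>R b)) = (\<lambda>s. f x + s * f b)"
      using linear by (simp add: linear_add linear_cmul bounded_linear.linear)
    then show ?thesis by (auto intro!: derivative_eq_intros)
  qed
  then show ?case by blast
next
  case (const c)
  then show ?case by (intro exI[of _ "\<lambda>_. 0"]) auto
next
  case (add f g)
  then obtain f' g' where "real_polynomial_function f'" "\<And>x. ((\<lambda>s. f (x + s *\<^sub>R b)) has_real_derivative f' x) (at 0)"
     "real_polynomial_function g'" "\<And>x. ((\<lambda>s. g (x + s *\<^sub>R b)) has_real_derivative g' x) (at 0)" by blast
  then show ?case
    by (intro exI[of _ "\<lambda>x. f' x + g' x"]) (auto intro!: DERIV_add)
next
  case (mult f g)
  then obtain f' g' where *: "real_polynomial_function f'" "\<And>x. ((\<lambda>s. f (x + s *\<^sub>R b)) has_real_derivative f' x) (at 0)"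
     "real_polynomial_function g'" "\<And>x. ((\<lambda>s. g (x + s *\<^sub>R b)) has_real_derivative g' x) (at 0)" by blast
  have "((\<lambda>s. f (x + s *\<^sub>R b) * g (x + s *\<^sub>R b)) has_real_derivative f' x * g x + g' x * f x) (at 0)" for x
    using DERIV_mult[OF *(2)[of x] *(4)[of x]] by simp
  then show ?case using * mult.hyps
    by (intro exI[of _ "\<lambda>x. f' x * g x + g' x * f x"]) auto
qed

lemma
  fixes p :: "'a::euclidean_space \<Rightarrow> real"
  assumes p: "real_polynomial_function p"
  shows continuous_polynomial_gaussian: "continuous_on UNIV (\<lambda>x. complex_of_real (p x * exp (- (norm x)\<^sup>2)))"
    and integrable_polynomial_gaussian: "integrable lebesgue (\<lambda>x. complex_of_real (p x * exp (- (norm x)\<^sup>2)))"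
proof -
  have c: "continuous_on UNIV p"
    using continuous_real_polymonial_function[OF p] by (simp add: continuous_at_imp_continuous_on)
  then show "continuous_on UNIV (\<lambda>x. complex_of_real (p x * exp (- (norm x)\<^sup>2)))"
    by (intro continuous_on_of_real continuous_on_mult continuous_on_exp continuous_on_minus continuous_on_power continuous_on_norm continuous_on_id)
  have mp: "p \<in> borel_measurable lebesgue"
    by (rule borel_measurable_lebesgueI[OF borel_measurable_continuous_onI[OF c]])
  \<comment> \<open>The polynomial consumes half of the Gaussian's exponent and leaves an integrable
    Gaussian.\<close>
  obtain C where C: "C \<ge> 0" "\<And>x. \<bar>p x\<bar> \<le> C * exp (1 / 2 * (norm x)\<^sup>2)"
    using real_polynomial_le_exp[OF p, of "1 / 2"] by auto
  have "integrable lebesgue (\<lambda>x. p x * exp (- (norm x)\<^sup>2))"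
  proof (rule Bochner_Integration.integrable_bound)
    show "integrable lebesgue (\<lambda>x::'a. C * exp (- (1 / 2) * (norm x)\<^sup>2))"
      by (intro integrable_mult_right integrable_gaussian) simp
    show "(\<lambda>x. p x * exp (- (norm x)\<^sup>2)) \<in> borel_measurable lebesgue"
      using mp ident_lebesgue_borel by measurable
    show "AE x in lebesgue. norm (p x * exp (- (norm x)\<^sup>2)) \<le> norm (C * exp (- (1 / 2) * (norm x)\<^sup>2))"
    proof (intro AE_I2)
      fix x
      have "\<bar>p x\<bar> * exp (- (norm x)\<^sup>2) \<le> C * exp (1 / 2 * (norm x)\<^sup>2) * exp (- (norm x)\<^sup>2)"
        by (intro mult_right_mono C) simp
      also have "\<dots> = C * exp (- (1 / 2) * (norm x)\<^sup>2)"
        by (simp add: mult.assoc flip: exp_add)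
      finally show "norm (p x * exp (- (norm x)\<^sup>2)) \<le> norm (C * exp (- (1 / 2) * (norm x)\<^sup>2))"
        using C(1) by (simp add: abs_mult)
    qed
  qed
  then show "integrable lebesgue (\<lambda>x. complex_of_real (p x * exp (- (norm x)\<^sup>2)))"
    by (simp only: integrable_of_real_iff)
qed

text \<open>Polynomials times exp (- |x|^2) are closed under directional derivatives, so the
  induction on the order stays in the class.\<close>

lemma W_k_polynomial_gaussian:
  fixes p :: "'a::euclidean_space \<Rightarrow> real"
  assumes "real_polynomial_function p"
  shows "W_k k (\<lambda>x. complex_of_real (p x * exp (- (norm x)\<^sup>2)))"
  using assms
proof (induction k arbitrary: p)
  case 0
  then show ?case
    by (simp only: W_k.simps continuous_polynomial_gaussian integrable_polynomial_gaussian)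
next
    case (Suc k)
    have "\<exists>f'. (\<forall>x. ((\<lambda>s. complex_of_real (p (x + s *\<^sub>R b) * exp (- (norm (x + s *\<^sub>R b))\<^sup>2))) has_vector_derivative f' x) (at 0)) \<and> W_k k f'" for b :: 'a
    proof -
      obtain p' where p': "real_polynomial_function p'" "\<And>x. ((\<lambda>s. p (x + s *\<^sub>R b)) has_real_derivative p' x) (at 0)"
        using real_polynomial_directional_derivative[OF Suc.prems] by blast
      \<comment> \<open>The second term comes from differentiating exp (- |x|^2) in direction
        b.\<close>
      define q where "q x = p' x + (-2) * (x \<bullet> b) * p x" for x
      have "real_polynomial_function (\<lambda>x. x \<bullet> b)" by (intro real_polynomial_function.intros(1) bounded_linear_inner_left)
      then have "real_polynomial_function q" unfolding q_def using p' Suc.prems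
        by (intro real_polynomial_function.intros(3)[of p'] real_polynomial_function.intros(4)
            real_polynomial_function.intros(2))
      then have "W_k k (\<lambda>x. complex_of_real (q x * exp (- (norm x)\<^sup>2)))" by (rule Suc.IH)
      moreover have "((\<lambda>s. p (x + s *\<^sub>R b) * exp (- (norm (x + s *\<^sub>R b))\<^sup>2)) has_real_derivative q x * exp (- (norm x)\<^sup>2)) (at 0)" for x
      proof -
        have n: "(norm (x + s *\<^sub>R b))\<^sup>2 = (norm x)\<^sup>2 + 2 * s * (x \<bullet> b) + s\<^sup>2 * (norm b)\<^sup>2" for s
          unfolding power2_norm_eq_inner by (simp add: inner_add inner_commute power2_eq_square algebra_simps)
        have "((\<lambda>s. exp (- (norm (x + s *\<^sub>R b))\<^sup>2)) has_real_derivative (-2) * (x \<bullet> b) * exp (- (norm x)\<^sup>2)) (at 0)"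
          unfolding n by (auto intro!: derivative_eq_intros)
        from DERIV_mult[OF p'(2)[of x] this] show ?thesis
          by (simp add: q_def algebra_simps)
      qed
      then have "((\<lambda>s. complex_of_real (p (x + s *\<^sub>R b) * exp (- (norm (x + s *\<^sub>R b))\<^sup>2))) has_vector_derivative complex_of_real (q x * exp (- (norm x)\<^sup>2))) (at 0)" for x
        by (intro has_vector_derivative_of_real) (simp add: has_real_derivative_iff_has_vector_derivative)
      ultimately show ?thesis
        by (intro exI[of _ "\<lambda>x. complex_of_real (q x * exp (- (norm x)\<^sup>2))"] conjI allI)
    qed
    then show ?case
      using continuous_polynomial_gaussian[OF Suc.prems] integrable_polynomial_gaussian[OF Suc.prems]
      unfolding W_k.simps by (intro conjI ballI)
qed

text \<open>An even power of the norm is a polynomial. Real powers are reduced to this case by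
  mixtures in \<open>fractional_gaussian_decay\<close>.\<close>

lemma fourier_norm_gaussian_decay:
  fixes m :: nat and q :: real
  assumes "q \<ge> 0"
  shows "\<exists>C\<ge>0. \<forall>\<xi>::'a::euclidean_space. norm \<xi> powr q *
    norm (fourier (\<lambda>x. complex_of_real (norm x ^ (2 * m) * exp (- (norm x)\<^sup>2))) \<xi>) \<le> C"
proof (rule fourier_decay_powr[OF W_k_polynomial_gaussian assms])
  have "(\<lambda>x::'a. norm x ^ (2 * m)) = (\<lambda>x. (\<Sum>b\<in>Basis. (x \<bullet> b)\<^sup>2) ^ m)"
    by (simp add: power_mult norm_power2_Basis)
  moreover have "real_polynomial_function (\<lambda>x::'a. (\<Sum>b\<in>Basis. (x \<bullet> b)\<^sup>2) ^ m)"
    by (intro real_polynomial_function_power real_polynomial_function_sum real_polynomial_function.intros(1) bounded_linear_inner_left) auto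
  ultimately show "real_polynomial_function (\<lambda>x::'a. norm x ^ (2 * m))" by simp
qed

section \<open>The Gamma and beta integrals behind the two mixtures\<close>

lemma has_bochner_integral_of_has_integral_nonneg:
  fixes f :: "real \<Rightarrow> real"
  assumes "(f has_integral I) S" "\<And>x. x \<in> S \<Longrightarrow> f x \<ge> 0"
    and m: "(\<lambda>x. indicator S x * f x) \<in> borel_measurable borel"
  shows "has_bochner_integral lborel (\<lambda>x. indicator S x * f x) I"
proof (rule has_bochner_integral_nn_integral)
  show "I \<ge> 0" using has_integral_nonneg[OF assms(1,2)] .
  show "(\<integral>\<^sup>+x. ennreal (indicator S x * f x) \<partial>lborel) = ennreal I"
    using nn_integral_has_integral_lebesgue[OF assms(2,1)] by simp
  show "(\<lambda>x. indicator S x * f x) \<in> borel_measurable lborel" using m by simp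
  show "AE x in lborel. 0 \<le> indicator S x * f x"
    using assms(2) by (auto simp: indicator_def)
qed

text \<open>Substitution of y r for r in Euler's integral. With y = 1 + |x|^2 it writes
  \<open>japanese\<close> as a mixture of Gaussians; with y = |x|^2 it lowers an even power of |x|
  to a real one.\<close>

lemma has_bochner_integral_Gamma:
  assumes s: "s > 0" and y: "y > 0"
  shows "has_bochner_integral lborel (\<lambda>r::real. indicator {0..} r * (r powr (s - 1) * exp (- y * r))) (Gamma s * y powr - s)"
proof -
  have 1: "has_bochner_integral lborel (\<lambda>r::real. indicator {0..} r * (r powr (s - 1) / exp r)) (Gamma s)"
    by (rule has_bochner_integral_of_has_integral_nonneg[OF Gamma_integral_real[OF s]]) auto
  have "has_bochner_integral lborel (\<lambda>r::real. indicator {0..} (0 + y * r) * ((0 + y * r) powr (s - 1) / exp (0 + y * r))) (Gamma s /\<^sub>R \<bar>y\<bar>)"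
    using 1 y by (subst (asm) lborel_has_bochner_integral_real_affine_iff[of y _ _ 0]) auto
  also have "(\<lambda>r::real. indicator {0..} (0 + y * r) * ((0 + y * r) powr (s - 1) / exp (0 + y * r))) =
     (\<lambda>r. y powr (s - 1) * (indicator {0..} r * (r powr (s - 1) * exp (- y * r))))"
    using y by (auto simp: fun_eq_iff indicator_def powr_mult exp_minus field_simps zero_le_mult_iff)
  finally have "has_bochner_integral lborel (\<lambda>r. y powr (s - 1) * (indicator {0..} r * (r powr (s - 1) * exp (- y * r)))) (Gamma s /\<^sub>R \<bar>y\<bar>)" .
  from has_bochner_integral_mult_right[OF this, of "1 / y powr (s - 1)"] y
  have "has_bochner_integral lborel (\<lambda>r::real. indicator {0..} r * (r powr (s - 1) * exp (- y * r))) (1 / y powr (s - 1) * (Gamma s /\<^sub>R \<bar>y\<bar>))"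
    by simp
  also have "1 / y powr (s - 1) * (Gamma s /\<^sub>R \<bar>y\<bar>) = Gamma s * y powr - s"
    using y by (simp add: powr_diff powr_minus_divide)
  finally show ?thesis .
qed

text \<open>The condition s > 0 governs the behaviour at 0 and b > s that at infinity, so the
  integrand is compared with one power on each side of r = 1. It controls the moments of the mixing
  density in \<open>fractional_gaussian_decay\<close>.\<close>

lemma integrable_beta_prime:
  assumes "s > 0" "b > s" "a > 0"
  shows "integrable lborel (\<lambda>r::real. indicator {0..} r * (r powr (s - 1) * (a + r) powr - b))"
proof (rule Bochner_Integration.integrable_bound)
  have 1: "has_bochner_integral lborel (\<lambda>r::real. indicator {0..1} r * r powr (s - 1)) (1 powr (s - 1 + 1) / (s - 1 + 1))"
    using assms by (intro has_bochner_integral_of_has_integral_nonneg has_integral_powr_from_0) auto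
  have 2: "has_bochner_integral lborel (\<lambda>r::real. indicator {1..} r * r powr (s - 1 - b)) (- (1 powr (s - 1 - b + 1)) / (s - 1 - b + 1))"
    using assms by (intro has_bochner_integral_of_has_integral_nonneg has_integral_powr_to_inf) auto
  from 1 2 show "integrable lborel (\<lambda>r::real. a powr - b * (indicator {0..1} r * r powr (s - 1)) + indicator {1..} r * r powr (s - 1 - b))"
    by (intro Bochner_Integration.integrable_add integrable_mult_right) (auto simp: has_bochner_integral_iff)
  show "AE r in lborel. norm (indicator {0..} r * (r powr (s - 1) * (a + r) powr - b))
     \<le> norm (a powr - b * (indicator {0..1} r * r powr (s - 1)) + indicator {1..} r * r powr (s - 1 - b))"
  proof (intro AE_I2)
    fix r :: real
    consider "r < 0" | "0 \<le> r" "r \<le> 1" | "1 < r" by linarith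
    then show "norm (indicator {0..} r * (r powr (s - 1) * (a + r) powr - b))
       \<le> norm (a powr - b * (indicator {0..1} r * r powr (s - 1)) + indicator {1..} r * r powr (s - 1 - b))"
    proof cases
      case 1 then show ?thesis by simp
    next
      case 2
      have "(a + r) powr - b \<le> a powr - b" using assms 2 by (intro powr_mono2') auto
      then have "r powr (s - 1) * (a + r) powr - b \<le> a powr - b * r powr (s - 1)"
        using mult_left_mono[of "(a + r) powr - b" "a powr - b" "r powr (s - 1)"] by (simp add: mult.commute)
      with 2 show ?thesis by (simp add: indicator_def add_increasing2)
    next
      case 3
      have "(a + r) powr - b \<le> r powr - b" using assms 3 by (intro powr_mono2') auto
      then have "r powr (s - 1) * (a + r) powr - b \<le> r powr (s - 1) * r powr - b"
        by (rule mult_left_mono) simp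
      also have "\<dots> = r powr (s - 1 - b)" by (simp flip: powr_add)
      finally show ?thesis using 3 by (simp add: indicator_def)
    qed
  qed
qed simp

section \<open>Fractional Laplacians of mixtures of Gaussians\<close>

text \<open>A non-integrable \<open>f\<close> has integral 0 by convention, in which case the bound
  reduces to g \<ge> 0.\<close>

lemma norm_integral_le:
  fixes f :: "'p \<Rightarrow> 'b::{banach, second_countable_topology}"
  assumes "integrable M g" "\<And>x. norm (f x) \<le> g x"
  shows "norm (integral\<^sup>L M f) \<le> integral\<^sup>L M g"
proof (cases "integrable M f")
  case True
  then have "(LINT x|M. norm (f x)) \<le> integral\<^sup>L M g" using assms by (intro integral_mono) auto
  with integral_norm_bound[of M f] show ?thesis by (rule order_trans)
next
  case False
  have "0 \<le> g x" for x using norm_ge_zero[of "f x"] assms(2)[of x] by (rule order_trans)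
  then have "integral\<^sup>L M g \<ge> 0" by simp
  with False show ?thesis by (simp add: not_integrable_integral_eq)
qed

text \<open>The transform of the dilate G(c x) is c^(-n) times that of G at \<xi> / c. Thus a
  mixture of dilates is integrable once |A| / c^n is, and decay of order q of the transform of G
  survives if the moment with additional weight c^q is finite. Positivity of c is asked only where A
  differs from 0, so that A can carry an indicator.\<close>

lemma
  fixes G :: "'a::euclidean_space \<Rightarrow> complex" and A c :: "real \<Rightarrow> real"
  assumes G: "integrable lebesgue G" "G \<in> borel_measurable borel"
    and mA: "A \<in> borel_measurable borel" "c \<in> borel_measurable borel"
    and c: "\<And>s. A s \<noteq> 0 \<Longrightarrow> c s > 0"
    and A: "integrable lborel (\<lambda>s. A s / c s ^ DIM('a))"
  defines "F \<equiv> \<lambda>x. LINT s|lborel. of_real (A s) * G (c s *\<^sub>R x)"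
  shows integrable_scale_mixture: "integrable lebesgue F"
    and fourier_scale_mixture: "fourier F \<xi> = (LINT s|lborel. of_real (A s / c s ^ DIM('a)) * fourier G ((1 / c s) *\<^sub>R \<xi>))"
    and fourier_scale_mixture_bound: "(\<And>\<xi>. norm \<xi> powr q * norm (fourier G \<xi>) \<le> C) \<Longrightarrow>
      integrable lborel (\<lambda>s. A s / c s ^ DIM('a) * c s powr q) \<Longrightarrow>
      norm \<xi> powr q * norm (fourier F \<xi>) \<le> (LINT s|lborel. \<bar>A s / c s ^ DIM('a) * c s powr q\<bar> * C)"
proof -
  interpret P: pair_sigma_finite "lborel :: real measure" "lebesgue :: 'a measure" ..
  note [measurable] = G(2) mA
  have Gi: "integrable lebesgue (\<lambda>x. of_real (A s) * G (c s *\<^sub>R x))" for s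
    using c[of s] G(1) integrable_affine[of "c s" G 0] by (cases "A s = 0") auto
  have I: "integrable (lborel \<Otimes>\<^sub>M lebesgue) (\<lambda>(s, x). of_real (A s) * G (c s *\<^sub>R x))"
  proof (rule P.Fubini_integrable)
    show "(\<lambda>(s, x). of_real (A s) * G (c s *\<^sub>R x)) \<in> borel_measurable (lborel \<Otimes>\<^sub>M lebesgue)"
      by measurable
    have "(LINT x|lebesgue. norm (of_real (A s) * G (c s *\<^sub>R x))) = \<bar>A s / c s ^ DIM('a)\<bar> * (LINT x|lebesgue. norm (G x))" for s
      using c[of s] integral_affine[of "c s" "\<lambda>x. norm (G x)" 0]
      by (cases "A s = 0") (auto simp: norm_mult)
    then show "integrable lborel (\<lambda>s. LINT x|lebesgue. norm ((\<lambda>(s, x). of_real (A s) * G (c s *\<^sub>R x)) (s, x)))"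
      using A by (simp only: prod.case) (intro integrable_mult_left integrable_abs)
  qed (use Gi in simp)
  show "integrable lebesgue F"
    unfolding F_def by (rule P.integrable_snd[OF I])
  have fG: "fourier (\<lambda>x. of_real (A s) * G (c s *\<^sub>R x)) \<xi> = of_real (A s / c s ^ DIM('a)) * fourier G ((1 / c s) *\<^sub>R \<xi>)" for s \<xi>
  proof (cases "A s = 0")
    case True then show ?thesis by (simp add: fourier_def)
  next
    case False
    have "fourier (\<lambda>x. of_real (A s) * G (c s *\<^sub>R x)) \<xi> = of_real (A s) * fourier (\<lambda>x. G (c s *\<^sub>R x)) \<xi>"
      by (simp only: fourier_def mult.left_commute[of _ "of_real (A s)"] integral_mult_right_zero)
    then show ?thesis by (simp add: fourier_scale[OF c[OF False]])
  qed
  show eq: "fourier F \<xi> = (LINT s|lborel. of_real (A s / c s ^ DIM('a)) * fourier G ((1 / c s) *\<^sub>R \<xi>))" for \<xi>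
    unfolding F_def using fourier_integral[OF lborel.sigma_finite_measure_axioms I] by (simp only: fG)
  assume C: "\<And>\<xi>. norm \<xi> powr q * norm (fourier G \<xi>) \<le> C"
    and q: "integrable lborel (\<lambda>s. A s / c s ^ DIM('a) * c s powr q)"
  have "norm \<xi> powr q * norm (fourier F \<xi>) = norm (LINT s|lborel. of_real (norm \<xi> powr q) * (of_real (A s / c s ^ DIM('a)) * fourier G ((1 / c s) *\<^sub>R \<xi>)))"
    unfolding eq by (simp only: integral_mult_right_zero norm_mult norm_of_real abs_of_nonneg[OF powr_ge_zero])
  also have "\<dots> \<le> (LINT s|lborel. \<bar>A s / c s ^ DIM('a) * c s powr q\<bar> * C)"
  proof (rule norm_integral_le)
    show "integrable lborel (\<lambda>s. \<bar>A s / c s ^ DIM('a) * c s powr q\<bar> * C)"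
      using q by (intro integrable_mult_left integrable_abs)
    fix s
    show "norm (of_real (norm \<xi> powr q) * (of_real (A s / c s ^ DIM('a)) * fourier G ((1 / c s) *\<^sub>R \<xi>))) \<le> \<bar>A s / c s ^ DIM('a) * c s powr q\<bar> * C"
    proof (cases "A s = 0")
      case False
      have cs: "c s > 0" by (rule c[OF False])
      \<comment> \<open>Splitting off c^q makes the decay of \<open>fourier G\<close> applicable at
        the rescaled frequency.\<close>
      have "norm \<xi> powr q = c s powr q * norm ((1 / c s) *\<^sub>R \<xi>) powr q"
        using cs by (simp flip: powr_mult)
      then have "norm (of_real (norm \<xi> powr q) * (of_real (A s / c s ^ DIM('a)) * fourier G ((1 / c s) *\<^sub>R \<xi>)))
        = \<bar>A s / c s ^ DIM('a) * c s powr q\<bar> * (norm ((1 / c s) *\<^sub>R \<xi>) powr q * norm (fourier G ((1 / c s) *\<^sub>R \<xi>)))"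
        by (simp only: norm_mult norm_of_real abs_mult abs_of_nonneg[OF powr_ge_zero] mult_ac)
      also have "\<dots> \<le> \<bar>A s / c s ^ DIM('a) * c s powr q\<bar> * C"
        by (intro mult_left_mono C) simp
      finally show ?thesis .
    qed simp
  qed
  finally show "norm \<xi> powr q * norm (fourier F \<xi>) \<le> (LINT s|lborel. \<bar>A s / c s ^ DIM('a) * c s powr q\<bar> * C)" .
qed

lemma integrable_norm_power_gaussian:
  "integrable lebesgue (\<lambda>x::'a::euclidean_space. norm x ^ (2 * m) * exp (- (norm x)\<^sup>2))"
proof -
  have "(\<lambda>x::'a. norm x ^ (2 * m)) = (\<lambda>x. (\<Sum>b\<in>Basis. (x \<bullet> b)\<^sup>2) ^ m)"
    by (simp add: power_mult norm_power2_Basis)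
  moreover have "real_polynomial_function (\<lambda>x::'a. (\<Sum>b\<in>Basis. (x \<bullet> b)\<^sup>2) ^ m)"
    by (intro real_polynomial_function_power real_polynomial_function_sum real_polynomial_function.intros(1) bounded_linear_inner_left) auto
  ultimately have "real_polynomial_function (\<lambda>x::'a. norm x ^ (2 * m))" by simp
  from integrable_polynomial_gaussian[OF this] show ?thesis by (simp only: integrable_of_real_iff)
qed

text \<open>The power is dominated by 1 + |x|^(2m) with an integer m \<ge> g, and the width a is
  reached by dilation with sqrt a.\<close>

lemma integrable_norm_powr_gaussian:
  assumes g: "g \<ge> 0" and a: "a > 0"
  shows "integrable lebesgue (\<lambda>x::'a::euclidean_space. norm x powr (2 * g) * exp (- a * (norm x)\<^sup>2))"
proof -
  let ?F = "\<lambda>x::'a. norm x powr (2 * g) * exp (- (norm x)\<^sup>2)"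
  define m where "m = nat \<lceil>g\<rceil>"
  have m: "g \<le> real m" using g by (simp add: m_def)
  have F: "integrable lebesgue ?F"
  proof (rule Bochner_Integration.integrable_bound)
    show "integrable lebesgue (\<lambda>x::'a. norm x ^ (2 * 0) * exp (- (norm x)\<^sup>2) + norm x ^ (2 * m) * exp (- (norm x)\<^sup>2))"
      by (intro Bochner_Integration.integrable_add integrable_norm_power_gaussian)
    show "?F \<in> borel_measurable lebesgue" by (rule borel_measurable_lebesgueI) measurable
    show "AE x in lebesgue. norm (?F x) \<le> norm (norm x ^ (2 * 0) * exp (- (norm x)\<^sup>2) + norm x ^ (2 * m) * exp (- (norm x)\<^sup>2))"
    proof (intro AE_I2)
      fix x :: 'a
      have "norm x powr (2 * g) \<le> 1 + norm x ^ (2 * m)"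
      proof (cases "norm x \<le> 1")
        case True
        then have "norm x powr (2 * g) \<le> 1" using powr_mono2[of "2 * g" "norm x" 1] g by simp
        then show ?thesis by (simp add: add_increasing2)
      next
        case False
        then have "norm x powr (2 * g) \<le> norm x powr real (2 * m)" using m by (intro powr_mono) auto
        also have "\<dots> = norm x ^ (2 * m)" using False by (intro powr_realpow) linarith
        finally show ?thesis by simp
      qed
      then have "norm x powr (2 * g) * exp (- (norm x)\<^sup>2) \<le> (1 + norm x ^ (2 * m)) * exp (- (norm x)\<^sup>2)"
        by (rule mult_right_mono) simp
      then show "norm (?F x) \<le> norm (norm x ^ (2 * 0) * exp (- (norm x)\<^sup>2) + norm x ^ (2 * m) * exp (- (norm x)\<^sup>2))"
        by (simp add: abs_mult distrib_right add_nonneg_nonneg)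
    qed
  qed
  have "sqrt a powr (2 * g) = a powr g"
    using a by (simp add: powr_half_sqrt[symmetric] powr_powr)
  then have "(\<lambda>x::'a. norm x powr (2 * g) * exp (- a * (norm x)\<^sup>2)) = (\<lambda>x. a powr (- g) * ?F (0 + sqrt a *\<^sub>R x))"
    using a by (auto simp: fun_eq_iff powr_mult power_mult_distrib powr_minus_divide)
  moreover have "integrable lebesgue (\<lambda>x. a powr (- g) * ?F (0 + sqrt a *\<^sub>R x))"
    using integrable_affine[of "sqrt a" ?F 0] F a by (intro integrable_mult_right) auto
  ultimately show ?thesis by simp
qed

text \<open>Write |x|^(2g) as |x|^(2m) |x|^(-2\<theta>) with m > g an integer, and the negative
  power as a Gamma integral over exp (- r |x|^2). Up to the factor Gamma \<theta> the function
  becomes a mixture of dilates of |x|^(2m) exp (- |x|^2), whose transform decays rapidly; the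
  moments of the mixing density limit the order to q < n + 2g.\<close>

lemma fractional_gaussian_decay:
  fixes g q :: real
  assumes g: "g > 0" and q: "0 \<le> q" "q < real DIM('a::euclidean_space) + 2 * g"
  shows "\<exists>C\<ge>0. \<forall>\<xi>::'a. norm \<xi> powr q *
    norm (fourier (\<lambda>x. complex_of_real (norm x powr (2 * g) * exp (- (norm x)\<^sup>2 / 4))) \<xi>) \<le> C"
proof -
  \<comment> \<open>The floor plus one, not the ceiling, so that \<theta> > 0 even when g is an
    integer.\<close>
  define m where "m = nat \<lfloor>g\<rfloor> + 1"
  define \<theta> where "\<theta> = real m - g"
  have m: "m \<ge> 1" and \<theta>: "\<theta> > 0" using g unfolding m_def \<theta>_def by linarith+
  define G where "G x = complex_of_real (norm x ^ (2 * m) * exp (- (norm x)\<^sup>2))" for x :: 'a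
  \<comment> \<open>The Gaussian factors combine to exp (- (1/4 + r) |x|^2), whence the dilation
    factor \<open>c r\<close>; the power (1/4 + r)^(-m) undoes the dilation of |x|^(2m).\<close>
  define A where "A r = indicator {0..} r * (r powr (\<theta> - 1) * (1 / 4 + r) powr - real m)" for r :: real
  define c where "c r = sqrt (1 / 4 + r)" for r
  define F where "F x = (LINT r|lborel. of_real (A r) * G (c r *\<^sub>R x))" for x :: 'a
  have cr: "A r \<noteq> 0 \<Longrightarrow> c r > 0" for r by (auto simp: A_def c_def split: split_indicator_asm)
  have cp: "c r = (1 / 4 + r) powr (1 / 2)" if "r \<ge> 0" for r
    using that by (simp add: c_def powr_half_sqrt)
  have Ac: "A r / c r ^ DIM('a) * c r powr b = indicator {0..} r * (r powr (\<theta> - 1) * (1 / 4 + r) powr - (real m + real DIM('a) / 2 - b / 2))" for r b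
  proof (cases "r \<ge> 0")
    case True
    then have "(1 / 4 + r) powr - real m / c r ^ DIM('a) * c r powr b = (1 / 4 + r) powr - (real m + real DIM('a) / 2 - b / 2)"
      unfolding cp[OF True]
      by (simp add: powr_realpow[symmetric] powr_powr powr_diff[symmetric] powr_add[symmetric] algebra_simps)
    moreover have "A r / c r ^ DIM('a) * c r powr b = indicator {0..} r * (r powr (\<theta> - 1) * ((1 / 4 + r) powr - real m / c r ^ DIM('a) * c r powr b))"
      by (simp add: A_def)
    ultimately show ?thesis by (simp only:)
  qed (simp add: A_def)
  \<comment> \<open>Integrability at infinity requires m + n/2 - b/2 > \<theta> = m - g, that is b <
    n + 2g.\<close>
  have Ai: "integrable lborel (\<lambda>r. A r / c r ^ DIM('a) * c r powr b)" if "b < real DIM('a) + 2 * g" for b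
    unfolding Ac using \<theta> that by (intro integrable_beta_prime) (auto simp: \<theta>_def)
  have A0: "A r / c r ^ DIM('a) * c r powr 0 = A r / c r ^ DIM('a)" for r
    using cr[of r] by (cases "A r = 0") auto
  have G1: "integrable lebesgue G"
    unfolding G_def integrable_of_real_iff by (rule integrable_norm_power_gaussian)
  have G2: "G \<in> borel_measurable borel" unfolding G_def by measurable
  have mA: "A \<in> borel_measurable borel" "c \<in> borel_measurable borel" unfolding A_def c_def by measurable
  have A1: "integrable lborel (\<lambda>r. A r / c r ^ DIM('a))" using Ai[of 0] g unfolding A0 by simp
  obtain C where C: "C \<ge> 0" "\<And>\<xi>. norm \<xi> powr q * norm (fourier G \<xi>) \<le> C"
    using fourier_norm_gaussian_decay[OF q(1), where 'a='a and m=m] unfolding G_def by auto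
  have F: "F x = of_real (Gamma \<theta>) * complex_of_real (norm x powr (2 * g) * exp (- (norm x)\<^sup>2 / 4))" for x
  proof (cases "x = 0")
    case True
    then show ?thesis using m by (simp add: F_def G_def power_0_left)
  next
    case False
    have "A r * (norm (c r *\<^sub>R x) ^ (2 * m) * exp (- (norm (c r *\<^sub>R x))\<^sup>2)) =
        norm x ^ (2 * m) * exp (- (norm x)\<^sup>2 / 4) * (indicator {0..} r * (r powr (\<theta> - 1) * exp (- (norm x)\<^sup>2 * r)))" for r
    proof (cases "r \<ge> 0")
      case True
      then have "(norm (c r *\<^sub>R x))\<^sup>2 = (1 / 4 + r) * (norm x)\<^sup>2" by (simp add: power_mult_distrib c_def)
      note n = this
      have N: "norm (c r *\<^sub>R x) ^ (2 * m) = (1 / 4 + r) ^ m * norm x ^ (2 * m)"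
        by (simp only: power_mult n power_mult_distrib)
      have E: "exp (- (norm (c r *\<^sub>R x))\<^sup>2) = exp (- (norm x)\<^sup>2 / 4) * exp (- (norm x)\<^sup>2 * r)"
        by (simp only: n exp_add[symmetric]) (simp add: algebra_simps)
      have P: "(1 / 4 + r) powr - real m * (1 / 4 + r) ^ m = 1"
        using True by (simp add: powr_minus_divide powr_realpow)
      have "A r * (norm (c r *\<^sub>R x) ^ (2 * m) * exp (- (norm (c r *\<^sub>R x))\<^sup>2)) = ((1 / 4 + r) powr - real m * (1 / 4 + r) ^ m) *
          (norm x ^ (2 * m) * exp (- (norm x)\<^sup>2 / 4) * (indicator {0..} r * (r powr (\<theta> - 1) * exp (- (norm x)\<^sup>2 * r))))"
        unfolding N E A_def by (simp only: mult_ac)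
      then show ?thesis unfolding P by simp
    qed (simp add: A_def)
    then have *: "of_real (A r) * G (c r *\<^sub>R x) = complex_of_real (norm x ^ (2 * m) * exp (- (norm x)\<^sup>2 / 4) * (indicator {0..} r * (r powr (\<theta> - 1) * exp (- (norm x)\<^sup>2 * r))))" for r
      unfolding G_def of_real_mult[symmetric] by simp
    have "F x = of_real (norm x ^ (2 * m) * exp (- (norm x)\<^sup>2 / 4) * (LINT r|lborel. indicator {0..} r * (r powr (\<theta> - 1) * exp (- (norm x)\<^sup>2 * r))))"
      unfolding F_def * by (simp only: integral_complex_of_real integral_mult_right_zero)
    also have "(LINT r|lborel. indicator {0..} r * (r powr (\<theta> - 1) * exp (- (norm x)\<^sup>2 * r))) = Gamma \<theta> * (norm x)\<^sup>2 powr - \<theta>"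
      using has_bochner_integral_Gamma[OF \<theta>, of "(norm x)\<^sup>2"] False by (simp add: has_bochner_integral_iff)
    also have "norm x ^ (2 * m) * exp (- (norm x)\<^sup>2 / 4) * (Gamma \<theta> * (norm x)\<^sup>2 powr - \<theta>) = Gamma \<theta> * (norm x powr (2 * g) * exp (- (norm x)\<^sup>2 / 4))"
    proof -
      have "norm x ^ (2 * m) = norm x powr (2 * real m)"
        using False powr_realpow[of "norm x" "2 * m"] by simp
      moreover have "(norm x)\<^sup>2 powr - \<theta> = norm x powr (- 2 * \<theta>)"
        using False powr_powr[of "norm x" 2 "- \<theta>"] by simp
      ultimately have "norm x ^ (2 * m) * (norm x)\<^sup>2 powr - \<theta> = norm x powr (2 * real m + (- 2 * \<theta>))"
        by (simp only: powr_add)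
      also have "2 * real m + (- 2 * \<theta>) = 2 * g" by (simp add: \<theta>_def)
      finally have *: "norm x ^ (2 * m) * (norm x)\<^sup>2 powr - \<theta> = norm x powr (2 * g)" .
      show ?thesis unfolding *[symmetric] by (simp only: mult_ac)
    qed
    finally show ?thesis by (simp only: of_real_mult)
  qed
  have "norm \<xi> powr q * norm (fourier (\<lambda>x. complex_of_real (norm x powr (2 * g) * exp (- (norm x)\<^sup>2 / 4))) \<xi>) \<le>
     (LINT s|lborel. \<bar>A s / c s ^ DIM('a) * c s powr q\<bar> * C) / Gamma \<theta>" for \<xi> :: 'a
  proof -
    have "norm \<xi> powr q * norm (fourier F \<xi>) \<le> (LINT s|lborel. \<bar>A s / c s ^ DIM('a) * c s powr q\<bar> * C)"
      unfolding F_def by (rule fourier_scale_mixture_bound[OF G1 G2 mA cr A1 C(2) Ai[OF q(2)]])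
    moreover have "fourier F \<xi> = of_real (Gamma \<theta>) * fourier (\<lambda>x. complex_of_real (norm x powr (2 * g) * exp (- (norm x)\<^sup>2 / 4))) \<xi>"
      unfolding F fourier_def by (simp only: mult.left_commute[of _ "of_real (Gamma \<theta>)"] integral_mult_right_zero)
    ultimately show ?thesis using Gamma_real_pos[OF \<theta>]
      by (simp add: norm_mult field_simps)
  qed
  moreover have "(LINT s|lborel. \<bar>A s / c s ^ DIM('a) * c s powr q\<bar> * C) / Gamma \<theta> \<ge> 0"
    using Gamma_real_pos[OF \<theta>] C(1) by (intro divide_nonneg_pos Bochner_Integration.integral_nonneg) auto
  ultimately show ?thesis by blast
qed

section \<open>The weight (1 + |x|^2)^(-q/2) and its fractional Laplacians\<close>

definition japanese :: "real \<Rightarrow> 'a::euclidean_space \<Rightarrow> real" where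
  "japanese q x = (1 + (norm x)\<^sup>2) powr (- q / 2)"

definition frac_symbol :: "real \<Rightarrow> ('a::euclidean_space \<Rightarrow> complex) \<Rightarrow> 'a \<Rightarrow> complex" where
  "frac_symbol g f \<xi> = of_real (norm \<xi> powr (2 * g)) * fourier f \<xi>"

lemma frac_laplacian_eq: "frac_laplacian g f x = Re (inv_fourier (frac_symbol g (\<lambda>y. of_real (f y))) x)"
  by (simp add: frac_laplacian_def frac_symbol_def[abs_def])

lemma japanese_pos: "japanese q x > 0"
proof -
  have "1 + (norm x)\<^sup>2 > 0" by (simp add: add_pos_nonneg)
  then show ?thesis by (simp add: japanese_def)
qed

lemma japanese_le_1: "q \<ge> 0 \<Longrightarrow> japanese q x \<le> 1"
  using powr_mono[of "- q / 2" 0 "1 + (norm x)\<^sup>2"] by (auto simp: japanese_def split: if_splits)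

text \<open>Inside the unit ball the weight is at least 2^(-q/2) and the plain bound C is used;
  outside, 1 + |x|^2 \<le> 2 |x|^2 and the decay bound D is used.\<close>

lemma japanese_bound:
  assumes q: "q \<ge> 0" and "y \<le> C" "norm x powr q * y \<le> D" "C \<ge> 0" "D \<ge> 0"
  shows "y \<le> 2 powr (q / 2) * (C + D) * japanese q x"
proof (cases "norm x \<le> 1")
  case True
  have "(norm x)\<^sup>2 \<le> 1" using True by (simp add: power_le_one)
  then have "2 powr (- q / 2) \<le> japanese q x" unfolding japanese_def using q
    by (intro powr_mono2') (auto intro: add_pos_nonneg)
  then have "2 powr (q / 2) * (C + D) * 2 powr (- q / 2) \<le> 2 powr (q / 2) * (C + D) * japanese q x"
    using assms by (intro mult_left_mono) auto
  moreover have "2 powr (q / 2) * (C + D) * 2 powr (- q / 2) = C + D" by (simp add: powr_minus_divide)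
  ultimately show ?thesis using assms by linarith
next
  case False
  then have n: "norm x > 0" "1 \<le> (norm x)\<^sup>2" by (auto simp: one_le_power)
  have "(2 * (norm x)\<^sup>2) powr (- q / 2) \<le> japanese q x" unfolding japanese_def using q n
    by (intro powr_mono2') (auto intro: add_pos_nonneg)
  moreover have "(2 * (norm x)\<^sup>2) powr (- q / 2) = 2 powr (- q / 2) * norm x powr (- q)"
    using n powr_powr[of "norm x" 2 "- q / 2"] by (simp add: powr_mult)
  ultimately have "2 powr (q / 2) * (C + D) * (2 powr (- q / 2) * norm x powr (- q)) \<le> 2 powr (q / 2) * (C + D) * japanese q x"
    using assms by (intro mult_left_mono) auto
  moreover have "2 powr (q / 2) * (C + D) * (2 powr (- q / 2) * norm x powr (- q)) = (C + D) * norm x powr (- q)"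
    by (simp add: powr_minus_divide)
  moreover have "y \<le> D * norm x powr (- q)"
    using assms(3) n by (simp add: powr_minus_divide field_simps)
  moreover have "C * norm x powr (- q) \<ge> 0" using assms by simp
  ultimately show ?thesis using distrib_right[of C D "norm x powr (- q)"] by linarith
qed

lemma has_bochner_integral_Gamma_1:
  assumes "s > 0"
  shows "has_bochner_integral lborel (\<lambda>r::real. indicator {0..} r * (r powr (s - 1) * exp (- r))) (Gamma s)"
  using has_bochner_integral_Gamma[OF assms, of 1] by simp

lemma integrable_std_real_gaussian: "integrable lebesgue (\<lambda>x::'a::euclidean_space. complex_of_real (exp (- (norm x)\<^sup>2)))"
  using integrable_gaussian[of 1, where 'a='a] by (simp add: integrable_of_real_iff)

text \<open>The Gamma integral with y = 1 + |x|^2 displays the weight as a mixture of the Gaussians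
  exp (- s |x|^2). Dividing by sqrt s ^ n leaves the exponent (q - n)/2 - 1 at s = 0, integrable
  because q > n.\<close>

lemma
  fixes q :: real
  assumes q: "q > real DIM('a::euclidean_space)"
  shows integrable_japanese: "integrable lebesgue (\<lambda>x::'a. complex_of_real (japanese q x))"
    and fourier_japanese: "fourier (\<lambda>x::'a. complex_of_real (japanese q x)) \<xi> =
      of_real (1 / Gamma (q / 2)) * (LINT s|lborel. of_real (indicator {0..} s * (s powr ((q - real DIM('a)) / 2 - 1) * exp (- s)) * (2 powr (- real DIM('a) / 2) * exp (- (norm ((1 / sqrt s) *\<^sub>R \<xi>))\<^sup>2 / 4))))"
proof -
  let ?n = "real DIM('a)"
  have q0: "q / 2 > 0" using q by (auto intro: le_less_trans[of 0 "real DIM('a)"])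
  then have Gq: "Gamma (q / 2) > 0" by (rule Gamma_real_pos)
  define G where "G x = complex_of_real (exp (- (norm x)\<^sup>2))" for x :: 'a
  define A where "A s = indicator {0..} s * (s powr (q / 2 - 1) * exp (- s))" for s :: real
  define F where "F x = (LINT s|lborel. of_real (A s) * G (sqrt s *\<^sub>R x))" for x :: 'a
  have c: "sqrt s > 0" if "A s \<noteq> 0" for s
    using that by (cases "s = 0") (auto simp: A_def split: split_indicator_asm)
  have Ac: "A s / sqrt s ^ DIM('a) = indicator {0..} s * (s powr ((q - ?n) / 2 - 1) * exp (- s))" for s
  proof (cases "s > 0")
    case True
    then have e1: "sqrt s ^ DIM('a) = s powr (?n / 2)"
      by (simp add: powr_half_sqrt[symmetric] powr_realpow[symmetric] powr_powr)
    have e2: "s powr (q / 2 - 1) / s powr (?n / 2) = s powr ((q - ?n) / 2 - 1)"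
      unfolding powr_diff[symmetric] by (rule arg_cong[where f="\<lambda>z. s powr z"]) (simp add: field_simps)
    show ?thesis unfolding A_def e1 e2[symmetric] by simp
  qed (auto simp: A_def split: split_indicator)
  have Ai: "integrable lborel (\<lambda>s. A s / sqrt s ^ DIM('a))"
    unfolding Ac using has_bochner_integral_Gamma_1[of "(q - ?n) / 2"] q by (simp add: has_bochner_integral_iff)
  have m: "A \<in> borel_measurable borel" "sqrt \<in> borel_measurable borel" "G \<in> borel_measurable borel"
    unfolding A_def G_def by measurable
  have G1: "integrable lebesgue G" unfolding G_def by (rule integrable_std_real_gaussian)
  have F: "F x = of_real (Gamma (q / 2)) * complex_of_real (japanese q x)" for x
  proof -
    have y: "1 + (norm x)\<^sup>2 > 0" by (simp add: add_pos_nonneg)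
    have "of_real (A s) * G (sqrt s *\<^sub>R x) = complex_of_real (indicator {0..} s * (s powr (q / 2 - 1) * exp (- (1 + (norm x)\<^sup>2) * s)))" for s
    proof (cases "s \<ge> 0")
      case True
      then have "exp (- s) * exp (- (norm (sqrt s *\<^sub>R x))\<^sup>2) = exp (- (1 + (norm x)\<^sup>2) * s)"
        by (simp add: power_mult_distrib algebra_simps flip: exp_add)
      then have "A s * exp (- (norm (sqrt s *\<^sub>R x))\<^sup>2) = indicator {0..} s * (s powr (q / 2 - 1) * exp (- (1 + (norm x)\<^sup>2) * s))"
        unfolding A_def by (simp only: mult.assoc)
      then show ?thesis unfolding G_def by (simp only: of_real_mult[symmetric])
    qed (simp add: A_def)
    then have "F x = of_real (LINT s|lborel. indicator {0..} s * (s powr (q / 2 - 1) * exp (- (1 + (norm x)\<^sup>2) * s)))"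
      unfolding F_def by (simp only: integral_complex_of_real)
    also have "(LINT s|lborel. indicator {0..} s * (s powr (q / 2 - 1) * exp (- (1 + (norm x)\<^sup>2) * s))) = Gamma (q / 2) * japanese q x"
      using has_bochner_integral_Gamma[OF q0 y] by (simp only: has_bochner_integral_iff japanese_def) simp
    finally show ?thesis by (simp only: of_real_mult)
  qed
  have J: "complex_of_real (japanese q x) = of_real (1 / Gamma (q / 2)) * F x" for x :: 'a
    unfolding F using Gq by simp
  show "integrable lebesgue (\<lambda>x::'a. complex_of_real (japanese q x))"
    unfolding J using integrable_scale_mixture[OF G1 m(3) m(1,2) c Ai] unfolding F_def by (rule integrable_mult_right)
  have fG: "fourier G \<eta> = of_real (2 powr (- ?n / 2) * exp (- (norm \<eta>)\<^sup>2 / 4))" for \<eta>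
    using fourier_gaussian[of 1 \<eta>] unfolding G_def by simp
  have "fourier (\<lambda>x::'a. complex_of_real (japanese q x)) \<xi> = of_real (1 / Gamma (q / 2)) * fourier F \<xi>"
    unfolding J fourier_def by (simp only: mult.left_commute[of _ "of_real (1 / Gamma (q / 2))"] integral_mult_right_zero)
  also have "fourier F \<xi> = (LINT s|lborel. of_real (A s / sqrt s ^ DIM('a)) * fourier G ((1 / sqrt s) *\<^sub>R \<xi>))"
    unfolding F_def by (rule fourier_scale_mixture[OF G1 m(3) m(1,2) c Ai])
  finally show "fourier (\<lambda>x::'a. complex_of_real (japanese q x)) \<xi> =
      of_real (1 / Gamma (q / 2)) * (LINT s|lborel. of_real (indicator {0..} s * (s powr ((q - ?n) / 2 - 1) * exp (- s)) * (2 powr (- ?n / 2) * exp (- (norm ((1 / sqrt s) *\<^sub>R \<xi>))\<^sup>2 / 4))))"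
    unfolding Ac fG by (simp only: of_real_mult)
qed

text \<open>Multiplying the mixture for the transform by |\<xi>|^(2g) yields another scale mixture,
  now of |x|^(2g) exp (- |x|^2 / 4). A second Fourier transform is therefore controlled by
  \<open>fractional_gaussian_decay\<close>, which supplies decay of order q as long as q < n +
  2g.\<close>

lemma
  fixes q g :: real
  assumes q: "q > real DIM('a::euclidean_space)" and g: "g \<ge> 0"
  shows integrable_frac_symbol_japanese: "integrable lebesgue (frac_symbol g (\<lambda>x::'a. complex_of_real (japanese q x)))"
    and frac_laplacian_japanese_decay: "g > 0 \<Longrightarrow> q < real DIM('a) + 2 * g \<Longrightarrow>
      \<exists>C\<ge>0. \<forall>\<xi>::'a. norm \<xi> powr q * norm (fourier (frac_symbol g (\<lambda>x. complex_of_real (japanese q x))) \<xi>) \<le> C"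
proof -
  let ?n = "real DIM('a)"
  have q0: "q / 2 > 0" using q by (auto intro: le_less_trans[of 0 "real DIM('a)"])
  then have Gq: "Gamma (q / 2) > 0" by (rule Gamma_real_pos)
  define G where "G x = complex_of_real (norm x powr (2 * g) * exp (- (norm x)\<^sup>2 / 4))" for x :: 'a
  define c where "c s = 1 / sqrt s" for s
  \<comment> \<open>The extra power of s compensates the factor s^(-g) that arises when |\<xi>|^(2g)
    is absorbed into the dilated G.\<close>
  define A where "A s = indicator {0..} s * (s powr ((q - ?n) / 2 - 1 + g) * exp (- s)) * 2 powr (- ?n / 2)" for s :: real
  define F where "F x = (LINT s|lborel. of_real (A s) * G (c s *\<^sub>R x))" for x :: 'a
  have cp: "c s = s powr (- (1 / 2))" if "s > 0" for s
    using that by (simp add: c_def powr_half_sqrt powr_minus_divide)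
  have c: "c s > 0" if "A s \<noteq> 0" for s
    using that by (cases "s = 0") (auto simp: A_def c_def split: split_indicator_asm)
  have Acb: "A s / c s ^ DIM('a) * c s powr b = 2 powr (- ?n / 2) * (indicator {0..} s * (s powr ((q / 2 + g - b / 2) - 1) * exp (- s)))" for s b
  proof (cases "s > 0")
    case True
    have "s powr ((q - ?n) / 2 - 1 + g) / c s ^ DIM('a) * c s powr b = s powr ((q / 2 + g - b / 2) - 1)"
      unfolding cp[OF True] using True
      by (simp add: powr_realpow[symmetric] powr_powr powr_diff[symmetric] powr_add[symmetric])
         (simp add: field_simps)
    moreover have "A s / c s ^ DIM('a) * c s powr b = 2 powr (- ?n / 2) * (indicator {0..} s * ((s powr ((q - ?n) / 2 - 1 + g) / c s ^ DIM('a) * c s powr b) * exp (- s)))"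
      unfolding A_def by simp
    ultimately show ?thesis by (simp only:)
  qed (auto simp: A_def split: split_indicator)
  have A0: "A s / c s ^ DIM('a) * c s powr 0 = A s / c s ^ DIM('a)" for s
    using c[of s] by (cases "A s = 0") auto
  \<comment> \<open>After the dilations the exponent at s = 0 is q/2 + g - b/2 - 1, hence the bound
    on b. The values b = 0 and b = q are used.\<close>
  have Aib: "integrable lborel (\<lambda>s. A s / c s ^ DIM('a) * c s powr b)" if "b < q + 2 * g" for b
    unfolding Acb using has_bochner_integral_Gamma_1[of "q / 2 + g - b / 2"] that
    by (intro integrable_mult_right) (auto simp: has_bochner_integral_iff field_simps)
  have Ai: "integrable lborel (\<lambda>s. A s / c s ^ DIM('a))"
    using Aib[of 0] q0 g unfolding A0 by simp
  have m: "A \<in> borel_measurable borel" "c \<in> borel_measurable borel" "G \<in> borel_measurable borel"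
    unfolding A_def G_def c_def by measurable
  have G1: "integrable lebesgue G"
    using integrable_norm_powr_gaussian[OF g, of "1 / 4", where 'a='a] unfolding G_def integrable_of_real_iff by simp
  let ?J = "\<lambda>x::'a. complex_of_real (japanese q x)"
  have F: "F \<xi> = of_real (Gamma (q / 2)) * frac_symbol g ?J \<xi>" for \<xi>
  proof -
    have "of_real (A s) * G (c s *\<^sub>R \<xi>) = of_real (norm \<xi> powr (2 * g)) * complex_of_real (indicator {0..} s * (s powr ((q - ?n) / 2 - 1) * exp (- s)) * (2 powr (- ?n / 2) * exp (- (norm ((1 / sqrt s) *\<^sub>R \<xi>))\<^sup>2 / 4)))" for s
    proof (cases "s > 0")
      case True
      have "norm (c s *\<^sub>R \<xi>) powr (2 * g) = norm \<xi> powr (2 * g) * s powr (- g)"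
        using True by (simp add: cp powr_mult powr_powr mult.commute)
      moreover have "s powr ((q - ?n) / 2 - 1 + g) * s powr (- g) = s powr ((q - ?n) / 2 - 1)"
        by (simp flip: powr_add)
      moreover have "A s * (norm \<xi> powr (2 * g) * s powr (- g) * exp (- (norm (c s *\<^sub>R \<xi>))\<^sup>2 / 4)) =
         norm \<xi> powr (2 * g) * (indicator {0..} s * ((s powr ((q - ?n) / 2 - 1 + g) * s powr (- g)) * exp (- s)) * (2 powr (- ?n / 2) * exp (- (norm (c s *\<^sub>R \<xi>))\<^sup>2 / 4)))"
        unfolding A_def by (simp only: mult_ac)
      ultimately show ?thesis unfolding G_def c_def by (simp only: of_real_mult[symmetric])
    qed (auto simp: A_def split: split_indicator)
    then have "F \<xi> = of_real (norm \<xi> powr (2 * g)) * (LINT s|lborel. of_real (indicator {0..} s * (s powr ((q - ?n) / 2 - 1) * exp (- s)) * (2 powr (- ?n / 2) * exp (- (norm ((1 / sqrt s) *\<^sub>R \<xi>))\<^sup>2 / 4))))"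
      unfolding F_def by (simp only: integral_mult_right_zero)
    then show ?thesis unfolding frac_symbol_def fourier_japanese[OF q] using Gq by simp
  qed
  have S: "frac_symbol g ?J = (\<lambda>\<xi>. of_real (1 / Gamma (q / 2)) * F \<xi>)"
    unfolding F using Gq by simp
  show "integrable lebesgue (frac_symbol g ?J)"
    unfolding S F_def by (intro integrable_mult_right integrable_scale_mixture[OF G1 m(3) m(1,2) c Ai])
  assume g': "g > 0" "q < ?n + 2 * g"
  obtain C where C: "C \<ge> 0" "\<And>\<xi>::'a. norm \<xi> powr q * norm (fourier G \<xi>) \<le> C"
    using fractional_gaussian_decay[OF g'(1) _ g'(2)] q0 unfolding G_def by auto
  let ?C = "LINT s|lborel. \<bar>A s / c s ^ DIM('a) * c s powr q\<bar> * C"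
  have "norm \<xi> powr q * norm (fourier (frac_symbol g ?J) \<xi>) \<le> 1 / Gamma (q / 2) * ?C" for \<xi> :: 'a
  proof -
    have "norm \<xi> powr q * norm (fourier F \<xi>) \<le> ?C"
      unfolding F_def by (rule fourier_scale_mixture_bound[OF G1 m(3) m(1,2) c Ai C(2) Aib]) (use g' in auto)
    moreover have "fourier (frac_symbol g ?J) \<xi> = of_real (1 / Gamma (q / 2)) * fourier F \<xi>"
      unfolding S fourier_def by (simp only: mult.left_commute[of _ "of_real (1 / Gamma (q / 2))"] integral_mult_right_zero)
    ultimately show ?thesis using Gq by (simp add: norm_mult norm_divide divide_right_mono)
  qed
  moreover have "1 / Gamma (q / 2) * ?C \<ge> 0"
    using Gq C(1) by (intro mult_nonneg_nonneg Bochner_Integration.integral_nonneg) auto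
  ultimately show "\<exists>C\<ge>0. \<forall>\<xi>::'a. norm \<xi> powr q * norm (fourier (frac_symbol g ?J) \<xi>) \<le> C"
    by blast
qed

section \<open>Square-integrable functions\<close>

lemma L2_D:
  assumes "f \<in> L2" shows "f \<in> borel_measurable lebesgue" "integrable lebesgue (\<lambda>x. (norm (f x))\<^sup>2)"
  using assms by (simp_all add: L2_def)

lemma L2_norm_nonneg: "L2_norm f \<ge> 0"
  by (simp add: L2_norm_def)

lemma L2_norm_power2: "(L2_norm f)\<^sup>2 = (LINT x|lebesgue. (norm (f x))\<^sup>2)"
  by (simp add: L2_norm_def)

lemma nn_integral_L2:
  assumes "f \<in> L2" shows "(\<integral>\<^sup>+x. ennreal ((norm (f x))\<^sup>2) \<partial>lebesgue) = ennreal ((L2_norm f)\<^sup>2)"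
  unfolding L2_norm_power2 using L2_D[OF assms] by (intro nn_integral_eq_integral) auto

lemma L2_I_nn_integral:
  assumes m: "f \<in> borel_measurable lebesgue" and "(\<integral>\<^sup>+x. ennreal ((norm (f x))\<^sup>2) \<partial>lebesgue) \<le> ennreal (b\<^sup>2)" "b \<ge> 0"
  shows "f \<in> L2" "L2_norm f \<le> b"
proof -
  have "(\<integral>\<^sup>+x. ennreal (norm ((norm (f x))\<^sup>2)) \<partial>lebesgue) < \<infinity>"
    using assms(2) by (simp add: le_less_trans)
  with m show *: "f \<in> L2" by (auto simp: L2_def intro!: integrableI_bounded)
  have "(L2_norm f)\<^sup>2 \<le> b\<^sup>2" using assms(2) unfolding nn_integral_L2[OF *] by simp
  then show "L2_norm f \<le> b" using assms(3) by (rule power2_le_imp_le)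
qed

lemma nn_integral_L2_mult_le:
  assumes [measurable]: "f \<in> borel_measurable lebesgue" "g \<in> borel_measurable lebesgue"
  shows "(\<integral>\<^sup>+x. ennreal (norm (f x * g x :: complex)) \<partial>lebesgue)\<^sup>2 \<le>
    (\<integral>\<^sup>+x. ennreal ((norm (f x))\<^sup>2) \<partial>lebesgue) * (\<integral>\<^sup>+x. ennreal ((norm (g x))\<^sup>2) \<partial>lebesgue)"
  using Cauchy_Schwarz_nn_integral[of "\<lambda>x. ennreal (norm (f x))" lebesgue "\<lambda>x. ennreal (norm (g x))"]
  by (simp add: norm_mult ennreal_mult' ennreal_power)

lemma ennreal_power2_le_imp_le:
  assumes "a\<^sup>2 \<le> (ennreal b)\<^sup>2" "b \<ge> 0" shows "a \<le> ennreal b"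
  using assms by (cases a) (auto simp: ennreal_power power_mono_iff top_power_ennreal top_unique intro: power2_le_imp_le)

lemma ennreal_double_sum: "a \<ge> 0 \<Longrightarrow> b \<ge> 0 \<Longrightarrow> 2 * ennreal a + 2 * ennreal b = ennreal (2 * a + 2 * b)"
  by (simp add: ennreal_mult')

lemma
  assumes f: "f \<in> L2" and g: "g \<in> L2"
  shows integrable_L2_mult: "integrable lebesgue (\<lambda>x. f x * g x)"
    and norm_integral_L2_mult_le: "norm (LINT x|lebesgue. f x * g x) \<le> L2_norm f * L2_norm g"
proof -
  note m = L2_D(1)[OF f] L2_D(1)[OF g]
  have *: "(\<integral>\<^sup>+x. ennreal (norm (f x * g x)) \<partial>lebesgue)\<^sup>2 \<le> (ennreal (L2_norm f * L2_norm g))\<^sup>2"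
    using nn_integral_L2_mult_le[OF m] unfolding nn_integral_L2[OF f] nn_integral_L2[OF g]
    by (simp add: power_mult_distrib ennreal_mult ennreal_power L2_norm_nonneg)
  then have *: "(\<integral>\<^sup>+x. ennreal (norm (f x * g x)) \<partial>lebesgue) \<le> ennreal (L2_norm f * L2_norm g)"
    by (rule ennreal_power2_le_imp_le) (simp add: L2_norm_nonneg)
  then have "(\<integral>\<^sup>+x. ennreal (norm (f x * g x)) \<partial>lebesgue) < \<infinity>"
    by (rule le_less_trans) simp
  then show i: "integrable lebesgue (\<lambda>x. f x * g x)"
    using m by (intro integrableI_bounded) auto
  have "ennreal (LINT x|lebesgue. norm (f x * g x)) \<le> ennreal (L2_norm f * L2_norm g)"
    using * i by (subst (asm) nn_integral_eq_integral) auto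
  then have "(LINT x|lebesgue. norm (f x * g x)) \<le> L2_norm f * L2_norm g"
    by (simp add: L2_norm_nonneg)
  then show "norm (LINT x|lebesgue. f x * g x) \<le> L2_norm f * L2_norm g"
    using integral_norm_bound by (rule order_trans[rotated])
qed

lemma norm_add_power2_le: "(norm (a + b))\<^sup>2 \<le> 2 * (norm a)\<^sup>2 + 2 * (norm b)\<^sup>2"
  for a b :: "'a::real_normed_vector"
proof -
  have "(norm (a + b))\<^sup>2 \<le> (norm a + norm b)\<^sup>2" by (intro power_mono norm_triangle_ineq) simp
  also have "\<dots> \<le> 2 * (norm a)\<^sup>2 + 2 * (norm b)\<^sup>2"
    using sum_squares_bound[of "norm a" "norm b"] by (simp add: power2_sum)
  finally show ?thesis .
qed

lemma norm_diff_power2_le: "(norm (a - b))\<^sup>2 \<le> 2 * (norm a)\<^sup>2 + 2 * (norm b)\<^sup>2"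
  for a b :: "'a::real_normed_vector"
  using norm_add_power2_le[of a "- b"] by simp

lemma L2_diff: "f \<in> L2 \<Longrightarrow> g \<in> L2 \<Longrightarrow> (\<lambda>x. f x - g x) \<in> L2"
  unfolding L2_def
  by (auto intro!: Bochner_Integration.integrable_bound[where g="\<lambda>x. (norm (f x - g x))\<^sup>2" and f="\<lambda>x. 2 * (norm (f x))\<^sup>2 + 2 * (norm (g x))\<^sup>2"] norm_diff_power2_le)

lemma L2_norm_cong_AE:
  assumes "AE x in lebesgue. f x = g x" "f \<in> borel_measurable lebesgue" "g \<in> borel_measurable lebesgue"
  shows "L2_norm f = L2_norm g"
  unfolding L2_norm_def by (intro arg_cong[where f=sqrt] integral_cong_AE) (use assms in auto)

lemma L2_cong_AE:
  assumes "AE x in lebesgue. f x = g x" "f \<in> L2" "g \<in> borel_measurable lebesgue"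
  shows "g \<in> L2"
proof -
  have "integrable lebesgue (\<lambda>x. (norm (g x))\<^sup>2)"
    using L2_D(2)[OF assms(2)]
    by (rule integrable_cong_AE_imp) (use assms in auto)
  with assms(3) show ?thesis by (simp add: L2_def)
qed

lemma L2_norm_power2_le:
  assumes "f \<in> L2" "g \<in> L2"
  shows "(L2_norm f)\<^sup>2 \<le> 2 * (L2_norm (\<lambda>x. f x - g x))\<^sup>2 + 2 * (L2_norm g)\<^sup>2"
proof -
  note d = L2_diff[OF assms]
  have "(LINT x|lebesgue. (norm (f x))\<^sup>2) \<le> (LINT x|lebesgue. 2 * (norm (f x - g x))\<^sup>2 + 2 * (norm (g x))\<^sup>2)"
    using norm_add_power2_le[of "f x - g x" "g x" for x] L2_D(2)[OF d] L2_D(2)[OF assms(1)] L2_D(2)[OF assms(2)]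
    by (intro integral_mono) auto
  also have "\<dots> = 2 * (L2_norm (\<lambda>x. f x - g x))\<^sup>2 + 2 * (L2_norm g)\<^sup>2"
    unfolding L2_norm_power2 using L2_D(2)[OF d] L2_D(2)[OF assms(2)] by simp
  finally show ?thesis unfolding L2_norm_power2 .
qed

lemma
  assumes "integrable lebesgue w" "w \<in> L2"
  shows fourier_L2: "fourier w \<in> L2" and L2_norm_fourier_le: "L2_norm (fourier w) \<le> L2_norm w"
  using L2_I_nn_integral[OF measurable_fourier_lebesgue[OF assms(1)], of "L2_norm w"]
    nn_integral_fourier_le[OF assms(1)] nn_integral_L2[OF assms(2)] by (auto simp: L2_norm_nonneg)

lemma
  assumes "f \<in> L2"
  shows L2_reflect: "(\<lambda>x. f (- x)) \<in> L2" and L2_norm_reflect: "L2_norm (\<lambda>x. f (- x)) = L2_norm f"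
proof -
  have "(\<lambda>x. f (- x)) \<in> borel_measurable lebesgue"
    using measurable_compose[OF lebesgue_affine(2)[of "-1" 0] L2_D(1)[OF assms]] by simp
  then show "(\<lambda>x. f (- x)) \<in> L2" using integrable_affine[of "-1" "\<lambda>x. (norm (f x))\<^sup>2" 0] L2_D(2)[OF assms]
    by (simp add: L2_def)
  show "L2_norm (\<lambda>x. f (- x)) = L2_norm f"
    using integral_affine[of "-1" "\<lambda>x. (norm (f x))\<^sup>2" 0] by (simp add: L2_norm_def)
qed

lemma fourier_reflect: "fourier (\<lambda>x. f (- x)) \<xi> = fourier f (- \<xi>)"
  using integral_affine[of "-1" "\<lambda>x. cis (x \<bullet> \<xi>) * f x" 0] by (simp add: fourier_def)

text \<open>Cauchy-Schwarz against the indicator of the ball, which has finite measure.\<close>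

lemma integrable_truncation:
  assumes "f \<in> L2" shows "integrable lebesgue (\<lambda>x::'a::euclidean_space. indicator (cball 0 R) x * f x)"
proof (rule integrable_L2_mult[OF _ assms])
  have "integrable lebesgue (indicator (cball (0::'a) R) :: 'a \<Rightarrow> real)"
    using emeasure_bounded_finite[OF bounded_cball, of "0::'a" R] by (intro integrable_real_indicator) auto
  moreover have "(norm (indicator (cball 0 R) x :: complex))\<^sup>2 = indicator (cball 0 R) x" for x :: 'a
    by (auto simp: indicator_def)
  ultimately show "(\<lambda>x::'a. indicator (cball 0 R) x) \<in> L2"
    by (auto simp: L2_def intro!: borel_measurable_indicator)
qed

lemma is_L2_fourier_sequence:
  assumes "is_L2_fourier f g"
  shows "(\<lambda>k. \<integral>\<^sup>+\<xi>. ennreal ((norm (g \<xi> - fourier (\<lambda>x. indicator (cball 0 (real k)) x * f x) \<xi>))\<^sup>2) \<partial>lebesgue) \<longlonglongrightarrow> 0"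
  using assms unfolding is_L2_fourier_def by (auto intro: filterlim_compose[OF _ filterlim_real_sequentially])

lemma is_L2_fourier_diff:
  assumes 1: "is_L2_fourier f g" and 2: "is_L2_fourier f' g'"
  shows "is_L2_fourier (\<lambda>x. f x - f' x) (\<lambda>x. g x - g' x)"
proof -
  note L = 1[unfolded is_L2_fourier_def] 2[unfolded is_L2_fourier_def]
  let ?F = "\<lambda>f R. fourier (\<lambda>x. indicator (cball 0 R) x * f x)"
  let ?d = "\<lambda>f g R. \<integral>\<^sup>+\<xi>. ennreal ((norm (g \<xi> - ?F f R \<xi>))\<^sup>2) \<partial>lebesgue"
  have [measurable]: "?F f R \<in> borel_measurable lebesgue" "?F f' R \<in> borel_measurable lebesgue" for R
    using L by (auto intro!: measurable_fourier_lebesgue integrable_truncation)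
  have [measurable]: "g \<in> borel_measurable lebesgue" "g' \<in> borel_measurable lebesgue" using L by (auto dest: L2_D)
  have F: "?F (\<lambda>x. f x - f' x) R \<xi> = ?F f R \<xi> - ?F f' R \<xi>" for R \<xi>
  proof -
    have i: "integrable lebesgue (\<lambda>x. cis (- (x \<bullet> \<xi>)) * (indicator (cball 0 R) x * h x))" if "h \<in> L2" for h
      by (intro integrable_cis_mult integrable_truncation that measurable_compose[OF ident_lebesgue_borel]) simp
    show ?thesis unfolding fourier_def
      using i[of f] i[of f'] L by (simp add: algebra_simps Bochner_Integration.integral_diff)
  qed
  have le: "?d (\<lambda>x. f x - f' x) (\<lambda>x. g x - g' x) R \<le> 2 * ?d f g R + 2 * ?d f' g' R" for R
  proof -
    have "?d (\<lambda>x. f x - f' x) (\<lambda>x. g x - g' x) R \<le> (\<integral>\<^sup>+\<xi>. 2 * ennreal ((norm (g \<xi> - ?F f R \<xi>))\<^sup>2) + 2 * ennreal ((norm (g' \<xi> - ?F f' R \<xi>))\<^sup>2) \<partial>lebesgue)"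
    proof (intro nn_integral_mono)
      fix \<xi>
      have "(norm (g \<xi> - g' \<xi> - ?F (\<lambda>x. f x - f' x) R \<xi>))\<^sup>2 = (norm ((g \<xi> - ?F f R \<xi>) - (g' \<xi> - ?F f' R \<xi>)))\<^sup>2"
        unfolding F by (simp add: algebra_simps)
      also have "\<dots> \<le> 2 * (norm (g \<xi> - ?F f R \<xi>))\<^sup>2 + 2 * (norm (g' \<xi> - ?F f' R \<xi>))\<^sup>2"
        by (rule norm_diff_power2_le)
      finally show "ennreal ((norm (g \<xi> - g' \<xi> - ?F (\<lambda>x. f x - f' x) R \<xi>))\<^sup>2) \<le> 2 * ennreal ((norm (g \<xi> - ?F f R \<xi>))\<^sup>2) + 2 * ennreal ((norm (g' \<xi> - ?F f' R \<xi>))\<^sup>2)"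
        by (simp only: ennreal_double_sum[OF zero_le_power2 zero_le_power2] ennreal_leI)
    qed
    also have "\<dots> = 2 * ?d f g R + 2 * ?d f' g' R"
      by (simp add: nn_integral_add nn_integral_cmult)
    finally show ?thesis .
  qed
  have "((\<lambda>R. 2 * ?d f g R + 2 * ?d f' g' R) \<longlongrightarrow> 2 * 0 + 2 * 0) at_top"
    using L by (intro tendsto_add ennreal_tendsto_cmult) auto
  then have "(?d (\<lambda>x. f x - f' x) (\<lambda>x. g x - g' x) \<longlongrightarrow> 0) at_top"
    by (intro tendsto_sandwich[of "\<lambda>_. 0" "?d (\<lambda>x. f x - f' x) (\<lambda>x. g x - g' x)" at_top "\<lambda>R. 2 * ?d f g R + 2 * ?d f' g' R"])
       (auto intro!: always_eventually le)
  then show ?thesis using L unfolding is_L2_fourier_def by (auto intro: L2_diff)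
qed

text \<open>The difference is a transform of the zero function, for which the quantity in the
  defining limit is constant in R and hence 0.\<close>

lemma is_L2_fourier_unique:
  assumes 1: "is_L2_fourier f g" and 2: "is_L2_fourier f g'"
  shows "AE x in lebesgue. g x = g' x"
proof -
  have L: "is_L2_fourier (\<lambda>x. 0) (\<lambda>x. g x - g' x)"
    using is_L2_fourier_diff[OF 1 2] by simp
  then have [measurable]: "(\<lambda>x. g x - g' x) \<in> borel_measurable lebesgue"
    by (auto simp: is_L2_fourier_def L2_def)
  have "((\<lambda>R::real. \<integral>\<^sup>+\<xi>. ennreal ((norm (g \<xi> - g' \<xi>))\<^sup>2) \<partial>lebesgue) \<longlongrightarrow> 0) at_top"
    using L by (simp add: is_L2_fourier_def fourier_def)
  then have "(\<integral>\<^sup>+\<xi>. ennreal ((norm (g \<xi> - g' \<xi>))\<^sup>2) \<partial>lebesgue) = 0"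
    by (simp add: tendsto_const_iff)
  then have "AE \<xi> in lebesgue. ennreal ((norm (g \<xi> - g' \<xi>))\<^sup>2) = 0"
    by (subst (asm) nn_integral_0_iff_AE) auto
  then show ?thesis by eventually_elim simp
qed

lemma tendsto_0_if_power2_le:
  fixes z :: "nat \<Rightarrow> 'b::real_normed_vector"
  assumes le: "\<And>k. ennreal (norm (z k)) ^ 2 \<le> B k" and B: "B \<longlonglongrightarrow> 0"
  shows "z \<longlonglongrightarrow> 0"
proof -
  have "(\<lambda>k. ennreal (norm (z k)) ^ 2) \<longlonglongrightarrow> 0"
    by (rule tendsto_sandwich[OF _ _ tendsto_const B]) (auto intro!: always_eventually le)
  then have "(\<lambda>k. ennreal ((norm (z k))\<^sup>2)) \<longlonglongrightarrow> 0"
    by (simp add: ennreal_power)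
  then have "(\<lambda>k. (norm (z k))\<^sup>2) \<longlonglongrightarrow> 0"
    by (subst (asm) ennreal_tendsto_0_iff) auto
  from tendsto_real_sqrt[OF this] show ?thesis
    by (simp add: tendsto_norm_zero_iff)
qed

text \<open>The multiplication formula holds for the truncations of \<open>v\<close>; pass to the limit.\<close>

lemma L2_fourier_pairing:
  fixes v :: "'a::euclidean_space \<Rightarrow> complex"
  assumes v: "is_L2_fourier v g" and w: "integrable lebesgue w" "w \<in> L2"
  shows "integrable lebesgue (\<lambda>x. v x * inv_fourier w x)"
    and "(LINT x|lebesgue. v x * inv_fourier w x) = (LINT \<xi>|lebesgue. g \<xi> * w (- \<xi>))"
proof -
  have vL: "v \<in> L2" "g \<in> L2" using v by (auto simp: is_L2_fourier_def)
  \<comment> \<open>Reflection turns \<open>inv_fourier w\<close> into \<open>fourier w'\<close>,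
    the form that the multiplication formula accepts.\<close>
  define w' where "w' x = w (- x)" for x
  have w': "integrable lebesgue w'" "w' \<in> L2"
    using integrable_affine[of "-1" w 0] w L2_reflect[OF w(2)] by (simp_all add: w'_def[abs_def])
  have inv: "inv_fourier w x = fourier w' x" for x
    by (simp add: inv_fourier_eq w'_def[abs_def] fourier_reflect)
  note fw = fourier_L2[OF w']
  show i: "integrable lebesgue (\<lambda>x. v x * inv_fourier w x)"
    unfolding inv by (rule integrable_L2_mult[OF vL(1) fw])
  define vk where "vk k x = indicator (cball 0 (real k)) x * v x" for k :: nat and x :: 'a
  have vk: "integrable lebesgue (vk k)" for k unfolding vk_def by (rule integrable_truncation[OF vL(1)])
  note [measurable] = L2_D(1)[OF vL(1)] L2_D(1)[OF vL(2)] L2_D(1)[OF fw] L2_D(1)[OF w'(2)] measurable_fourier_lebesgue[OF vk]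
  have lim1: "(\<lambda>k. LINT x|lebesgue. vk k x * fourier w' x) \<longlonglongrightarrow> (LINT x|lebesgue. v x * fourier w' x)"
  proof (rule integral_dominated_convergence[where w="\<lambda>x. norm (v x * fourier w' x)"])
    show "AE x in lebesgue. (\<lambda>k. vk k x * fourier w' x) \<longlonglongrightarrow> v x * fourier w' x"
    proof (intro AE_I2 tendsto_eventually)
      fix x :: 'a
      have "\<forall>\<^sub>F k in sequentially. real k \<ge> norm x"
        using filterlim_real_sequentially unfolding filterlim_at_top by blast
      then show "\<forall>\<^sub>F k in sequentially. vk k x * fourier w' x = v x * fourier w' x"
        by eventually_elim (simp add: vk_def)
    qed
    show "AE x in lebesgue. norm (vk k x * fourier w' x) \<le> norm (v x * fourier w' x)" for k
      by (auto simp: vk_def norm_mult indicator_def)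
    show "(\<lambda>x. vk k x * fourier w' x) \<in> borel_measurable lebesgue" for k
      using vk[of k] by measurable
  qed (use i in \<open>simp_all add: inv\<close>)
  have eq: "(LINT x|lebesgue. vk k x * fourier w' x) = (LINT \<xi>|lebesgue. fourier (vk k) \<xi> * w' \<xi>)" for k
    by (rule fourier_mult_swap[OF vk w'(1)])
  \<comment> \<open>By Cauchy-Schwarz against \<open>w'\<close> the error is at most the
    \<open>L2\<close> distance between g and the transform of the truncation, which tends to 0 by
    the definition of \<open>is_L2_fourier\<close>.\<close>
  have lim2: "(\<lambda>k. LINT \<xi>|lebesgue. fourier (vk k) \<xi> * w' \<xi>) \<longlonglongrightarrow> (LINT \<xi>|lebesgue. g \<xi> * w' \<xi>)"
  proof (rule LIM_zero_cancel)
    let ?D = "\<lambda>k. \<integral>\<^sup>+\<xi>. ennreal ((norm (g \<xi> - fourier (vk k) \<xi>))\<^sup>2) \<partial>lebesgue"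
    have fv: "integrable lebesgue (\<lambda>\<xi>. fourier (vk k) \<xi> * w' \<xi>)" for k
    proof (rule Bochner_Integration.integrable_bound)
      show "integrable lebesgue (\<lambda>x. ((2 * pi) powr (- real DIM('a) / 2) * (LINT x|lebesgue. norm (vk k x))) * norm (w' x))"
        using w' by (intro integrable_mult_right integrable_norm)
      show "AE x in lebesgue. norm (fourier (vk k) x * w' x) \<le> norm (((2 * pi) powr (- real DIM('a) / 2) * (LINT x|lebesgue. norm (vk k x))) * norm (w' x))"
        using norm_fourier_le[OF vk[of k]] by (intro AE_I2) (auto simp: norm_mult intro!: mult_right_mono)
    qed measurable
    have le: "ennreal (norm ((LINT \<xi>|lebesgue. fourier (vk k) \<xi> * w' \<xi>) - (LINT \<xi>|lebesgue. g \<xi> * w' \<xi>))) ^ 2 \<le> ?D k * ennreal ((L2_norm w')\<^sup>2)" for k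
    proof -
      have "(LINT \<xi>|lebesgue. fourier (vk k) \<xi> * w' \<xi>) - (LINT \<xi>|lebesgue. g \<xi> * w' \<xi>) = - (LINT \<xi>|lebesgue. (g \<xi> - fourier (vk k) \<xi>) * w' \<xi>)"
        using fv[of k] integrable_L2_mult[OF vL(2) w'(2)] by (simp add: left_diff_distrib)
      then have "ennreal (norm ((LINT \<xi>|lebesgue. fourier (vk k) \<xi> * w' \<xi>) - (LINT \<xi>|lebesgue. g \<xi> * w' \<xi>))) \<le> (\<integral>\<^sup>+\<xi>. ennreal (norm ((g \<xi> - fourier (vk k) \<xi>) * w' \<xi>)) \<partial>lebesgue)"
        using norm_integral_le_nn_integral by simp
      then have "ennreal (norm ((LINT \<xi>|lebesgue. fourier (vk k) \<xi> * w' \<xi>) - (LINT \<xi>|lebesgue. g \<xi> * w' \<xi>))) ^ 2 \<le> (\<integral>\<^sup>+\<xi>. ennreal (norm ((g \<xi> - fourier (vk k) \<xi>) * w' \<xi>)) \<partial>lebesgue) ^ 2"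
        by (intro power_mono) auto
      also have "\<dots> \<le> ?D k * (\<integral>\<^sup>+\<xi>. ennreal ((norm (w' \<xi>))\<^sup>2) \<partial>lebesgue)"
        by (rule nn_integral_L2_mult_le) measurable
      finally show ?thesis unfolding nn_integral_L2[OF w'(2)] .
    qed
    have "(\<lambda>k. ennreal ((L2_norm w')\<^sup>2) * ?D k) \<longlonglongrightarrow> ennreal ((L2_norm w')\<^sup>2) * 0"
      using is_L2_fourier_sequence[OF v] unfolding vk_def[abs_def] by (intro ennreal_tendsto_cmult) auto
    then have "(\<lambda>k. ?D k * ennreal ((L2_norm w')\<^sup>2)) \<longlonglongrightarrow> 0"
      by (simp add: mult.commute)
    with le show "(\<lambda>k. (LINT \<xi>|lebesgue. fourier (vk k) \<xi> * w' \<xi>) - (LINT \<xi>|lebesgue. g \<xi> * w' \<xi>)) \<longlonglongrightarrow> 0"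
      by (rule tendsto_0_if_power2_le)
  qed
  show "(LINT x|lebesgue. v x * inv_fourier w x) = (LINT \<xi>|lebesgue. g \<xi> * w (- \<xi>))"
    unfolding inv w'_def[symmetric] by (rule LIMSEQ_unique[OF lim1[unfolded eq] lim2])
qed

section \<open>The fractional Laplacian in weak form\<close>

lemma
  assumes m: "f \<in> borel_measurable lebesgue" and g: "g \<in> L2" and le: "\<And>x. norm (f x) \<le> norm (g x)"
  shows L2_mono: "f \<in> L2" and L2_norm_mono: "L2_norm f \<le> L2_norm g"
proof -
  have sq: "(norm (f x))\<^sup>2 \<le> (norm (g x))\<^sup>2" for x using le by (intro power_mono) auto
  then have "(\<integral>\<^sup>+x. ennreal ((norm (f x))\<^sup>2) \<partial>lebesgue) \<le> (\<integral>\<^sup>+x. ennreal ((norm (g x))\<^sup>2) \<partial>lebesgue)"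
    by (intro nn_integral_mono ennreal_leI)
  then show "f \<in> L2" "L2_norm f \<le> L2_norm g"
    using L2_I_nn_integral[OF m, of "L2_norm g"] nn_integral_L2[OF g] by (auto simp: L2_norm_nonneg)
qed

lemma L2_bounded_integrable:
  assumes "integrable lebesgue f" "\<And>x. norm (f x) \<le> B"
  shows "f \<in> L2"
proof -
  have "integrable lebesgue (\<lambda>x. (norm (f x))\<^sup>2)"
  proof (rule Bochner_Integration.integrable_bound)
    show "integrable lebesgue (\<lambda>x. B * norm (f x))" using assms by (intro integrable_mult_right integrable_norm)
    show "AE x in lebesgue. norm ((norm (f x))\<^sup>2) \<le> norm (B * norm (f x))"
    proof (intro AE_I2)
      fix x
      have "norm (f x) * norm (f x) \<le> B * norm (f x)" by (intro mult_right_mono assms) simp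
      then show "norm ((norm (f x))\<^sup>2) \<le> norm (B * norm (f x))" by (simp add: power2_eq_square)
    qed
  qed (use assms in measurable)
  then show ?thesis using assms(1) by (auto simp: L2_def)
qed

text \<open>A common home for the smooth functions of compact support and for
  \<open>japanese q\<close>, closed under differences and dilations. Only the transform decays
  rapidly, in the sense that every (-\<Delta>)^g f is the inverse transform of an integrable symbol;
  \<open>japanese q\<close> itself is no Schwartz function.\<close>

definition fourier_rapid :: "('a::euclidean_space \<Rightarrow> complex) \<Rightarrow> bool" where
  "fourier_rapid f \<longleftrightarrow> continuous_on UNIV f \<and> integrable lebesgue f \<and> (\<exists>B. \<forall>x. norm (f x) \<le> B) \<and>
     (\<forall>g\<ge>0. integrable lebesgue (frac_symbol g f))"

lemma fourier_rapidD:
  assumes "fourier_rapid f"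
  shows "continuous_on UNIV f" "integrable lebesgue f" "f \<in> L2" "fourier f \<in> L2"
    "L2_norm (fourier f) \<le> L2_norm f" "g \<ge> 0 \<Longrightarrow> integrable lebesgue (frac_symbol g f)"
proof -
  obtain B where B: "\<And>x. norm (f x) \<le> B" using assms by (auto simp: fourier_rapid_def)
  show f: "continuous_on UNIV f" "integrable lebesgue f" "g \<ge> 0 \<Longrightarrow> integrable lebesgue (frac_symbol g f)"
    using assms by (auto simp: fourier_rapid_def)
  show L: "f \<in> L2" by (rule L2_bounded_integrable[OF f(2) B])
  show "fourier f \<in> L2" "L2_norm (fourier f) \<le> L2_norm f"
    using fourier_L2[OF f(2) L] L2_norm_fourier_le[OF f(2) L] by auto
qed

text \<open>The squared symbol of order g is the bounded factor |fourier f| times the absolute value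
  of the symbol of order 2g, which is integrable.\<close>

lemma frac_symbol_L2:
  fixes f :: "'a::euclidean_space \<Rightarrow> complex"
  assumes f: "fourier_rapid f" and g: "g \<ge> 0"
  shows "frac_symbol g f \<in> L2"
proof -
  note i = fourier_rapidD(2)[OF f]
  define B where "B = (2 * pi) powr (- real DIM('a) / 2) * (LINT x|lebesgue. norm (f x))"
  have B: "norm (fourier f \<xi>) \<le> B" for \<xi> unfolding B_def by (rule norm_fourier_le[OF i])
  have m: "frac_symbol h f \<in> borel_measurable lebesgue" if "h \<ge> 0" for h
    using fourier_rapidD(6)[OF f that] by auto
  have "integrable lebesgue (\<lambda>\<xi>. (norm (frac_symbol g f \<xi>))\<^sup>2)"
  proof (rule Bochner_Integration.integrable_bound)
    show "integrable lebesgue (\<lambda>\<xi>. B * norm (frac_symbol (2 * g) f \<xi>))"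
      using fourier_rapidD(6)[OF f, of "2 * g"] g by (intro integrable_mult_right integrable_norm) auto
    show "(\<lambda>\<xi>. (norm (frac_symbol g f \<xi>))\<^sup>2) \<in> borel_measurable lebesgue" using m[OF g] by measurable
    show "AE \<xi> in lebesgue. norm ((norm (frac_symbol g f \<xi>))\<^sup>2) \<le> norm (B * norm (frac_symbol (2 * g) f \<xi>))"
    proof (intro AE_I2)
      fix \<xi> :: 'a
      have e: "norm \<xi> powr (2 * g) * norm \<xi> powr (2 * g) = norm \<xi> powr (2 * (2 * g))"
        by (simp flip: powr_add)
      have "(norm (frac_symbol g f \<xi>))\<^sup>2 = norm (fourier f \<xi>) * (norm \<xi> powr (2 * (2 * g)) * norm (fourier f \<xi>))"
        unfolding e[symmetric] frac_symbol_def by (simp add: norm_mult power2_eq_square mult_ac)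
      also have "\<dots> \<le> B * (norm \<xi> powr (2 * (2 * g)) * norm (fourier f \<xi>))"
        by (intro mult_right_mono B) simp
      also have "\<dots> = B * norm (frac_symbol (2 * g) f \<xi>)" by (simp add: frac_symbol_def norm_mult)
      finally show "norm ((norm (frac_symbol g f \<xi>))\<^sup>2) \<le> norm (B * norm (frac_symbol (2 * g) f \<xi>))"
        by simp
    qed
  qed
  then show ?thesis using m[OF g] by (simp add: L2_def)
qed

lemma frac_symbol_0: "\<xi> \<noteq> 0 \<Longrightarrow> frac_symbol 0 f \<xi> = fourier f \<xi>"
  by (simp add: frac_symbol_def)

lemma AE_lebesgue_neq: "AE x in lebesgue. x \<noteq> (c::'a::euclidean_space)"
  by (rule AE_I'[of "{c}"]) (auto simp: negligible_iff_null_sets[symmetric])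

text \<open>Because 0 powr 0 = 0, the symbol of order 0 equals \<open>fourier f\<close> only off the
  origin. The null set is discarded before Fourier inversion is applied.\<close>

lemma inv_fourier_frac_symbol_0:
  assumes f: "fourier_rapid f"
  shows "inv_fourier (frac_symbol 0 f) x = f x"
proof -
  obtain B where B: "\<And>x. norm (f x) \<le> B" using f by (auto simp: fourier_rapid_def)
  note i = fourier_rapidD(2)[OF f]
  have ae: "AE \<xi> in lebesgue. frac_symbol 0 f \<xi> = fourier f \<xi>"
    using AE_lebesgue_neq[of 0] by eventually_elim (simp add: frac_symbol_0)
  have m: "frac_symbol 0 f \<in> borel_measurable lebesgue" "fourier f \<in> borel_measurable lebesgue"
    using fourier_rapidD(6)[OF f, of 0] measurable_fourier_lebesgue[OF i] by auto
  have fi: "integrable lebesgue (fourier f)"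
    using fourier_rapidD(6)[OF f, of 0] by (rule integrable_cong_AE_imp) (use m ae in auto)
  have "inv_fourier (frac_symbol 0 f) x = inv_fourier (fourier f) x"
    unfolding inv_fourier_eq using fourier_cong_AE[OF ae m] by simp
  also have "\<dots> = f x" by (rule fourier_inversion[OF i fourier_rapidD(1)[OF f] B fi])
  finally show ?thesis .
qed

lemma fourier_diff:
  assumes "integrable lebesgue f" "integrable lebesgue g"
  shows "fourier (\<lambda>x. f x - g x) \<xi> = fourier f \<xi> - fourier g \<xi>"
proof -
  have i: "integrable lebesgue (\<lambda>x. cis (- (x \<bullet> \<xi>)) * h x)" if "integrable lebesgue h" for h
    by (intro integrable_cis_mult that measurable_compose[OF ident_lebesgue_borel]) simp
  show ?thesis unfolding fourier_def
    using i[OF assms(1)] i[OF assms(2)] by (simp add: right_diff_distrib Bochner_Integration.integral_diff)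
qed

lemma frac_symbol_diff:
  assumes "integrable lebesgue f" "integrable lebesgue f'"
  shows "frac_symbol g (\<lambda>x. f x - f' x) \<xi> = frac_symbol g f \<xi> - frac_symbol g f' \<xi>"
  by (simp add: frac_symbol_def fourier_diff[OF assms] right_diff_distrib)

lemma fourier_rapid_diff:
  assumes f: "fourier_rapid f" and f': "fourier_rapid f'"
  shows "fourier_rapid (\<lambda>x. f x - f' x)"
proof -
  obtain B where B: "\<And>x. norm (f x) \<le> B" using f by (auto simp: fourier_rapid_def)
  obtain B' where B': "\<And>x. norm (f' x) \<le> B'" using f' by (auto simp: fourier_rapid_def)
  note i = fourier_rapidD(2)[OF f] fourier_rapidD(2)[OF f']
  have "norm (f x - f' x) \<le> B + B'" for x
    using norm_triangle_ineq4[of "f x" "f' x"] B[of x] B'[of x] by linarith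
  moreover have "integrable lebesgue (frac_symbol g (\<lambda>x. f x - f' x))" if "g \<ge> 0" for g
    unfolding frac_symbol_diff[OF i, abs_def]
    using fourier_rapidD(6)[OF f that] fourier_rapidD(6)[OF f' that] by (rule Bochner_Integration.integrable_diff)
  ultimately show ?thesis unfolding fourier_rapid_def
    using i fourier_rapidD(1)[OF f] fourier_rapidD(1)[OF f']
    by (auto intro!: continuous_on_diff)
qed

lemma frac_symbol_scale:
  fixes f :: "'a::euclidean_space \<Rightarrow> complex"
  assumes c: "c > 0"
  shows "frac_symbol g (\<lambda>x. f (c *\<^sub>R x)) \<xi> = of_real (c powr (2 * g) / c ^ DIM('a)) * frac_symbol g f ((1 / c) *\<^sub>R \<xi>)"
proof -
  have "norm \<xi> powr (2 * g) = c powr (2 * g) * norm ((1 / c) *\<^sub>R \<xi>) powr (2 * g)"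
    using c by (simp flip: powr_mult)
  then show ?thesis unfolding frac_symbol_def fourier_scale[OF c] by simp
qed

lemma inv_fourier_frac_symbol_scale:
  fixes f :: "'a::euclidean_space \<Rightarrow> complex"
  assumes c: "c > 0"
  shows "inv_fourier (frac_symbol g (\<lambda>x. f (c *\<^sub>R x))) x = of_real (c powr (2 * g)) * inv_fourier (frac_symbol g f) (c *\<^sub>R x)"
proof -
  have "inv_fourier (frac_symbol g (\<lambda>x. f (c *\<^sub>R x))) x =
      of_real (c powr (2 * g) / c ^ DIM('a)) * fourier (\<lambda>\<xi>. frac_symbol g f ((1 / c) *\<^sub>R \<xi>)) (- x)"
    unfolding inv_fourier_eq frac_symbol_scale[OF c, abs_def] fourier_def
    by (simp only: mult.left_commute[of _ "of_real (c powr (2 * g) / c ^ DIM('a))"] integral_mult_right_zero)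
  also have "\<dots> = of_real (c powr (2 * g)) * fourier (frac_symbol g f) (c *\<^sub>R (- x))"
    using c fourier_scale[of "1 / c" "frac_symbol g f" "- x"] by (simp add: power_one_over)
  finally show ?thesis by (simp add: inv_fourier_eq)
qed

lemma fourier_rapid_scale:
  fixes f :: "'a::euclidean_space \<Rightarrow> complex"
  assumes f: "fourier_rapid f" and c: "c > 0"
  shows "fourier_rapid (\<lambda>x. f (c *\<^sub>R x))"
proof -
  have "continuous_on UNIV (\<lambda>x. f (c *\<^sub>R x))"
    by (intro continuous_on_compose2[OF fourier_rapidD(1)[OF f]] continuous_intros) auto
  moreover have "integrable lebesgue (\<lambda>x. f (c *\<^sub>R x))"
    using integrable_affine[of c f 0] fourier_rapidD(2)[OF f] c by simp
  moreover have "integrable lebesgue (frac_symbol g (\<lambda>x. f (c *\<^sub>R x)))" if "g \<ge> 0" for g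
    unfolding frac_symbol_scale[OF c, abs_def]
    using integrable_affine[of "1 / c" "frac_symbol g f" 0] fourier_rapidD(6)[OF f that] c
    by (intro integrable_mult_right) simp
  ultimately show ?thesis using f unfolding fourier_rapid_def by auto
qed

lemma fourier_rapid_japanese:
  assumes q: "q > real DIM('a::euclidean_space)"
  shows "fourier_rapid (\<lambda>x::'a. complex_of_real (japanese q x))"
proof -
  have c: "continuous_on UNIV (\<lambda>x::'a. japanese q x)"
    unfolding japanese_def by (intro continuous_intros) (auto simp: add_nonneg_eq_0_iff)
  have q0: "q \<ge> 0" using q by (auto intro: order_trans[of 0 "real DIM('a)"])
  have "norm (complex_of_real (japanese q x)) \<le> 1" for x :: 'a
    using japanese_pos[of q x] japanese_le_1[OF q0, of x] by simp
  then show ?thesis unfolding fourier_rapid_def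
    using c integrable_japanese[OF q] integrable_frac_symbol_japanese[OF q]
    by (auto intro!: continuous_on_of_real)
qed

text \<open>Rapid decay of the transform bounds each symbol by a multiple of
  \<open>japanese (n + 1)\<close>, which is integrable.\<close>

lemma fourier_rapid_compact_support:
  fixes f :: "'a::euclidean_space \<Rightarrow> real"
  assumes f: "smooth f" "\<And>x. norm x > R \<Longrightarrow> f x = 0"
  shows "fourier_rapid (\<lambda>x. complex_of_real (f x))"
proof -
  let ?f = "\<lambda>x. complex_of_real (f x)"
  let ?q = "real DIM('a) + 1"
  have W: "W_k k ?f" for k
    using f by (intro W_k_smooth_compact_support) (auto simp: smooth_def)
  note ci = W_kD[OF W[of 0]]
  have "bounded (?f ` cball 0 R)"
    using ci(1) by (intro compact_imp_bounded compact_continuous_image) (auto intro: continuous_on_subset)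
  then obtain B where B: "\<And>y. y \<in> ?f ` cball 0 R \<Longrightarrow> norm y \<le> B" unfolding bounded_iff by blast
  have b: "norm (?f x) \<le> \<bar>B\<bar>" for x
    using B[OF imageI, of x] f(2)[of x] by (cases "norm x > R") auto
  have "integrable lebesgue (frac_symbol g ?f)" if g: "g \<ge> 0" for g
  proof -
    obtain C where C: "C \<ge> 0" "\<And>\<xi>. norm \<xi> powr (2 * g) * norm (fourier ?f \<xi>) \<le> C"
      using fourier_decay_powr[OF W, of "2 * g"] g by auto
    obtain D where D: "D \<ge> 0" "\<And>\<xi>. norm \<xi> powr (?q + 2 * g) * norm (fourier ?f \<xi>) \<le> D"
      using fourier_decay_powr[OF W, of "?q + 2 * g"] g by auto
    have le: "norm (frac_symbol g ?f \<xi>) \<le> 2 powr (?q / 2) * (C + D) * japanese ?q \<xi>" for \<xi>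
      using C D by (intro japanese_bound) (auto simp: frac_symbol_def norm_mult powr_add mult_ac)
    show ?thesis
    proof (rule Bochner_Integration.integrable_bound)
      show "integrable lebesgue (\<lambda>\<xi>::'a. 2 powr (?q / 2) * (C + D) * japanese ?q \<xi>)"
        using integrable_japanese[of ?q, where 'a='a] by (intro integrable_mult_right) (simp add: integrable_of_real_iff)
      have "fourier ?f \<in> borel_measurable borel" by (rule measurable_fourier[OF ci(2)])
      then show "frac_symbol g ?f \<in> borel_measurable lebesgue"
        unfolding frac_symbol_def[abs_def] by (intro borel_measurable_lebesgueI) measurable
      show "AE \<xi> in lebesgue. norm (frac_symbol g ?f \<xi>) \<le> norm (2 powr (?q / 2) * (C + D) * japanese ?q \<xi>)"
        using le by (intro AE_I2) (auto intro: order_trans[OF _ abs_ge_self])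
    qed
  qed
  then show ?thesis unfolding fourier_rapid_def using ci b by blast
qed

text \<open>On the Fourier side |\<xi>|^(2g) moves from f to v, where the Bessel weight dominates it
  because 2g \<le> s. The bound then contains f only through its \<open>L2\<close> norm, which is
  why approximation in \<open>L2\<close> is sufficient later.\<close>

lemma
  fixes v :: "'a::euclidean_space \<Rightarrow> complex"
  assumes v: "is_L2_fourier v G" "bessel_weight s G \<in> L2" and g: "0 \<le> g" "2 * g \<le> s"
    and f: "fourier_rapid f"
  shows integrable_frac_pairing: "integrable lebesgue (\<lambda>x. v x * inv_fourier (frac_symbol g f) x)"
    and frac_pairing_le: "norm (LINT x|lebesgue. v x * inv_fourier (frac_symbol g f) x) \<le> L2_norm (bessel_weight s G) * L2_norm f"
proof -
  note w = fourier_rapidD(6)[OF f g(1)] frac_symbol_L2[OF f g(1)]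
  have G: "G \<in> L2" using v by (simp add: is_L2_fourier_def)
  show "integrable lebesgue (\<lambda>x. v x * inv_fourier (frac_symbol g f) x)"
    by (rule L2_fourier_pairing(1)[OF v(1) w])
  define H where "H \<xi> = of_real (norm \<xi> powr (2 * g)) * G \<xi>" for \<xi>
  have "H \<in> borel_measurable lebesgue"
    unfolding H_def using L2_D(1)[OF G] by (intro borel_measurable_times[OF borel_measurable_lebesgueI]) auto
  moreover have "norm (H \<xi>) \<le> norm (bessel_weight s G \<xi>)" for \<xi>
  proof -
    have "norm \<xi> powr (2 * g) \<le> (1 + (norm \<xi>)\<^sup>2) powr (s / 2)"
    proof (cases "\<xi> = 0")
      case False
      then have "norm \<xi> powr (2 * g) = (norm \<xi>)\<^sup>2 powr g" using powr_powr[of "norm \<xi>" 2 g] by simp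
      also have "\<dots> \<le> (1 + (norm \<xi>)\<^sup>2) powr g" using g by (intro powr_mono2) auto
      also have "\<dots> \<le> (1 + (norm \<xi>)\<^sup>2) powr (s / 2)" using g by (intro powr_mono) auto
      finally show ?thesis .
    qed simp
    then have "norm \<xi> powr (2 * g) * norm (G \<xi>) \<le> (1 + (norm \<xi>)\<^sup>2) powr (s / 2) * norm (G \<xi>)"
      by (rule mult_right_mono) simp
    then show ?thesis by (simp add: H_def bessel_weight_def norm_mult)
  qed
  ultimately have H: "H \<in> L2" "L2_norm H \<le> L2_norm (bessel_weight s G)"
    using L2_mono[OF _ v(2)] L2_norm_mono[OF _ v(2)] by auto
  note ff = fourier_rapidD(4)[OF f]
  have "(LINT x|lebesgue. v x * inv_fourier (frac_symbol g f) x) = (LINT \<xi>|lebesgue. H \<xi> * fourier f (- \<xi>))"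
    unfolding L2_fourier_pairing(2)[OF v(1) w] by (simp add: frac_symbol_def H_def mult_ac)
  also have "norm \<dots> \<le> L2_norm H * L2_norm (\<lambda>\<xi>. fourier f (- \<xi>))"
    by (rule norm_integral_L2_mult_le[OF H(1) L2_reflect[OF ff]])
  also have "\<dots> \<le> L2_norm (bessel_weight s G) * L2_norm f"
    unfolding L2_norm_reflect[OF ff] using H fourier_rapidD(5)[OF f]
    by (intro mult_mono) (auto simp: L2_norm_nonneg)
  finally show "norm (LINT x|lebesgue. v x * inv_fourier (frac_symbol g f) x) \<le> L2_norm (bessel_weight s G) * L2_norm f" .
qed

text \<open>The same choice of representative as in \<open>sobolev_norm\<close>, so that the norm
  unfolds to it.\<close>

definition space_fourier :: "('a::euclidean_space \<Rightarrow> real) \<Rightarrow> 'a \<Rightarrow> complex" where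
  "space_fourier v = (SOME g. is_L2_fourier (\<lambda>x. of_real (v x)) g)"

definition frac_pairing :: "real \<Rightarrow> ('a::euclidean_space \<Rightarrow> complex) \<Rightarrow> ('a \<Rightarrow> real) \<Rightarrow> complex" where
  "frac_pairing g f v = (LINT x|lebesgue. of_real (v x) * inv_fourier (frac_symbol g f) x)"

text \<open>The weighted integrability in \<open>sobolev_space\<close> is known for some transform;
  it passes to the chosen one because transforms agree almost everywhere.\<close>

lemma space_fourier:
  assumes "(\<lambda>x. of_real (v x)) \<in> sobolev_space s"
  shows "is_L2_fourier (\<lambda>x. of_real (v x)) (space_fourier v)" "bessel_weight s (space_fourier v) \<in> L2"
proof -
  obtain g where g: "is_L2_fourier (\<lambda>x. of_real (v x)) g" "bessel_weight s g \<in> L2"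
    using assms by (auto simp: sobolev_space_def)
  show *: "is_L2_fourier (\<lambda>x. of_real (v x)) (space_fourier v)"
    unfolding space_fourier_def by (rule someI[where P="is_L2_fourier (\<lambda>x. of_real (v x))", OF g(1)])
  have ae: "AE x in lebesgue. bessel_weight s g x = bessel_weight s (space_fourier v) x"
    using is_L2_fourier_unique[OF g(1) *] by eventually_elim (simp add: bessel_weight_def)
  have m: "bessel_weight s (space_fourier v) \<in> borel_measurable lebesgue"
    using * unfolding bessel_weight_def[abs_def]
    by (intro borel_measurable_times[OF borel_measurable_lebesgueI]) (auto simp: is_L2_fourier_def L2_def)
  show "bessel_weight s (space_fourier v) \<in> L2" by (rule L2_cong_AE[OF ae g(2) m])
qed

lemma bessel_weight_diff: "bessel_weight s (\<lambda>x. f x - g x) x = bessel_weight s f x - bessel_weight s g x"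
  by (simp add: bessel_weight_def right_diff_distrib)

text \<open>\<open>sobolev_norm\<close> of a difference refers to its own chosen transform; by
  uniqueness this equals the difference of the chosen transforms almost everywhere, which makes
  norms at different times comparable.\<close>

lemma sobolev_diff:
  assumes v: "(\<lambda>x. of_real (v x)) \<in> sobolev_space s" and w: "(\<lambda>x. of_real (w x)) \<in> sobolev_space s"
  defines "G \<equiv> \<lambda>\<xi>. space_fourier v \<xi> - space_fourier w \<xi>"
  shows "is_L2_fourier (\<lambda>x. of_real (v x - w x)) G" "bessel_weight s G \<in> L2"
    "sobolev_norm s (\<lambda>x. of_real (v x - w x)) = L2_norm (bessel_weight s G)"
proof -
  show 1: "is_L2_fourier (\<lambda>x. of_real (v x - w x)) G"
    using is_L2_fourier_diff[OF space_fourier(1)[OF v] space_fourier(1)[OF w]] by (simp add: G_def)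
  show 2: "bessel_weight s G \<in> L2"
    using L2_diff[OF space_fourier(2)[OF v] space_fourier(2)[OF w]] unfolding G_def bessel_weight_diff[abs_def] .
  have S: "(\<lambda>x. of_real (v x - w x)) \<in> sobolev_space s" using 1 2 by (auto simp: sobolev_space_def)
  note 3 = space_fourier[OF S]
  have "AE x in lebesgue. bessel_weight s (space_fourier (\<lambda>x. v x - w x)) x = bessel_weight s G x"
    using is_L2_fourier_unique[OF 3(1) 1] by eventually_elim (simp add: bessel_weight_def)
  then show "sobolev_norm s (\<lambda>x. of_real (v x - w x)) = L2_norm (bessel_weight s G)"
    unfolding sobolev_norm_def space_fourier_def[symmetric]
    by (rule L2_norm_cong_AE) (use 2 3 in \<open>auto simp: L2_def\<close>)
qed

section \<open>Pairings along a continuous curve in a Sobolev space\<close>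

context
  fixes s :: real and u :: "real \<Rightarrow> 'a::euclidean_space \<Rightarrow> real"
  assumes cs: "continuous_sobolev s u"
begin

lemma sobolev_at: "t \<ge> 0 \<Longrightarrow> (\<lambda>x. of_real (u t x)) \<in> sobolev_space s"
  using cs by (simp add: continuous_sobolev_def)

lemma frac_pairing_slice:
  assumes "t \<ge> 0" "0 \<le> g" "2 * g \<le> s" "fourier_rapid f"
  shows "integrable lebesgue (\<lambda>x. of_real (u t x) * inv_fourier (frac_symbol g f) x)"
    and "norm (frac_pairing g f (u t)) \<le> L2_norm (bessel_weight s (space_fourier (u t))) * L2_norm f"
proof -
  note v = space_fourier[OF sobolev_at[OF assms(1)]]
  show "integrable lebesgue (\<lambda>x. of_real (u t x) * inv_fourier (frac_symbol g f) x)"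
    by (rule integrable_frac_pairing[OF v assms(2-4)])
  show "norm (frac_pairing g f (u t)) \<le> L2_norm (bessel_weight s (space_fourier (u t))) * L2_norm f"
    unfolding frac_pairing_def by (rule frac_pairing_le[OF v assms(2-4)])
qed

text \<open>The pairing is linear in u(t) and bounded by the Sobolev norm. The continuity provides
  measurability in t of the linear terms of the equation.\<close>

lemma frac_pairing_continuous:
  assumes g: "0 \<le> g" "2 * g \<le> s" and f: "fourier_rapid f"
  shows "continuous_on {0..} (\<lambda>t. frac_pairing g f (u t))"
  unfolding continuous_on_def
proof safe
  fix t :: real assume "t \<ge> 0"
  have le: "norm (frac_pairing g f (u r) - frac_pairing g f (u t)) \<le> sobolev_norm s (\<lambda>x. of_real (u r x - u t x)) * L2_norm f" if r: "r \<ge> 0" for r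
  proof -
    note D = sobolev_diff[OF sobolev_at[OF r] sobolev_at[OF \<open>t \<ge> 0\<close>]]
    have "frac_pairing g f (u r) - frac_pairing g f (u t) = (LINT x|lebesgue. of_real (u r x - u t x) * inv_fourier (frac_symbol g f) x)"
      unfolding frac_pairing_def
      using frac_pairing_slice(1)[OF r g f] frac_pairing_slice(1)[OF \<open>t \<ge> 0\<close> g f]
      by (simp add: left_diff_distrib)
    then show ?thesis using frac_pairing_le[OF D(1,2) g f] unfolding D(3) by simp
  qed
  have "((\<lambda>r. sobolev_norm s (\<lambda>x. of_real (u r x - u t x)) * L2_norm f) \<longlongrightarrow> 0 * L2_norm f) (at t within {0..})"
    using cs \<open>t \<ge> 0\<close> unfolding continuous_sobolev_def by (intro tendsto_mult tendsto_const) auto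
  then have lim: "((\<lambda>r. sobolev_norm s (\<lambda>x. of_real (u r x - u t x)) * L2_norm f) \<longlongrightarrow> 0) (at t within {0..})"
    by simp
  have "((\<lambda>r. frac_pairing g f (u r) - frac_pairing g f (u t)) \<longlongrightarrow> 0) (at t within {0..})"
  proof (rule Lim_null_comparison[OF _ lim])
    show "\<forall>\<^sub>F r in at t within {0..}. norm (frac_pairing g f (u r) - frac_pairing g f (u t)) \<le> sobolev_norm s (\<lambda>x. of_real (u r x - u t x)) * L2_norm f"
      unfolding eventually_at_filter by (intro always_eventually allI impI le) auto
  qed
  then show "((\<lambda>r. frac_pairing g f (u r)) \<longlongrightarrow> frac_pairing g f (u t)) (at t within {0..})"
    by (rule LIM_zero_cancel)
qed

text \<open>Continuity gives a local bound around each time, with a squared form of the triangle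
  inequality, and compactness of the interval makes finitely many of them enough. The bound supplies
  the majorant for the time integrals.\<close>

lemma sobolev_bounded:
  obtains N where "N \<ge> 0" "\<And>t. t \<in> {0..T} \<Longrightarrow> L2_norm (bessel_weight s (space_fourier (u t))) \<le> N"
proof -
  let ?N = "\<lambda>t. L2_norm (bessel_weight s (space_fourier (u t)))"
  have "\<exists>e>0. \<forall>r\<ge>0. dist t r < e \<longrightarrow> (?N r)\<^sup>2 \<le> 2 + 2 * (?N t)\<^sup>2" if t: "t \<ge> 0" for t
  proof -
    let ?d = "\<lambda>r. sobolev_norm s (\<lambda>x. of_real (u r x - u t x))"
    have "(?d \<longlongrightarrow> 0) (at t within {0..})" using cs t by (simp add: continuous_sobolev_def)
    from tendstoD[OF this zero_less_one] obtain e where e: "e > 0" "\<And>r. r \<ge> 0 \<Longrightarrow> r \<noteq> t \<Longrightarrow> dist r t < e \<Longrightarrow> \<bar>?d r\<bar> < 1"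
      by (auto simp: eventually_at)
    have "(?N r)\<^sup>2 \<le> 2 + 2 * (?N t)\<^sup>2" if r: "r \<ge> 0" "dist t r < e" for r
    proof (cases "r = t")
      case False
      note D = sobolev_diff[OF sobolev_at[OF r(1)] sobolev_at[OF t]]
      have "(?d r)\<^sup>2 \<le> 1" using e(2)[OF r(1) False] r(2) by (simp add: dist_commute abs_square_le_1)
      moreover have "(?N r)\<^sup>2 \<le> 2 * (?d r)\<^sup>2 + 2 * (?N t)\<^sup>2"
        using L2_norm_power2_le[OF space_fourier(2)[OF sobolev_at[OF r(1)]] space_fourier(2)[OF sobolev_at[OF t]]]
        unfolding D(3) bessel_weight_diff[abs_def] .
      ultimately show ?thesis by linarith
    qed simp
    with e(1) show ?thesis by blast
  qed
  then obtain e where e: "\<And>t. t \<ge> 0 \<Longrightarrow> e t > 0" "\<And>t r. t \<ge> 0 \<Longrightarrow> r \<ge> 0 \<Longrightarrow> dist t r < e t \<Longrightarrow> (?N r)\<^sup>2 \<le> 2 + 2 * (?N t)\<^sup>2"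
    by metis
  have "{0..T} \<subseteq> (\<Union>t\<in>{0..T}. ball t (e t))" using e(1) by force
  then obtain C where C: "C \<subseteq> {0..T}" "finite C" "{0..T} \<subseteq> (\<Union>t\<in>C. ball t (e t))"
    using compactE_image[of "{0..T}" "{0..T}" "\<lambda>t. ball t (e t)"] by auto
  define B where "B = (\<Sum>t\<in>C. 2 + 2 * (?N t)\<^sup>2)"
  have "?N r \<le> 1 + B" if r: "r \<in> {0..T}" for r
  proof -
    obtain t where t: "t \<in> C" "dist t r < e t" using C(3) r by auto
    have "(?N r)\<^sup>2 \<le> 2 + 2 * (?N t)\<^sup>2" using e(2)[of t r] t C(1) r by auto
    also have "\<dots> \<le> B" unfolding B_def using t(1) C(2) by (intro member_le_sum) auto
    finally have "(?N r)\<^sup>2 \<le> B" .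
    \<comment> \<open>Passes from a bound on the square to one on the norm itself.\<close>
    moreover have "2 * ?N r \<le> (?N r)\<^sup>2 + 1" using sum_squares_bound[of "?N r" 1] by simp
    ultimately show ?thesis using L2_norm_nonneg[of "bessel_weight s (space_fourier (u r))"] by linarith
  qed
  then have *: "\<And>t. t \<in> {0..T} \<Longrightarrow> ?N t \<le> 1 + B" .
  have "1 + B \<ge> 0" unfolding B_def by (intro add_nonneg_nonneg sum_nonneg) auto
  from that[OF this *] show thesis .
qed

text \<open>Linearity in f and the \<open>L2\<close> bound on the pairing, applied to f k -
  F.\<close>

lemma frac_pairing_tendsto:
  assumes g: "0 \<le> g" "2 * g \<le> s" and f: "\<And>k. fourier_rapid (f k)" "fourier_rapid F"
    and lim: "(\<lambda>k. L2_norm (\<lambda>x. f k x - F x)) \<longlonglongrightarrow> 0" and t: "t \<ge> 0"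
  shows "(\<lambda>k. frac_pairing g (f k) (u t)) \<longlonglongrightarrow> frac_pairing g F (u t)"
proof (rule LIM_zero_cancel)
  let ?N = "L2_norm (bessel_weight s (space_fourier (u t)))"
  have le: "norm (frac_pairing g (f k) (u t) - frac_pairing g F (u t)) \<le> ?N * L2_norm (\<lambda>x. f k x - F x)" for k
  proof -
    have eq: "inv_fourier (frac_symbol g (\<lambda>x. f k x - F x)) x = inv_fourier (frac_symbol g (f k)) x - inv_fourier (frac_symbol g F) x" for x
      unfolding inv_fourier_eq frac_symbol_diff[OF fourier_rapidD(2)[OF f(1)] fourier_rapidD(2)[OF f(2)], abs_def]
      by (rule fourier_diff[OF fourier_rapidD(6)[OF f(1) g(1)] fourier_rapidD(6)[OF f(2) g(1)]])
    have "frac_pairing g (f k) (u t) - frac_pairing g F (u t) = frac_pairing g (\<lambda>x. f k x - F x) (u t)"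
      unfolding frac_pairing_def eq
      using frac_pairing_slice(1)[OF t g f(1)] frac_pairing_slice(1)[OF t g f(2)]
      by (simp add: right_diff_distrib)
    then show ?thesis using frac_pairing_slice(2)[OF t g fourier_rapid_diff[OF f(1) f(2)]] by simp
  qed
  have "(\<lambda>k. ?N * L2_norm (\<lambda>x. f k x - F x)) \<longlonglongrightarrow> ?N * 0"
    by (intro tendsto_mult tendsto_const lim)
  then have "(\<lambda>k. ?N * L2_norm (\<lambda>x. f k x - F x)) \<longlonglongrightarrow> 0" by simp
  moreover have "\<forall>\<^sub>F k in sequentially. norm (frac_pairing g (f k) (u t) - frac_pairing g F (u t)) \<le> ?N * L2_norm (\<lambda>x. f k x - F x)"
    by (intro always_eventually allI le)
  ultimately show "(\<lambda>k. frac_pairing g (f k) (u t) - frac_pairing g F (u t)) \<longlonglongrightarrow> 0"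
    by (rule Lim_null_comparison[rotated])
qed

end

section \<open>Cutoff in time\<close>

definition bump1 :: "real \<Rightarrow> real" where "bump1 t = exp 1 * (flat 1 (1 - t\<^sup>2) * (- 2 * t))"
definition bump2 :: "real \<Rightarrow> real" where
  "bump2 t = exp 1 * (flat 2 (1 - t\<^sup>2) * (- 2 * t) * (- 2 * t) + flat 1 (1 - t\<^sup>2) * (- 2))"

lemma continuous_flat: "continuous_on UNIV (flat k)"
  using DERIV_flat by (intro continuous_at_imp_continuous_on) (auto intro: DERIV_isCont)

lemma DERIV_bump: "(bump has_real_derivative bump1 t) (at t)"
proof -
  have "((\<lambda>t. exp 1 * flat 0 (1 - t\<^sup>2)) has_real_derivative bump1 t) (at t)"
    unfolding bump1_def by (auto intro!: derivative_eq_intros DERIV_chain2[OF DERIV_flat])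
  then show ?thesis by (simp add: bump_def[abs_def])
qed

lemma DERIV_bump1: "(bump1 has_real_derivative bump2 t) (at t)"
  unfolding bump1_def[abs_def] bump2_def
  by (auto intro!: derivative_eq_intros DERIV_chain2[OF DERIV_flat] simp: numeral_2_eq_2 algebra_simps)

lemma bump12_bounded: obtains K where "K \<ge> 0" "\<And>t. \<bar>bump1 t\<bar> \<le> K" "\<And>t. \<bar>bump2 t\<bar> \<le> K"
proof -
  have c: "continuous_on UNIV bump1" "continuous_on UNIV bump2"
    unfolding bump1_def[abs_def] bump2_def[abs_def]
    by (intro continuous_intros continuous_on_compose2[OF continuous_flat]; simp)+
  have "bounded (bump1 ` {-1..1})" "bounded (bump2 ` {-1..1})"
    using c by (auto intro!: compact_imp_bounded compact_continuous_image intro: continuous_on_subset)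
  then obtain K1 K2 where K: "\<And>y. y \<in> bump1 ` {-1..1} \<Longrightarrow> \<bar>y\<bar> \<le> K1" "\<And>y. y \<in> bump2 ` {-1..1} \<Longrightarrow> \<bar>y\<bar> \<le> K2"
    unfolding bounded_iff real_norm_def by metis
  have z: "bump1 t = 0" "bump2 t = 0" if "t \<notin> {-1..1}" for t
  proof -
    have "\<bar>t\<bar> \<ge> 1" using that by auto
    then have "1 - t\<^sup>2 \<le> 0" using one_le_power[of "\<bar>t\<bar>" 2] by simp
    then show "bump1 t = 0" "bump2 t = 0" by (simp_all add: bump1_def bump2_def flat_def)
  qed
  have "\<bar>bump1 t\<bar> \<le> \<bar>K1\<bar> + \<bar>K2\<bar>" "\<bar>bump2 t\<bar> \<le> \<bar>K1\<bar> + \<bar>K2\<bar>" for t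
    using K(1)[OF imageI, of t] K(2)[OF imageI, of t] z[of t] by (cases "t \<in> {-1..1}"; force)+
  then show ?thesis using that[of "\<bar>K1\<bar> + \<bar>K2\<bar>"] by auto
qed

text \<open>A large power of a bump function dominates its derivatives up to the power \<open>1 / p\<close>.\<close>

lemma time_cutoff:
  fixes p :: real
  assumes p: "p > 1"
  obtains \<eta> \<eta>1 \<eta>2 :: "real \<Rightarrow> real" and K where
    "\<And>t. (\<eta> has_real_derivative \<eta>1 t) (at t)" "\<And>t. (\<eta>1 has_real_derivative \<eta>2 t) (at t)"
    "continuous_on UNIV \<eta>2" "\<And>c. smooth (\<lambda>z::real \<times> 'a::euclidean_space. \<eta> (c * fst z))" "\<eta> 0 = 1"
    "\<And>t. 0 \<le> \<eta> t" "\<And>t. \<eta> t \<le> 1" "\<And>t. \<bar>t\<bar> \<ge> 1 \<Longrightarrow> \<eta> t = 0" "K \<ge> 0"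
    "\<And>t. \<bar>\<eta>1 t\<bar> \<le> K * \<eta> t powr (1 / p)" "\<And>t. \<bar>\<eta>2 t\<bar> \<le> K * \<eta> t powr (1 / p)"
proof -
  obtain K where K: "K \<ge> 0" "\<And>t. \<bar>bump1 t\<bar> \<le> K" "\<And>t. \<bar>bump2 t\<bar> \<le> K" using bump12_bounded by blast
  \<comment> \<open>Two derivatives of bump^N leave the power m = N - 2, which has to be at least N
    / p; this is N (1 - 1/p) \<ge> 2. As bump \<le> 1, the larger exponent gives the smaller power.
    The positivity of m settles the points where the bump vanishes.\<close>
  define m where "m = nat \<lceil>2 / (1 - 1 / p)\<rceil> + 1"
  define N where "N = m + 2"
  have m: "m \<ge> 1" "real N * (1 - 1 / p) \<ge> 2"
  proof -
    have "2 / (1 - 1 / p) \<le> real N" unfolding N_def m_def by linarith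
    then show "real N * (1 - 1 / p) \<ge> 2" using p by (simp add: field_simps)
  qed (simp add: m_def)
  define \<eta> where "\<eta> t = bump t ^ N" for t :: real
  define \<eta>1 where "\<eta>1 t = real N * bump t ^ (m + 1) * bump1 t" for t :: real
  define \<eta>2 where "\<eta>2 t = real N * (real (m + 1) * bump t ^ m * bump1 t * bump1 t + bump t ^ (m + 1) * bump2 t)" for t :: real
  define C where "C = real N * (real (m + 1) * K * K + K)"
  have d1: "(\<eta> has_real_derivative \<eta>1 t) (at t)" for t
    unfolding \<eta>_def[abs_def] \<eta>1_def N_def
    by (rule DERIV_cong[OF DERIV_power[OF DERIV_bump]]) simp
  have d2: "(\<eta>1 has_real_derivative \<eta>2 t) (at t)" for t
    unfolding \<eta>1_def[abs_def] \<eta>2_def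
    by (rule DERIV_cong[OF DERIV_mult[OF DERIV_cmult[OF DERIV_power[OF DERIV_bump]] DERIV_bump1]]) (simp add: algebra_simps)
  have cb: "continuous_on UNIV (bump :: real \<Rightarrow> real)" "continuous_on UNIV bump1" "continuous_on UNIV bump2"
    unfolding bump_def[abs_def] bump1_def[abs_def] bump2_def[abs_def]
    by (intro continuous_intros continuous_on_compose2[OF continuous_flat]; simp)+
  have c: "continuous_on UNIV \<eta>2" unfolding \<eta>2_def[abs_def]
    by (intro continuous_on_mult continuous_on_add continuous_on_power continuous_on_const cb)
  have sm: "smooth (\<lambda>z::real \<times> 'a. \<eta> (c * fst z))" for c
    unfolding \<eta>_def
    by (intro smooth_power smooth_bump bounded_linear_const_mult bounded_linear_fst)
  have bd: "0 \<le> \<eta> t" "\<eta> t \<le> 1" for t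
    unfolding \<eta>_def using bump_bounds[of t] by (auto intro: power_le_one)
  have z: "\<eta> t = 0" if "\<bar>t\<bar> \<ge> 1" for t
    using bump_eq_0[of t] that by (simp add: \<eta>_def N_def)
  have pw: "bump t ^ m \<le> \<eta> t powr (1 / p)" for t
  proof (cases "bump t = 0")
    case True
    then show ?thesis using m(1) by (simp add: power_0_left)
  next
    case False
    then have b: "bump t > 0" using bump_bounds[of t] by simp
    have "bump t ^ m = bump t powr real m" using b by (simp add: powr_realpow)
    also have "\<dots> \<le> bump t powr (real N * (1 / p))"
      using m(2) b bump_bounds(2)[of t] by (intro powr_mono') (auto simp: N_def right_diff_distrib)
    also have "\<dots> = \<eta> t powr (1 / p)"
      unfolding \<eta>_def using b by (simp add: powr_powr flip: powr_realpow)
    finally show ?thesis .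
  qed
  have C0: "C \<ge> 0" unfolding C_def using K(1) by simp
  have pm: "bump t ^ (m + 1) \<le> bump t ^ m" "bump t ^ m \<ge> 0" "bump t ^ (m + 1) \<ge> 0" for t :: real
    using bump_bounds[of t] by (auto intro: mult_left_le_one_le)
  have b1: "\<bar>\<eta>1 t\<bar> \<le> C * \<eta> t powr (1 / p)" for t
  proof -
    have "\<bar>\<eta>1 t\<bar> = real N * (bump t ^ (m + 1) * \<bar>bump1 t\<bar>)"
      unfolding \<eta>1_def by (simp only: abs_mult abs_of_nonneg[OF pm(3)] abs_of_nat mult.assoc)
    also have "\<dots> \<le> real N * (bump t ^ m * K)"
      by (intro mult_left_mono mult_mono pm K) auto
    also have "\<dots> \<le> C * bump t ^ m"
    proof -
      have "real N * K \<le> C" unfolding C_def using K(1) by (intro mult_left_mono) auto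
      from mult_right_mono[OF this pm(2)[of t]] show ?thesis by (simp add: mult_ac)
    qed
    also have "\<dots> \<le> C * \<eta> t powr (1 / p)" by (intro mult_left_mono pw C0)
    finally show ?thesis .
  qed
  have b2: "\<bar>\<eta>2 t\<bar> \<le> C * \<eta> t powr (1 / p)" for t
  proof -
    have "\<bar>real (m + 1) * bump t ^ m * bump1 t * bump1 t + bump t ^ (m + 1) * bump2 t\<bar> \<le>
        real (m + 1) * bump t ^ m * (\<bar>bump1 t\<bar> * \<bar>bump1 t\<bar>) + bump t ^ (m + 1) * \<bar>bump2 t\<bar>"
      by (intro order_trans[OF abs_triangle_ineq])
         (simp only: abs_mult abs_of_nonneg[OF pm(2)] abs_of_nonneg[OF pm(3)] abs_of_nat mult.assoc order_refl)
    also have "\<dots> \<le> real (m + 1) * bump t ^ m * (K * K) + bump t ^ m * K"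
      using pm(2)[of t] K(1) by (intro add_mono mult_left_mono mult_mono pm K) auto
    finally have "\<bar>real (m + 1) * bump t ^ m * bump1 t * bump1 t + bump t ^ (m + 1) * bump2 t\<bar> \<le> real (m + 1) * bump t ^ m * (K * K) + bump t ^ m * K" .
    then have "\<bar>\<eta>2 t\<bar> \<le> real N * (real (m + 1) * bump t ^ m * (K * K) + bump t ^ m * K)"
      unfolding \<eta>2_def abs_mult by (intro mult_mono) auto
    also have "\<dots> = C * bump t ^ m" unfolding C_def by (simp add: algebra_simps)
    also have "\<dots> \<le> C * \<eta> t powr (1 / p)" by (intro mult_left_mono pw C0)
    finally show ?thesis .
  qed
  show ?thesis
    by (rule that[OF d1 d2 c sm _ bd z C0 b1 b2]) (simp add: \<eta>_def)
qed

section \<open>Measurability and iterated integrals for the complete measure\<close>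

lemma borel_measurable_lebesgue_AE:
  fixes f g :: "'a::euclidean_space \<Rightarrow> 'b::topological_space"
  assumes f: "f \<in> borel_measurable lborel" and ae: "AE x in lborel. f x = g x"
  shows "g \<in> borel_measurable lebesgue"
proof (rule measurableI)
  fix A :: "'b set" assume A: "A \<in> sets borel"
  obtain N where N: "N \<in> null_sets lborel" "{x \<in> space lborel. f x \<noteq> g x} \<subseteq> N"
    using ae by (auto simp: eventually_ae_filter)
  have fA: "f -` A \<inter> space lborel \<in> sets lborel" using f A by (rule measurable_sets)
  have 1: "(g -` A) \<inter> N \<in> sets lebesgue"
    using N(1) null_sets_completion_subset[of "g -` A \<inter> N" N lborel] null_sets_completionI[OF N(1)]
    by (auto simp: null_sets_def)
  have "g -` A \<inter> space lebesgue = ((f -` A \<inter> space lborel) - N) \<union> (g -` A \<inter> N)"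
  proof -
    have "f x = g x" if "x \<notin> N" for x using N(2) that by auto
    then show ?thesis by auto
  qed
  also have "\<dots> \<in> sets lebesgue"
    using 1 fA N(1) by (intro sets.Un sets.Diff) (auto simp: null_sets_def)
  finally show "g -` A \<inter> space lebesgue \<in> sets lebesgue" .
qed simp

text \<open>Tonelli's theorem for the complete measure; the library states it for product measures only.\<close>

lemma
  fixes h :: "real \<times> 'a::euclidean_space \<Rightarrow> real"
  assumes i: "integrable lebesgue h" and nn: "\<And>z. h z \<ge> 0"
    and m: "\<And>t. (\<lambda>x. h (t, x)) \<in> borel_measurable lebesgue"
  shows Tonelli_lebesgue_measurable: "(\<lambda>t. \<integral>\<^sup>+x. ennreal (h (t, x)) \<partial>lebesgue) \<in> borel_measurable lebesgue"
    and Tonelli_lebesgue: "(\<integral>\<^sup>+t. \<integral>\<^sup>+x. ennreal (h (t, x)) \<partial>lebesgue \<partial>lebesgue) = ennreal (LINT t|lebesgue. LINT x|lebesgue. h (t, x))"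
proof -
  \<comment> \<open>A Borel version of h, to which Tonelli for the product measure applies. For
    almost every t its slice agrees with that of h almost everywhere.\<close>
  obtain h' where h': "h' \<in> borel_measurable lborel" "AE z in lborel. h z = h' z"
    using completion_ex_borel_measurable_real[OF borel_measurable_integrable[OF i]] by auto
  have [measurable]: "h' \<in> borel_measurable (lborel \<Otimes>\<^sub>M lborel)" using h'(1) unfolding lborel_prod .
  let ?h' = "\<lambda>z. ennreal (h' z)"
  have ae: "AE t in lborel. AE x in lborel. h (t, x) = h' (t, x)"
    using h'(2) unfolding lborel_prod[symmetric] by (rule lborel_pair.AE_pair)
  have aeq: "AE t in lborel. (\<integral>\<^sup>+x. ?h' (t, x) \<partial>lborel) = (\<integral>\<^sup>+x. ennreal (h (t, x)) \<partial>lebesgue)"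
    using ae
  proof eventually_elim
    fix t assume "AE x in lborel. h (t, x) = h' (t, x)"
    then have "AE x in lebesgue. h (t, x) = h' (t, x)" by (rule AE_completion)
    then have "(\<integral>\<^sup>+x. ennreal (h (t, x)) \<partial>lebesgue) = (\<integral>\<^sup>+x. ?h' (t, x) \<partial>lebesgue)"
      by (intro nn_integral_cong_AE) auto
    also have "\<dots> = (\<integral>\<^sup>+x. ?h' (t, x) \<partial>lborel)" by (rule nn_integral_completion)
    finally show "(\<integral>\<^sup>+x. ?h' (t, x) \<partial>lborel) = (\<integral>\<^sup>+x. ennreal (h (t, x)) \<partial>lebesgue)" by simp
  qed
  have m': "(\<lambda>t. \<integral>\<^sup>+x. ?h' (t, x) \<partial>lborel) \<in> borel_measurable lborel" by measurable
  show M: "(\<lambda>t. \<integral>\<^sup>+x. ennreal (h (t, x)) \<partial>lebesgue) \<in> borel_measurable lebesgue"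
    by (rule borel_measurable_lebesgue_AE[OF m' aeq])
  have "(\<integral>\<^sup>+t. \<integral>\<^sup>+x. ennreal (h (t, x)) \<partial>lebesgue \<partial>lebesgue) = (\<integral>\<^sup>+t. \<integral>\<^sup>+x. ?h' (t, x) \<partial>lborel \<partial>lebesgue)"
    using AE_completion[OF aeq] by (intro nn_integral_cong_AE) auto
  also have "\<dots> = (\<integral>\<^sup>+t. \<integral>\<^sup>+x. ?h' (t, x) \<partial>lborel \<partial>lborel)" by (rule nn_integral_completion)
  also have "\<dots> = (\<integral>\<^sup>+z. ?h' z \<partial>(lborel \<Otimes>\<^sub>M lborel))" by (rule lborel.nn_integral_fst) measurable
  also have "\<dots> = (\<integral>\<^sup>+z. ?h' z \<partial>lborel)" unfolding lborel_prod ..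
  also have "\<dots> = (\<integral>\<^sup>+z. ennreal (h z) \<partial>lborel)" using h'(2) by (intro nn_integral_cong_AE) auto
  also have "\<dots> = (\<integral>\<^sup>+z. ennreal (h z) \<partial>lebesgue)" by (rule nn_integral_completion[symmetric])
  also have "\<dots> < \<infinity>" using i nn by (simp add: integrable_iff_bounded)
  finally have fin: "(\<integral>\<^sup>+t. \<integral>\<^sup>+x. ennreal (h (t, x)) \<partial>lebesgue \<partial>lebesgue) < \<infinity>" .
  \<comment> \<open>\<open>enn2real\<close> sends infinity to 0, so a slice of infinite mass would
    have Bochner integral 0. Finiteness of the total confines such t to a null set.\<close>
  have x: "(LINT x|lebesgue. h (t, x)) = enn2real (\<integral>\<^sup>+x. ennreal (h (t, x)) \<partial>lebesgue)" for t
    using m nn by (intro integral_eq_nn_integral) auto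
  have "AE t in lebesgue. (\<integral>\<^sup>+x. ennreal (h (t, x)) \<partial>lebesgue) \<noteq> \<infinity>"
    using M fin by (intro nn_integral_PInf_AE) auto
  then have "(\<integral>\<^sup>+t. \<integral>\<^sup>+x. ennreal (h (t, x)) \<partial>lebesgue \<partial>lebesgue) = (\<integral>\<^sup>+t. ennreal (LINT x|lebesgue. h (t, x)) \<partial>lebesgue)"
    unfolding x by (intro nn_integral_cong_AE) (auto simp: less_top)
  moreover have "(LINT t|lebesgue. LINT x|lebesgue. h (t, x)) = enn2real (\<integral>\<^sup>+t. ennreal (LINT x|lebesgue. h (t, x)) \<partial>lebesgue)"
    using M nn unfolding x by (intro integral_eq_nn_integral) auto
  ultimately show "(\<integral>\<^sup>+t. \<integral>\<^sup>+x. ennreal (h (t, x)) \<partial>lebesgue \<partial>lebesgue) = ennreal (LINT t|lebesgue. LINT x|lebesgue. h (t, x))"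
    using fin by (simp add: less_top)
qed

section \<open>The test function estimate\<close>

text \<open>Either D is so small against x^(p-1) that the product is absorbed by x^p / 2, or x is at
  most (2 D)^(1/(p-1)). The factor 1/2 leaves room to absorb |u|^p later.\<close>

lemma young_le:
  fixes x D p :: real
  assumes p: "p > 1" and x: "x \<ge> 0" and D: "D \<ge> 0"
  shows "x * D \<le> x powr p / 2 + 2 powr (1 / (p - 1)) * D powr (p / (p - 1))"
proof (cases "x = 0 \<or> D = 0")
  case False
  then have pos: "x > 0" "D > 0" using x D by auto
  show ?thesis
  proof (cases "2 * D \<le> x powr (p - 1)")
    case True
    have "x * D \<le> x * (x powr (p - 1) / 2)" using True pos by (intro mult_left_mono) auto
    also have "\<dots> = x powr p / 2" using pos by (simp add: powr_diff)
    finally show ?thesis by (simp add: add_increasing2)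
  next
    case False
    have "x = (x powr (p - 1)) powr (1 / (p - 1))" using pos p by (simp add: powr_powr)
    also have "\<dots> \<le> (2 * D) powr (1 / (p - 1))" using False p by (intro powr_mono2) auto
    finally have "x * D \<le> (2 * D) powr (1 / (p - 1)) * D" using pos by (intro mult_right_mono) auto
    also have "\<dots> = 2 powr (1 / (p - 1)) * (D powr (1 / (p - 1)) * D powr 1)" using pos by (simp add: powr_mult)
    also have "D powr (1 / (p - 1)) * D powr 1 = D powr (p / (p - 1))"
    proof -
      have "1 / (p - 1) + 1 = p / (p - 1)" using p by (simp add: field_simps)
      then show ?thesis by (simp only: powr_add[symmetric])
    qed
    finally show ?thesis by (simp add: add_increasing)
  qed
qed auto

lemma frac_laplacian_cmult: "frac_laplacian g (\<lambda>y. c * f y) x = c * frac_laplacian g f x"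
proof -
  have F: "fourier (\<lambda>y. of_real (c * f y)) \<xi> = of_real c * fourier (\<lambda>y. of_real (f y)) \<xi>" for \<xi>
    unfolding fourier_def of_real_mult
    by (simp only: mult.left_commute[of _ "of_real c"] integral_mult_right_zero)
  have "inv_fourier (\<lambda>\<xi>. of_real (norm \<xi> powr (2 * g)) * (of_real c * fourier (\<lambda>y. of_real (f y)) \<xi>)) x
     = of_real c * inv_fourier (\<lambda>\<xi>. of_real (norm \<xi> powr (2 * g)) * fourier (\<lambda>y. of_real (f y)) \<xi>) x"
    unfolding inv_fourier_def
    by (simp only: mult.left_commute[of _ "of_real c"] integral_mult_right_zero)
  then show ?thesis unfolding frac_laplacian_def F by simp
qed

lemma continuous_sobolev_measurable:
  assumes "continuous_sobolev s u" "t \<ge> 0"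
  shows "u t \<in> borel_measurable lebesgue"
proof -
  have "(\<lambda>x. complex_of_real (u t x)) \<in> borel_measurable lebesgue"
    using sobolev_at[OF assms] by (auto simp: sobolev_space_def is_L2_fourier_def L2_def)
  from measurable_compose[OF this borel_measurable_Re] show ?thesis by simp
qed

text \<open>The function f counts as its own fractional Laplacian of order 0, so all three terms
  become pairings of the same kind.\<close>

lemma integral_slice:
  fixes u :: "real \<Rightarrow> 'a::euclidean_space \<Rightarrow> real"
  assumes cs: "continuous_sobolev (2 * \<sigma>) u" and s: "0 \<le> \<delta>" "\<delta> \<le> \<sigma>" and t: "t \<ge> 0"
    and f: "fourier_rapid (\<lambda>x. complex_of_real (f x))"
  shows "(LINT x|lebesgue. u t x * (a * f x + b * frac_laplacian \<sigma> f x - c * frac_laplacian \<delta> f x)) =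
      a * Re (frac_pairing 0 (\<lambda>x. of_real (f x)) (u t)) + b * Re (frac_pairing \<sigma> (\<lambda>x. of_real (f x)) (u t))
      - c * Re (frac_pairing \<delta> (\<lambda>x. of_real (f x)) (u t))"
proof -
  let ?g = "\<lambda>\<gamma> x. complex_of_real (u t x) * inv_fourier (frac_symbol \<gamma> (\<lambda>x. of_real (f x))) x"
  have i: "integrable lebesgue (?g \<gamma>)" if "0 \<le> \<gamma>" "\<gamma> \<le> \<sigma>" for \<gamma>
    using that by (intro frac_pairing_slice(1)[OF cs t _ _ f]) auto
  have r: "integrable lebesgue (\<lambda>x. Re (?g \<gamma> x))" "(LINT x|lebesgue. Re (?g \<gamma> x)) = Re (frac_pairing \<gamma> (\<lambda>x. of_real (f x)) (u t))"
    if "0 \<le> \<gamma>" "\<gamma> \<le> \<sigma>" for \<gamma>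
    using integrable_Re[OF i[OF that]] integral_bounded_linear[OF bounded_linear_Re i[OF that]]
    unfolding frac_pairing_def by (simp_all only:)
  have eq: "u t x * (a * f x + b * frac_laplacian \<sigma> f x - c * frac_laplacian \<delta> f x) =
      a * Re (?g 0 x) + b * Re (?g \<sigma> x) - c * Re (?g \<delta> x)" for x
    unfolding frac_laplacian_eq inv_fourier_frac_symbol_0[OF f] by (simp add: algebra_simps)
  have s': "0 \<le> \<sigma>" using s by simp
  note R = r[OF order_refl s'] r[OF s' order_refl] r[OF s]
  show "(LINT x|lebesgue. u t x * (a * f x + b * frac_laplacian \<sigma> f x - c * frac_laplacian \<delta> f x)) =
      a * Re (frac_pairing 0 (\<lambda>x. of_real (f x)) (u t)) + b * Re (frac_pairing \<sigma> (\<lambda>x. of_real (f x)) (u t))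
      - c * Re (frac_pairing \<delta> (\<lambda>x. of_real (f x)) (u t))"
    unfolding eq R(2,4,6)[symmetric]
    by (simp only: Bochner_Integration.integral_diff Bochner_Integration.integral_add integral_mult_right_zero
       Bochner_Integration.integrable_add integrable_mult_right R(1,3,5))
qed

text \<open>For a product test function the time derivatives fall on \<eta> and the spatial
  operators on f, so each time slice of the right side consists of pairings of order 0, \<sigma> and
  \<delta>.\<close>

lemma solution_product_test_function:
  fixes u :: "real \<Rightarrow> 'a::euclidean_space \<Rightarrow> real"
  assumes sol: "global_sobolev_solution \<sigma> \<delta> p u1 u" and s: "0 \<le> \<delta>" "\<delta> \<le> \<sigma>"
    and f: "fourier_rapid (\<lambda>x. complex_of_real (f x))"
    and d: "\<And>t. (\<eta> has_real_derivative \<eta>1 t) (at t)" "\<And>t. (\<eta>1 has_real_derivative \<eta>2 t) (at t)"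
    and test: "(\<lambda>z. \<eta> (fst z) * f (snd z)) \<in> test_functions"
  shows "(LINT t:{0..}|lebesgue. LINT x|lebesgue. \<bar>u t x\<bar> powr p * (\<eta> t * f x)) + (LINT x|lebesgue. u1 x * (\<eta> 0 * f x)) =
    (LINT t:{0..}|lebesgue. \<eta>2 t * Re (frac_pairing 0 (\<lambda>x. of_real (f x)) (u t))
       + \<eta> t * Re (frac_pairing \<sigma> (\<lambda>x. of_real (f x)) (u t)) - \<eta>1 t * Re (frac_pairing \<delta> (\<lambda>x. of_real (f x)) (u t)))"
proof -
  have cs: "continuous_sobolev (2 * \<sigma>) u" using sol by (simp add: global_sobolev_solution_def)
  have d1: "deriv (\<lambda>s. \<eta> s * c) = (\<lambda>t. \<eta>1 t * c)" for c
    by (intro ext DERIV_imp_deriv DERIV_cmult_right d)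
  have d2: "(deriv ^^ 2) (\<lambda>s. \<eta> s * c) = (\<lambda>t. \<eta>2 t * c)" for c
    unfolding numeral_2_eq_2 funpow.simps o_def id_def d1
    by (intro ext DERIV_imp_deriv DERIV_cmult_right d)
  have "(LINT t:{0..}|lebesgue. LINT x|lebesgue. \<bar>u t x\<bar> powr p * (\<eta> t * f x)) + (LINT x|lebesgue. u1 x * (\<eta> 0 * f x)) =
    (LINT t:{0..}|lebesgue. LINT x|lebesgue. u t x * (\<eta>2 t * f x + frac_laplacian \<sigma> (\<lambda>y. \<eta> t * f y) x - frac_laplacian \<delta> (\<lambda>y. \<eta>1 t * f y) x))"
    using sol test unfolding global_sobolev_solution_def
    by (auto simp: d1 d2 dest!: bspec[of test_functions _ "\<lambda>z. \<eta> (fst z) * f (snd z)"])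
  also have "\<dots> = (LINT t:{0..}|lebesgue. \<eta>2 t * Re (frac_pairing 0 (\<lambda>x. of_real (f x)) (u t))
       + \<eta> t * Re (frac_pairing \<sigma> (\<lambda>x. of_real (f x)) (u t)) - \<eta>1 t * Re (frac_pairing \<delta> (\<lambda>x. of_real (f x)) (u t)))"
    unfolding frac_laplacian_cmult
    by (rule set_lebesgue_integral_cong) (auto intro!: integral_slice[OF cs s _ f])
  finally show ?thesis .
qed

text \<open>The weak equation is used with truncations f k of F, but the bounds by Cs and Cd are
  available for F alone. Hence the linear side B and the data term U are passed to the limit by
  dominated convergence, the nonlinear term by Fatou, and Young's inequality enters only at the
  limit. Absorbing half of the nonlinear term produces the factor 2; the factor T is the length of
  the time interval.\<close>

lemma weak_estimate:
  fixes u :: "real \<Rightarrow> 'a::euclidean_space \<Rightarrow> real"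
  assumes sol: "global_sobolev_solution \<sigma> \<delta> p u1 u" and s: "0 \<le> \<delta>" "\<delta> \<le> \<sigma>" and p: "p > 1"
    and u1: "integrable lebesgue u1"
    and F: "fourier_rapid (\<lambda>x. complex_of_real (F x))" "smooth F" "smooth (\<lambda>z::real \<times> 'a. F (snd z))"
      "\<And>x. 0 \<le> F x" "\<And>x. F x \<le> 1"
    and d: "\<And>t. (\<eta> has_real_derivative \<eta>1 t) (at t)" "\<And>t. (\<eta>1 has_real_derivative \<eta>2 t) (at t)"
      "continuous_on UNIV \<eta>2"
    and \<eta>: "smooth (\<lambda>z::real \<times> 'a. \<eta> (fst z))" "\<eta> 0 = 1" "\<And>t. 0 \<le> \<eta> t" "\<And>t. \<eta> t \<le> 1" "\<And>t. \<bar>t\<bar> \<ge> T \<Longrightarrow> \<eta> t = 0"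
    and T: "T \<ge> 0"
    and A: "\<And>t. \<bar>\<eta>1 t\<bar> \<le> A1 * \<eta> t powr (1 / p)" "\<And>t. \<bar>\<eta>2 t\<bar> \<le> A2 * \<eta> t powr (1 / p)" "A1 \<ge> 0" "A2 \<ge> 0"
    and C: "\<And>x. \<bar>frac_laplacian \<sigma> F x\<bar> \<le> Cs * F x" "\<And>x. \<bar>frac_laplacian \<delta> F x\<bar> \<le> Cd * F x" "Cs \<ge> 0" "Cd \<ge> 0"
  shows "(LINT x|lebesgue. u1 x * F x) \<le>
    2 * (T * (2 powr (1 / (p - 1)) * (A2 + Cs + A1 * Cd) powr (p / (p - 1)) * (LINT x|lebesgue. F x)))"
proof -
  define D where "D = A2 + Cs + A1 * Cd"
  define Y where "Y = 2 powr (1 / (p - 1)) * D powr (p / (p - 1))"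
  have D0: "D \<ge> 0" and Y0: "Y \<ge> 0" unfolding D_def Y_def using A C by auto
  have cs: "continuous_sobolev (2 * \<sigma>) u" using sol by (simp add: global_sobolev_solution_def)
  note um = continuous_sobolev_measurable[OF cs]
  define f where "f k x = F x * bump ((1 / real (Suc k)) *\<^sub>R x)" for k and x :: 'a
  define P where "P g h t = Re (frac_pairing g (\<lambda>x. of_real (h x)) (u t))" for g and h :: "'a \<Rightarrow> real" and t
  \<comment> \<open>\<open>I h t\<close> collects the linear terms at time t, \<open>B h\<close> is
    its time integral, \<open>U h\<close> the data term and \<open>w h\<close> the integrand of the
    nonlinear term. The weak equation reads: integral of \<open>w h\<close> = \<open>B h\<close> -
    \<open>U h\<close>.\<close>
  define I where "I h t = \<eta>2 t * P 0 h t + \<eta> t * P \<sigma> h t - \<eta>1 t * P \<delta> h t" for h t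
  define B where "B h = (LINT t:{0..}|lebesgue. I h t)" for h
  define U where "U h = (LINT x|lebesgue. u1 x * h x)" for h
  define w where "w h = (\<lambda>(t, x). indicator {0..} t * (\<bar>u t x\<bar> powr p * (\<eta> t * h x)))" for h :: "'a \<Rightarrow> real"
  have s0: "0 \<le> \<sigma>" using s by simp
  have F1: "integrable lebesgue F" using fourier_rapidD(2)[OF F(1)] by (simp only: integrable_of_real_iff)
  have cF: "continuous_on UNIV F" using F(2) by (auto simp: smooth_def intro: C_k_continuous)
  have c\<eta>: "continuous_on UNIV \<eta>" "continuous_on UNIV \<eta>1"
    using d by (auto intro!: continuous_at_imp_continuous_on DERIV_isCont)
  have e1: "\<eta> t powr (1 / p) \<le> 1" "\<eta> t \<le> \<eta> t powr (1 / p)" for t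
  proof -
    show "\<eta> t powr (1 / p) \<le> 1" using powr_mono2[of "1 / p" "\<eta> t" 1] \<eta> p by simp
    show "\<eta> t \<le> \<eta> t powr (1 / p)" using powr_mono'[of "1 / p" 1 "\<eta> t"] \<eta>(3,4)[of t] p by simp
  qed
  \<comment> \<open>Where \<eta> vanishes, so do its derivatives: both are bounded by a multiple of
    \<eta>^(1/p).\<close>
  have \<eta>z: "\<eta> t = 0" "\<eta>1 t = 0" "\<eta>2 t = 0" if "t > T" for t
    using \<eta>(5)[of t] A(1,2)[of t] that T by auto

  have fb: "0 \<le> f k x" "f k x \<le> F x" for k x
    unfolding f_def using F(4)[of x] bump_bounds[of "(1 / real (Suc k)) *\<^sub>R x"] by (auto intro: mult_left_le)
  have fz: "f k x = 0" if "norm x > real (Suc k)" for k x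
  proof -
    have "norm ((1 / real (Suc k)) *\<^sub>R x) \<ge> 1" using that by (simp add: field_simps)
    then show ?thesis unfolding f_def by (simp add: bump_eq_0)
  qed
  have fs: "smooth (f k)" "smooth (\<lambda>z::real \<times> 'a. f k (snd z))" for k
    unfolding f_def[abs_def]
    by (intro smooth_mult F smooth_bump bounded_linear_scaleR_right
        bounded_linear_compose[OF bounded_linear_scaleR_right bounded_linear_snd])+
  have fr: "fourier_rapid (\<lambda>x. complex_of_real (f k x))" for k
    by (rule fourier_rapid_compact_support[OF fs(1) fz])
  have flim: "(\<lambda>k. f k x) \<longlonglongrightarrow> F x" for x
  proof -
    have "(\<lambda>k. 1 / real (Suc k)) \<longlonglongrightarrow> 0"
      using LIMSEQ_inverse_real_of_nat by (simp add: inverse_eq_divide)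
    then have "(\<lambda>k. (1 / real (Suc k)) *\<^sub>R x) \<longlonglongrightarrow> 0 *\<^sub>R x" by (intro tendsto_intros)
    moreover have "continuous_on UNIV (bump :: 'a \<Rightarrow> real)"
      unfolding bump_def[abs_def] by (intro continuous_intros continuous_on_compose2[OF continuous_flat]) auto
    ultimately have "(\<lambda>k. bump ((1 / real (Suc k)) *\<^sub>R x)) \<longlonglongrightarrow> bump (0 *\<^sub>R x)"
      by (intro continuous_on_tendsto_compose[where f=bump and s=UNIV]) auto
    then have "(\<lambda>k. F x * bump ((1 / real (Suc k)) *\<^sub>R x)) \<longlonglongrightarrow> F x * bump (0 *\<^sub>R x)"
      by (intro tendsto_intros)
    then show ?thesis by (simp add: f_def)
  qed
  have cf: "continuous_on UNIV (f k)" for k using fs(1) by (auto simp: smooth_def intro: C_k_continuous)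
  have mf: "f k \<in> borel_measurable lebesgue" "F \<in> borel_measurable lebesgue" for k
    using cf cF by (auto intro!: borel_measurable_lebesgueI borel_measurable_continuous_onI)
  have L2lim: "(\<lambda>k. L2_norm (\<lambda>x. complex_of_real (f k x) - of_real (F x))) \<longlonglongrightarrow> 0"
  proof -
    have "(\<lambda>k. LINT x|lebesgue. (norm (complex_of_real (f k x) - of_real (F x)))\<^sup>2) \<longlonglongrightarrow> (LINT x::'a|lebesgue. 0)"
    proof (rule integral_dominated_convergence[where w="\<lambda>x. (norm (complex_of_real (F x)))\<^sup>2"])
      show "integrable lebesgue (\<lambda>x. (norm (complex_of_real (F x)))\<^sup>2)"
        by (rule L2_D(2)[OF fourier_rapidD(3)[OF F(1)]])
      show "AE x in lebesgue. (\<lambda>k. (norm (complex_of_real (f k x) - of_real (F x)))\<^sup>2) \<longlonglongrightarrow> 0"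
      proof (intro AE_I2)
        fix x
        have "(\<lambda>k. (norm (complex_of_real (f k x) - of_real (F x)))\<^sup>2) \<longlonglongrightarrow> (norm (complex_of_real (F x) - of_real (F x)))\<^sup>2"
          by (intro tendsto_intros flim)
        then show "(\<lambda>k. (norm (complex_of_real (f k x) - of_real (F x)))\<^sup>2) \<longlonglongrightarrow> 0" by simp
      qed
      show "AE x in lebesgue. norm ((norm (complex_of_real (f k x) - of_real (F x)))\<^sup>2) \<le> (norm (complex_of_real (F x)))\<^sup>2" for k
      proof (intro AE_I2)
        fix x
        have "\<bar>f k x - F x\<bar> \<le> \<bar>F x\<bar>" using fb[of k x] by auto
        then have "(f k x - F x)\<^sup>2 \<le> (F x)\<^sup>2" by (simp add: abs_le_square_iff)
        then show "norm ((norm (complex_of_real (f k x) - of_real (F x)))\<^sup>2) \<le> (norm (complex_of_real (F x)))\<^sup>2"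
          by (simp flip: of_real_diff)
      qed
    qed (use mf in measurable)
    from tendsto_real_sqrt[OF this] show ?thesis by (simp add: L2_norm_def)
  qed
  obtain N where N: "N \<ge> 0" "\<And>t. t \<in> {0..T} \<Longrightarrow> L2_norm (bessel_weight (2 * \<sigma>) (space_fourier (u t))) \<le> N"
    using sobolev_bounded[OF cs, of T] by blast
  define L where "L = L2_norm (\<lambda>x. complex_of_real (F x))"
  have L0: "L \<ge> 0" by (simp add: L_def L2_norm_nonneg)
  have Lf: "L2_norm (\<lambda>x. complex_of_real (f k x)) \<le> L" for k
    unfolding L_def
  proof (rule L2_norm_mono)
    show "(\<lambda>x. complex_of_real (f k x)) \<in> borel_measurable lebesgue" using mf(1)[of k] by measurable
    show "(\<lambda>x. complex_of_real (F x)) \<in> L2" by (rule fourier_rapidD(3)[OF F(1)])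
    show "norm (complex_of_real (f k x)) \<le> norm (complex_of_real (F x))" for x using fb[of k x] by simp
  qed
  have Pb: "\<bar>P g (f k) t\<bar> \<le> N * L" if "0 \<le> g" "g \<le> \<sigma>" "t \<in> {0..T}" for g k t
  proof -
    have "\<bar>P g (f k) t\<bar> \<le> norm (frac_pairing g (\<lambda>x. of_real (f k x)) (u t))"
      unfolding P_def by (rule abs_Re_le_cmod)
    also have "\<dots> \<le> L2_norm (bessel_weight (2 * \<sigma>) (space_fourier (u t))) * L2_norm (\<lambda>x. complex_of_real (f k x))"
      using that by (intro frac_pairing_slice(2)[OF cs _ _ _ fr]) auto
    also have "\<dots> \<le> N * L" using N L0 Lf that by (intro mult_mono) (auto simp: L2_norm_nonneg)
    finally show ?thesis .
  qed
  have Plim: "(\<lambda>k. P g (f k) t) \<longlonglongrightarrow> P g F t" if "0 \<le> g" "g \<le> \<sigma>" "t \<ge> 0" for g t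
    unfolding P_def using that by (intro tendsto_Re frac_pairing_tendsto[OF cs _ _ fr F(1) L2lim]) auto
  have Pc: "continuous_on {0..} (P g h)" if "0 \<le> g" "g \<le> \<sigma>" "fourier_rapid (\<lambda>x. complex_of_real (h x))" for g h
    unfolding P_def[abs_def] using that by (intro continuous_on_Re frac_pairing_continuous[OF cs]) auto
  \<comment> \<open>Measurability in t follows from continuity of the pairings on t \<ge> 0.\<close>
  have Im: "(\<lambda>t. indicator {0..} t *\<^sub>R I h t) \<in> borel_measurable lebesgue" if h: "fourier_rapid (\<lambda>x. complex_of_real (h x))" for h
  proof (rule borel_measurable_lebesgueI, rule borel_measurable_continuous_on_indicator)
    show "continuous_on {0..} (I h)"
      unfolding I_def[abs_def] using s
      by (intro continuous_on_add continuous_on_diff continuous_on_mult Pc h continuous_on_subset[OF c\<eta>(1)]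
          continuous_on_subset[OF c\<eta>(2)] continuous_on_subset[OF d(3)]) auto
  qed simp
  have I0: "I h t = 0" if "t > T" for h t using \<eta>z[OF that] by (simp add: I_def)
  define M where "M = (A2 + 1 + A1) * (N * L)"
  have NL: "N * L \<ge> 0" using N(1) L0 by simp
  \<comment> \<open>The majorant is uniform in k, since 0 \<le> f k \<le> F bounds all the
    \<open>L2\<close> norms by that of F.\<close>
  have Ib: "\<bar>I (f k) t\<bar> \<le> M" if t: "t \<in> {0..T}" for k t
  proof -
    have "\<bar>\<eta>2 t\<bar> \<le> A2" "\<bar>\<eta>1 t\<bar> \<le> A1"
      using A(1,2)[of t] mult_left_mono[OF e1(1)[of t] A(3)] mult_left_mono[OF e1(1)[of t] A(4)] by linarith+
    moreover have "\<bar>c * P g (f k) t\<bar> \<le> c' * (N * L)" if "\<bar>c\<bar> \<le> c'" "0 \<le> g" "g \<le> \<sigma>" for c c' g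
      unfolding abs_mult using that(1) by (intro mult_mono that(1) Pb[OF that(2,3) t]) auto
    moreover have "\<bar>\<eta> t\<bar> \<le> 1" using \<eta>(3,4)[of t] by simp
    ultimately have "\<bar>\<eta>2 t * P 0 (f k) t\<bar> \<le> A2 * (N * L)" "\<bar>\<eta> t * P \<sigma> (f k) t\<bar> \<le> 1 * (N * L)" "\<bar>\<eta>1 t * P \<delta> (f k) t\<bar> \<le> A1 * (N * L)"
      using s s0 by blast+
    then show ?thesis unfolding I_def M_def distrib_right by linarith
  qed
  have Ii: "integrable lebesgue (\<lambda>t. indicator {0..T} t * M)"
    using T by (intro integrable_mult_left integrable_real_indicator) auto
  have Ik: "norm (indicator {0..} t *\<^sub>R I (f k) t) \<le> indicator {0..T} t * M" for k t
    using Ib[of t k] I0[of t "f k"] T by (cases "t \<le> T"; cases "t \<ge> 0") (auto simp: indicator_def)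
  have Blim: "(\<lambda>k. B (f k)) \<longlonglongrightarrow> B F"
    unfolding B_def set_lebesgue_integral_def
  proof (rule integral_dominated_convergence[where w="\<lambda>t. indicator {0..T} t * M"])
    show "AE t in lebesgue. (\<lambda>k. indicator {0..} t *\<^sub>R I (f k) t) \<longlonglongrightarrow> indicator {0..} t *\<^sub>R I F t"
    proof (intro AE_I2)
      fix t :: real
      show "(\<lambda>k. indicator {0..} t *\<^sub>R I (f k) t) \<longlonglongrightarrow> indicator {0..} t *\<^sub>R I F t"
      proof (cases "t \<ge> 0")
        case True
        then show ?thesis unfolding I_def using s s0
          by (intro tendsto_scaleR tendsto_const tendsto_add tendsto_diff tendsto_mult Plim) auto
      qed simp
    qed
  qed (use Im fr F(1) Ii Ik in auto)
  have Ulim: "(\<lambda>k. U (f k)) \<longlonglongrightarrow> U F"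
    unfolding U_def
  proof (rule integral_dominated_convergence[where w="\<lambda>x. norm (u1 x)"])
    show "AE x in lebesgue. norm (u1 x * f k x) \<le> norm (u1 x)" for k
      using fb[of k] F(5) by (intro AE_I2) (auto simp: abs_mult intro!: mult_left_le order_trans[OF fb(2) F(5)])
    show "AE x in lebesgue. (\<lambda>k. u1 x * f k x) \<longlonglongrightarrow> u1 x * F x"
      by (intro AE_I2 tendsto_intros flim)
  qed (use u1 mf in \<open>auto intro!: borel_measurable_times\<close>)

  \<comment> \<open>For t \<ge> 0 the product of \<eta> and f k is at most 1 and vanishes outside
    the compact set \<open>?K\<close>, on which |u|^p is integrable by the notion of
    solution.\<close>
  have wi: "integrable lebesgue (w (f k))" for k
  proof -
    let ?K = "{0..T} \<times> cball (0::'a) (real (Suc k))"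
    have "compact ?K \<and> ?K \<subseteq> {0..} \<times> UNIV" by (auto intro: compact_Times)
    then have K: "integrable lebesgue (\<lambda>z. indicator ?K z *\<^sub>R (\<lambda>(t, x). \<bar>u t x\<bar> powr p) z)"
      using sol unfolding global_sobolev_solution_def set_integrable_def by blast
    have c: "continuous_on UNIV (\<lambda>z. \<eta> (fst z) * f k (snd z))"
      by (intro continuous_on_mult continuous_on_compose2[OF c\<eta>(1)] continuous_on_compose2[OF cf] continuous_on_fst continuous_on_snd continuous_on_id) auto
    have z: "t \<le> T" if "\<eta> t \<noteq> 0" for t using \<eta>z(1)[of t] that by force
    have z': "norm x \<le> 1 + real k" if "f k x \<noteq> 0" for x using fz[of k x] that by force
    have "w (f k) = (\<lambda>z. indicator ?K z *\<^sub>R (\<lambda>(t, x). \<bar>u t x\<bar> powr p) z * (\<eta> (fst z) * f k (snd z)))"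
      by (auto simp: fun_eq_iff w_def indicator_def dest: z z')
    moreover have "integrable lebesgue (\<lambda>z. indicator ?K z *\<^sub>R (\<lambda>(t, x). \<bar>u t x\<bar> powr p) z * (\<eta> (fst z) * f k (snd z)))"
    proof (rule Bochner_Integration.integrable_bound[OF K])
      show "(\<lambda>z. indicator ?K z *\<^sub>R (\<lambda>(t, x). \<bar>u t x\<bar> powr p) z * (\<eta> (fst z) * f k (snd z))) \<in> borel_measurable lebesgue"
        by (intro borel_measurable_times borel_measurable_integrable[OF K] borel_measurable_lebesgueI[OF borel_measurable_continuous_onI[OF c]])
      show "AE z in lebesgue. norm (indicator ?K z *\<^sub>R (\<lambda>(t, x). \<bar>u t x\<bar> powr p) z * (\<eta> (fst z) * f k (snd z)))
         \<le> norm (indicator ?K z *\<^sub>R (\<lambda>(t, x). \<bar>u t x\<bar> powr p) z)"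
      proof (intro AE_I2)
        fix z
        have "\<bar>\<eta> (fst z) * f k (snd z)\<bar> \<le> 1"
          using \<eta>(3,4)[of "fst z"] fb[of k "snd z"] F(5)[of "snd z"] by (auto simp: abs_mult intro!: mult_le_one)
        moreover have "norm (X * y) \<le> norm X" if "\<bar>y\<bar> \<le> 1" for X y :: real
          using mult_left_le[OF that, of "\<bar>X\<bar>"] by (simp add: abs_mult)
        ultimately show "norm (indicator ?K z *\<^sub>R (\<lambda>(t, x). \<bar>u t x\<bar> powr p) z * (\<eta> (fst z) * f k (snd z)))
         \<le> norm (indicator ?K z *\<^sub>R (\<lambda>(t, x). \<bar>u t x\<bar> powr p) z)" by blast
      qed
    qed
    ultimately show ?thesis by (simp only:)
  qed
  have wn: "w h z \<ge> 0" if "\<And>x. h x \<ge> 0" for h z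
    using that \<eta>(3) by (auto simp: w_def split: prod.split)
  have wm: "(\<lambda>x. w h (t, x)) \<in> borel_measurable lebesgue" if "h \<in> borel_measurable lebesgue" for h t
  proof (cases "t \<ge> 0")
    case True
    then show ?thesis using that um[OF True] by (simp add: w_def)
  qed (simp add: w_def)
  define a where "a k t = (\<integral>\<^sup>+x. ennreal (w (f k) (t, x)) \<partial>lebesgue)" for k t
  note tonelli = Tonelli_lebesgue_measurable[OF wi wn wm] Tonelli_lebesgue[OF wi wn wm]
  have am [measurable]: "a k \<in> borel_measurable lebesgue" for k
    unfolding a_def[abs_def] by (rule tonelli(1)[OF fb(1) mf(1)])
  have AB: "(LINT t|lebesgue. LINT x|lebesgue. w (f k) (t, x)) = B (f k) - U (f k)" for k
  proof -
    have test: "(\<lambda>z. \<eta> (fst z) * f k (snd z)) \<in> test_functions"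
    proof -
      have "{z. \<eta> (fst z) * f k (snd z) \<noteq> 0} \<subseteq> {-T..T} \<times> cball 0 (real (Suc k))"
      proof
        fix z assume "z \<in> {z. \<eta> (fst z) * f k (snd z) \<noteq> 0}"
        then have "\<eta> (fst z) \<noteq> 0" "f k (snd z) \<noteq> 0" by auto
        then have "\<not> \<bar>fst z\<bar> \<ge> T" "\<not> norm (snd z) > real (Suc k)" using \<eta>(5) fz by blast+
        then show "z \<in> {-T..T} \<times> cball 0 (real (Suc k))" by (cases z) auto
      qed
      then have "bounded {z. \<eta> (fst z) * f k (snd z) \<noteq> 0}"
        by (rule bounded_subset[rotated]) (intro bounded_Times bounded_closed_interval bounded_cball)
      then show ?thesis unfolding test_functions_def using smooth_mult[OF \<eta>(1) fs(2)] by (simp add: compact_closure)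
    qed
    have "(LINT t|lebesgue. LINT x|lebesgue. w (f k) (t, x)) = (LINT t:{0..}|lebesgue. LINT x|lebesgue. \<bar>u t x\<bar> powr p * (\<eta> t * f k x))"
      unfolding set_lebesgue_integral_def w_def by simp
    with solution_product_test_function[OF sol s fr d(1,2) test] show ?thesis
      unfolding B_def U_def I_def P_def using \<eta>(2) by simp
  qed
  have aint: "(\<integral>\<^sup>+t. a k t \<partial>lebesgue) = ennreal (B (f k) - U (f k))" for k
    unfolding a_def tonelli(2)[OF fb(1) mf(1)] AB ..
  have "B (f k) - U (f k) \<ge> 0" for k
    unfolding AB[symmetric] using wn[OF fb(1)] by (intro Bochner_Integration.integral_nonneg) auto
  then have BU: "B F - U F \<ge> 0"
    using tendsto_diff[OF Blim Ulim] by (intro tendsto_lowerbound[of _ "B F - U F" sequentially 0]) auto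
  \<comment> \<open>Fatou is used twice: in t to bound the integral of \<open>low\<close> by B F - U
    F, and in x to bound the slice of \<open>w F\<close> by \<open>low\<close>. This makes
    \<open>low\<close> a measurable substitute for the slices of \<open>w F\<close>, as the Tonelli
    lemma is applied to the truncated integrands only.\<close>
  define low where "low t = liminf (\<lambda>k. a k t)" for t
  have lm [measurable]: "low \<in> borel_measurable lebesgue" unfolding low_def[abs_def] by measurable
  have "(\<integral>\<^sup>+t. low t \<partial>lebesgue) \<le> liminf (\<lambda>k. \<integral>\<^sup>+t. a k t \<partial>lebesgue)"
    unfolding low_def by (rule nn_integral_liminf) measurable
  also have "\<dots> = ennreal (B F - U F)"
    unfolding aint by (intro lim_imp_Liminf tendsto_ennrealI tendsto_diff Blim Ulim) simp
  finally have lint: "(\<integral>\<^sup>+t. low t \<partial>lebesgue) \<le> ennreal (B F - U F)" .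
  have wl: "(\<integral>\<^sup>+x. ennreal (w F (t, x)) \<partial>lebesgue) \<le> low t" for t
  proof -
    have "(\<lambda>k. ennreal (w (f k) (t, x))) \<longlonglongrightarrow> ennreal (w F (t, x))" for x
      unfolding w_def prod.case by (intro tendsto_intros flim)
    then have "ennreal (w F (t, x)) = liminf (\<lambda>k. ennreal (w (f k) (t, x)))" for x
      by (intro lim_imp_Liminf[symmetric]) auto
    then have "(\<integral>\<^sup>+x. ennreal (w F (t, x)) \<partial>lebesgue) = (\<integral>\<^sup>+x. liminf (\<lambda>k. ennreal (w (f k) (t, x))) \<partial>lebesgue)"
      by (simp only:)
    also have "\<dots> \<le> low t"
      unfolding low_def a_def by (intro nn_integral_liminf measurable_compose[OF wm[OF mf(1)] measurable_ennreal])
    finally show ?thesis .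
  qed
  define E where "E = Y * (LINT x|lebesgue. F x)"
  have E0: "E \<ge> 0" unfolding E_def using Y0 F(4) by (intro mult_nonneg_nonneg) auto
  \<comment> \<open>The slice at time t of the linear terms, now with F itself, so that Young's
    inequality can be applied pointwise in x.\<close>
  have key: "ennreal (norm (indicator {0..} t *\<^sub>R I F t)) \<le> ennreal (1 / 2) * low t + ennreal (E * indicator {0..T} t)" for t
  proof (cases "t \<in> {0..T}")
    case False
    then have "indicator {0..} t *\<^sub>R I F t = 0" using I0[of t F] T by (auto simp: indicator_def)
    then show ?thesis by (simp only: norm_zero ennreal_0 zero_le)
  next
    case True
    then have t: "t \<ge> 0" by simp
    have mu: "u t \<in> borel_measurable lebesgue" by (rule um[OF t])
    let ?G = "\<lambda>x. u t x * (\<eta>2 t * F x + \<eta> t * frac_laplacian \<sigma> F x - \<eta>1 t * frac_laplacian \<delta> F x)"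
    have "I F t = (LINT x|lebesgue. ?G x)"
      unfolding I_def P_def integral_slice[OF cs s t F(1)] ..
    then have "ennreal (norm (I F t)) \<le> (\<integral>\<^sup>+x. ennreal (norm (?G x)) \<partial>lebesgue)"
      by (simp only: norm_integral_le_nn_integral)
    also have "\<dots> \<le> (\<integral>\<^sup>+x. ennreal (1 / 2) * ennreal (w F (t, x)) + ennreal Y * ennreal (F x) \<partial>lebesgue)"
    proof (intro nn_integral_mono)
      fix x
      let ?e = "\<eta> t powr (1 / p)"
      have "\<bar>\<eta>2 t * F x\<bar> \<le> A2 * ?e * F x" "\<bar>\<eta> t * frac_laplacian \<sigma> F x\<bar> \<le> ?e * (Cs * F x)"
        "\<bar>\<eta>1 t * frac_laplacian \<delta> F x\<bar> \<le> (A1 * ?e) * (Cd * F x)"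
        unfolding abs_mult using A(1,2)[of t] C(1,2)[of x] F(4)[of x] \<eta>(3)[of t] e1(2)[of t] A(3,4)
        by (auto intro!: mult_mono)
      then have "\<bar>\<eta>2 t * F x + \<eta> t * frac_laplacian \<sigma> F x - \<eta>1 t * frac_laplacian \<delta> F x\<bar> \<le> A2 * ?e * F x + ?e * (Cs * F x) + (A1 * ?e) * (Cd * F x)"
        by linarith
      also have "\<dots> = ?e * D * F x" unfolding D_def by (simp add: algebra_simps)
      finally have "norm (?G x) \<le> \<bar>u t x\<bar> * (?e * D * F x)"
        unfolding real_norm_def abs_mult by (intro mult_left_mono) auto
      also have "\<dots> = ((\<bar>u t x\<bar> * ?e) * D) * F x" by simp
      \<comment> \<open>Young with x = |u| \<eta>^(1/p), whose p-th power is |u|^p \<eta>: this is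
        why the derivatives of \<eta> were bounded by \<eta>^(1/p).\<close>
      also have "\<dots> \<le> ((\<bar>u t x\<bar> * ?e) powr p / 2 + Y) * F x"
        unfolding Y_def using p D0 F(4) by (intro mult_right_mono young_le) auto
      also have "(\<bar>u t x\<bar> * ?e) powr p = \<bar>u t x\<bar> powr p * \<eta> t"
        using p \<eta>(3)[of t] by (simp add: powr_mult powr_powr)
      also have "(\<bar>u t x\<bar> powr p * \<eta> t / 2 + Y) * F x = 1 / 2 * w F (t, x) + Y * F x"
        using t by (simp add: w_def algebra_simps)
      finally have "ennreal (norm (?G x)) \<le> ennreal (1 / 2 * w F (t, x) + Y * F x)" by (rule ennreal_leI)
      also have "\<dots> = ennreal (1 / 2) * ennreal (w F (t, x)) + ennreal Y * ennreal (F x)"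
        using wn[OF F(4)] Y0 F(4) by (simp only: ennreal_plus ennreal_mult mult_nonneg_nonneg)
      finally show "ennreal (norm (?G x)) \<le> ennreal (1 / 2) * ennreal (w F (t, x)) + ennreal Y * ennreal (F x)" .
    qed
    also have "\<dots> = ennreal (1 / 2) * (\<integral>\<^sup>+x. ennreal (w F (t, x)) \<partial>lebesgue) + ennreal Y * (\<integral>\<^sup>+x. ennreal (F x) \<partial>lebesgue)"
      using wm[OF mf(2)] mf(2) by (subst nn_integral_add) (auto simp: nn_integral_cmult)
    also have "\<dots> \<le> ennreal (1 / 2) * low t + ennreal E"
    proof (intro add_mono mult_left_mono wl)
      have "(\<integral>\<^sup>+x. ennreal (F x) \<partial>lebesgue) = ennreal (LINT x|lebesgue. F x)"
        by (rule nn_integral_eq_integral[OF F1]) (simp add: F(4))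
      then show "ennreal Y * (\<integral>\<^sup>+x. ennreal (F x) \<partial>lebesgue) \<le> ennreal E"
        using Y0 by (simp add: E_def ennreal_mult')
    qed simp
    finally show ?thesis using True by simp
  qed
  have mE: "(\<lambda>t. ennreal (E * indicator {0..T} t)) \<in> borel_measurable lebesgue"
    by (rule borel_measurable_lebesgueI) measurable
  have "ennreal \<bar>B F\<bar> \<le> (\<integral>\<^sup>+t. ennreal (norm (indicator {0..} t *\<^sub>R I F t)) \<partial>lebesgue)"
    unfolding B_def set_lebesgue_integral_def real_norm_def[symmetric] by (rule norm_integral_le_nn_integral)
  also have "\<dots> \<le> (\<integral>\<^sup>+t. ennreal (1 / 2) * low t + ennreal (E * indicator {0..T} t) \<partial>lebesgue)"
    by (intro nn_integral_mono key)
  also have "\<dots> = ennreal (1 / 2) * (\<integral>\<^sup>+t. low t \<partial>lebesgue) + (\<integral>\<^sup>+t. ennreal (E * indicator {0..T} t) \<partial>lebesgue)"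
    using mE lm by (subst nn_integral_add) (auto simp: nn_integral_cmult)
  also have "(\<integral>\<^sup>+t. ennreal (E * indicator {0..T} t) \<partial>lebesgue) = ennreal (T * E)"
  proof -
    have "(\<integral>\<^sup>+t. ennreal (E * indicator {0..T} t) \<partial>lebesgue) = (\<integral>\<^sup>+t. ennreal E * indicator {0..T} t \<partial>lebesgue)"
      by (intro nn_integral_cong) (simp add: indicator_def)
    also have "\<dots> = ennreal E * emeasure lebesgue {0..T}"
      by (rule nn_integral_cmult_indicator) simp
    also have "\<dots> = ennreal E * ennreal T" using T by simp
    finally show ?thesis using E0 T by (simp only: ennreal_mult mult.commute)
  qed
  also have "ennreal (1 / 2) * (\<integral>\<^sup>+t. low t \<partial>lebesgue) + ennreal (T * E) \<le> ennreal (1 / 2) * ennreal (B F - U F) + ennreal (T * E)"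
    by (intro add_mono mult_left_mono lint) auto
  also have "\<dots> = ennreal (1 / 2 * (B F - U F) + T * E)"
    using BU E0 T by (simp only: ennreal_plus ennreal_mult mult_nonneg_nonneg)
  \<comment> \<open>Doubling gives 2 |B| \<le> B - U + 2 T E, and B \<le> 2 |B| removes B
    altogether, leaving a bound on U alone.\<close>
  finally have "\<bar>B F\<bar> \<le> 1 / 2 * (B F - U F) + T * E"
    using BU E0 T by (subst (asm) ennreal_le_iff) auto
  then have "2 * \<bar>B F\<bar> \<le> 2 * (1 / 2 * (B F - U F) + T * E)" by (rule mult_left_mono) simp
  also have "\<dots> = B F - U F + 2 * (T * E)" by (simp add: distrib_left)
  finally have "U F \<le> 2 * (T * E)" by linarith
  then show ?thesis unfolding U_def E_def Y_def D_def by (simp only: mult.assoc)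
qed

text \<open>For positive order, integrability of the symbol bounds (-\<Delta>)^\<gamma> of the
  weight and the mixture argument gives decay of order q; \<open>japanese_bound\<close> joins both.
  Order 0 is the identity.\<close>

lemma frac_laplacian_japanese_bound:
  fixes q \<gamma> :: real
  assumes q: "q > real DIM('a::euclidean_space)" and g: "\<gamma> = 0 \<or> \<gamma> > 0 \<and> q < real DIM('a) + 2 * \<gamma>"
  shows "\<exists>C\<ge>0. \<forall>x::'a. \<bar>frac_laplacian \<gamma> (japanese q) x\<bar> \<le> C * japanese q x"
proof -
  let ?J = "\<lambda>x::'a. complex_of_real (japanese q x)"
  have q0: "q \<ge> 0" using q by (auto intro: order_trans[of 0 "real DIM('a)"])
  show ?thesis
  proof (cases "\<gamma> = 0")
    case True
    have "frac_laplacian \<gamma> (japanese q) x = japanese q x" for x :: 'a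
      unfolding frac_laplacian_eq True inv_fourier_frac_symbol_0[OF fourier_rapid_japanese[OF q]] by simp
    then show ?thesis using japanese_pos[of q] by (intro exI[of _ 1]) (auto intro: less_imp_le)
  next
    case False
    with g have g: "\<gamma> > 0" "q < real DIM('a) + 2 * \<gamma>" by auto
    obtain D where D: "D \<ge> 0" "\<And>x::'a. norm x powr q * norm (fourier (frac_symbol \<gamma> ?J) x) \<le> D"
      using frac_laplacian_japanese_decay[OF q _ g] g(1) by auto
    define C where "C = (2 * pi) powr (- real DIM('a) / 2) * (LINT x|lebesgue. norm (frac_symbol \<gamma> ?J x))"
    have C: "C \<ge> 0" "\<And>x. norm (fourier (frac_symbol \<gamma> ?J) x) \<le> C"
      unfolding C_def using norm_fourier_le[OF integrable_frac_symbol_japanese[OF q]] g(1) by auto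
    have "\<bar>frac_laplacian \<gamma> (japanese q) x\<bar> \<le> 2 powr (q / 2) * (C + D) * japanese q x" for x :: 'a
    proof -
      have "\<bar>frac_laplacian \<gamma> (japanese q) x\<bar> \<le> norm (fourier (frac_symbol \<gamma> ?J) (- x))"
        unfolding frac_laplacian_eq inv_fourier_eq by (rule abs_Re_le_cmod)
      also have "\<dots> \<le> 2 powr (q / 2) * (C + D) * japanese q (- x)"
        by (rule japanese_bound[OF q0 C(2) D(2) C(1) D(1)])
      finally show ?thesis by (simp add: japanese_def)
    qed
    moreover have "2 powr (q / 2) * (C + D) \<ge> 0" using C(1) D(1) by simp
    ultimately show ?thesis by blast
  qed
qed

section \<open>Dilation by R and the limit R to infinity\<close>

lemma frac_laplacian_scale:
  fixes f :: "'a::euclidean_space \<Rightarrow> real"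
  assumes "c > 0"
  shows "frac_laplacian \<gamma> (\<lambda>x. f (c *\<^sub>R x)) x = c powr (2 * \<gamma>) * frac_laplacian \<gamma> f (c *\<^sub>R x)"
  unfolding frac_laplacian_eq
  using inv_fourier_frac_symbol_scale[OF assms, of \<gamma> "\<lambda>x. of_real (f x)" x] by simp

text \<open>The number k enters through inequalities only: k \<le> \<sigma> and k \<le> 2\<delta>
  make the terms with time derivatives as small as the one with (-\<Delta>)^\<sigma>, and k < n
  keeps n - k positive.\<close>

theorem no_global_solution:
  fixes u1 :: "'a::euclidean_space \<Rightarrow> real" and \<sigma> \<delta> k p :: real
  assumes s: "\<sigma> > 0" "0 \<le> \<delta>" "\<delta> < \<sigma>" and k: "k \<le> \<sigma>" "k \<le> 2 * \<delta>" "k < real DIM('a)"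
    and u1: "integrable lebesgue u1" "(LINT x|lebesgue. u1 x) > 0"
    and p: "1 < p" "p < 1 + 2 * \<sigma> / (real DIM('a) - k)"
  shows "\<not> global_sobolev_solution \<sigma> \<delta> p u1 u"
proof
  assume sol: "global_sobolev_solution \<sigma> \<delta> p u1 u"
  let ?n = "real DIM('a)"
  \<comment> \<open>For \<delta> > 0 the value n + \<delta> lies above n and below both n +
    2\<delta> and n + 2\<sigma>. For \<delta> = 0 the damping operator is the identity and q = n +
    \<sigma> only has to stay below n + 2\<sigma>.\<close>
  define q where "q = ?n + (if \<delta> > 0 then \<delta> else \<sigma>)"
  have q: "q > ?n" using s by (auto simp: q_def)
  have q0: "q \<ge> 0" using q by (auto intro: order_trans[of 0 "real DIM('a)"])
  have q\<sigma>: "\<sigma> = 0 \<or> \<sigma> > 0 \<and> q < ?n + 2 * \<sigma>" and q\<delta>: "\<delta> = 0 \<or> \<delta> > 0 \<and> q < ?n + 2 * \<delta>"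
    using s by (auto simp: q_def)
  define F where "F = (japanese q :: 'a \<Rightarrow> real)"
  obtain Cs where Cs: "Cs \<ge> 0" "\<And>x. \<bar>frac_laplacian \<sigma> F x\<bar> \<le> Cs * F x"
    using frac_laplacian_japanese_bound[OF q q\<sigma>] unfolding F_def by blast
  obtain Cd where Cd: "Cd \<ge> 0" "\<And>x. \<bar>frac_laplacian \<delta> F x\<bar> \<le> Cd * F x"
    using frac_laplacian_japanese_bound[OF q q\<delta>] unfolding F_def by blast
  obtain \<eta> \<eta>1 \<eta>2 K where \<eta>: "\<And>t. (\<eta> has_real_derivative \<eta>1 t) (at t)" "\<And>t. (\<eta>1 has_real_derivative \<eta>2 t) (at t)"
    "continuous_on UNIV \<eta>2" "\<And>c. smooth (\<lambda>z::real \<times> 'a. \<eta> (c * fst z))" "\<eta> 0 = 1"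
    "\<And>t. 0 \<le> \<eta> t" "\<And>t. \<eta> t \<le> 1" "\<And>t. \<bar>t\<bar> \<ge> 1 \<Longrightarrow> \<eta> t = 0" "K \<ge> 0"
    "\<And>t. \<bar>\<eta>1 t\<bar> \<le> K * \<eta> t powr (1 / p)" "\<And>t. \<bar>\<eta>2 t\<bar> \<le> K * \<eta> t powr (1 / p)"
    using time_cutoff[OF p(1), where 'a='a] by blast
  define \<alpha> where "\<alpha> = 2 * \<sigma> - k"
  define D where "D = K + Cs + K * Cd"
  \<comment> \<open>The powers of R: \<alpha> from the length T of the time interval, n from the
    integral of F(x / R), and R^(-2\<sigma>) raised to the conjugate exponent p / (p - 1) from
    Young.\<close>
  define e where "e = \<alpha> + ?n - 2 * \<sigma> * (p / (p - 1))"
  define Z where "Z = 2 * (2 powr (1 / (p - 1)) * D powr (p / (p - 1)) * (LINT x|lebesgue. F x))"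
  have F0: "F x > 0" "F x \<le> 1" for x
    unfolding F_def by (rule japanese_pos, rule japanese_le_1[OF q0])
  have D0: "D \<ge> 0" using \<eta>(9) Cs(1) Cd(1) by (simp add: D_def)
  have Fi: "(LINT x|lebesgue. F x) \<ge> 0" using F0(1) by (intro Bochner_Integration.integral_nonneg) (auto intro: less_imp_le)
  have e: "e < 0"
  \<comment> \<open>Since p / (p - 1) = 1 + 1 / (p - 1), the exponent equals n - k - 2\<sigma> / (p
    - 1), negative by the upper bound on p.\<close>
  proof -
    have "(p - 1) * (?n - k) < 2 * \<sigma>" using p(2) k(3) by (simp add: field_simps)
    then have "?n - k < 2 * \<sigma> / (p - 1)" using p(1) by (simp add: field_simps)
    moreover have "p / (p - 1) = 1 + 1 / (p - 1)" using p(1) by (simp add: field_simps)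
    ultimately show ?thesis unfolding e_def \<alpha>_def by (simp add: distrib_left)
  qed
  have est: "(LINT x|lebesgue. u1 x * F ((1 / R) *\<^sub>R x)) \<le> Z * R powr e" if R: "R \<ge> 1" for R
  proof -
    define c where "c = 1 / R"
    define T where "T = R powr \<alpha>"
    have c: "c > 0" and T: "T > 0" using R by (auto simp: c_def T_def)
    let ?F = "\<lambda>x. F (c *\<^sub>R x)"
    have lin: "bounded_linear (\<lambda>z::real \<times> 'a. c *\<^sub>R snd z)"
      by (rule bounded_linear_compose[OF bounded_linear_scaleR_right bounded_linear_snd])
    have Fr: "fourier_rapid (\<lambda>x. complex_of_real (?F x))"
      using fourier_rapid_scale[OF fourier_rapid_japanese[OF q] c] unfolding F_def .
    have Fs: "smooth ?F" "smooth (\<lambda>z::real \<times> 'a. ?F (snd z))"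
      unfolding F_def japanese_def
      by (intro smooth_japanese_bracket bounded_linear_scaleR_right, intro smooth_japanese_bracket lin)
    have d1: "((\<lambda>t. \<eta> (1 / T * t)) has_real_derivative \<eta>1 (1 / T * t) * (1 / T)) (at t)" for t
      using T by (intro DERIV_chain2[OF \<eta>(1)]) (auto intro!: derivative_eq_intros)
    have d2: "((\<lambda>t. \<eta>1 (1 / T * t) * (1 / T)) has_real_derivative \<eta>2 (1 / T * t) * (1 / T) * (1 / T)) (at t)" for t
      using T by (intro DERIV_cmult_right DERIV_chain2[OF \<eta>(2)]) (auto intro!: derivative_eq_intros)
    have c2: "continuous_on UNIV (\<lambda>t. \<eta>2 (1 / T * t) * (1 / T) * (1 / T))"
      by (intro continuous_intros continuous_on_compose2[OF \<eta>(3)]) auto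
    have z: "\<eta> (1 / T * t) = 0" if "\<bar>t\<bar> \<ge> T" for t
      using that T by (intro \<eta>(8)) (simp add: abs_mult)
    have b1: "\<bar>\<eta>1 (1 / T * t) * (1 / T)\<bar> \<le> K * (1 / T) * \<eta> (1 / T * t) powr (1 / p)" for t
    proof -
      have "\<bar>\<eta>1 (1 / T * t)\<bar> * (1 / T) \<le> K * \<eta> (1 / T * t) powr (1 / p) * (1 / T)"
        using T by (intro mult_right_mono \<eta>) auto
      then show ?thesis using T by (simp add: abs_mult)
    qed
    have b2: "\<bar>\<eta>2 (1 / T * t) * (1 / T) * (1 / T)\<bar> \<le> K * (1 / T) * (1 / T) * \<eta> (1 / T * t) powr (1 / p)" for t
    proof -
      have "\<bar>\<eta>2 (1 / T * t)\<bar> * (1 / T * (1 / T)) \<le> K * \<eta> (1 / T * t) powr (1 / p) * (1 / T * (1 / T))"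
        using T by (intro mult_right_mono \<eta>) auto
      then show ?thesis using T by (simp add: abs_mult)
    qed
    have L: "\<bar>frac_laplacian \<gamma> ?F x\<bar> \<le> C * c powr (2 * \<gamma>) * ?F x"
      if "\<And>x. \<bar>frac_laplacian \<gamma> F x\<bar> \<le> C * F x" for \<gamma> C x
    proof -
      have "\<bar>frac_laplacian \<gamma> ?F x\<bar> = c powr (2 * \<gamma>) * \<bar>frac_laplacian \<gamma> F (c *\<^sub>R x)\<bar>"
        unfolding frac_laplacian_scale[OF c] by (simp add: abs_mult)
      also have "\<dots> \<le> c powr (2 * \<gamma>) * (C * ?F x)" by (intro mult_left_mono that) simp
      finally show ?thesis by (simp add: mult_ac)
    qed
    \<comment> \<open>Each time derivative contributes 1 / T, and (-\<Delta>)^\<gamma> contributes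
      c^(2\<gamma>) with c = 1 / R; the three summands are the terms u_tt, (-\<Delta>)^\<sigma> u
      and (-\<Delta>)^\<delta> u_t.\<close>
    let ?D = "K * (1 / T) * (1 / T) + Cs * c powr (2 * \<sigma>) + K * (1 / T) * (Cd * c powr (2 * \<delta>))"
    have "(LINT x|lebesgue. u1 x * ?F x) \<le> 2 * (T * (2 powr (1 / (p - 1)) * ?D powr (p / (p - 1)) * (LINT x|lebesgue. ?F x)))"
    proof (rule weak_estimate[OF sol s(2) less_imp_le[OF s(3)] p(1) u1(1) Fr Fs less_imp_le[OF F0(1)] F0(2) d1 d2 c2 \<eta>(4) _ _ _ z _ b1 b2])
      show "\<bar>frac_laplacian \<sigma> ?F x\<bar> \<le> Cs * c powr (2 * \<sigma>) * ?F x" for x by (rule L[OF Cs(2)])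
      show "\<bar>frac_laplacian \<delta> ?F x\<bar> \<le> Cd * c powr (2 * \<delta>) * ?F x" for x by (rule L[OF Cd(2)])
    qed (use \<eta> T Cs Cd in auto)
    also have "(LINT x|lebesgue. ?F x) = R powr ?n * (LINT x|lebesgue. F x)"
      using integral_affine[of c F 0] c R by (simp add: c_def power_one_over powr_realpow)
    also have "2 * (T * (2 powr (1 / (p - 1)) * ?D powr (p / (p - 1)) * (R powr ?n * (LINT x|lebesgue. F x))))
        \<le> 2 * (T * (2 powr (1 / (p - 1)) * (D * R powr (- 2 * \<sigma>)) powr (p / (p - 1)) * (R powr ?n * (LINT x|lebesgue. F x))))"
    proof -
      have cR: "c powr b = R powr (- b)" for b using R by (simp add: c_def powr_divide powr_minus_divide)
      have TR: "1 / T = R powr (- \<alpha>)" by (simp add: T_def powr_minus_divide)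
      \<comment> \<open>Here k \<le> \<sigma> is used, as -2\<alpha> \<le> -2\<sigma> means \<alpha>
        \<ge> \<sigma>; the next bound uses k \<le> 2\<delta> in the same way.\<close>
      have 1: "1 / T * (1 / T) \<le> R powr (- 2 * \<sigma>)"
        unfolding TR powr_add[symmetric] using R k s by (intro powr_mono) (auto simp: \<alpha>_def)
      have 2: "1 / T * c powr (2 * \<delta>) \<le> R powr (- 2 * \<sigma>)"
        unfolding TR cR powr_add[symmetric] using R k s by (intro powr_mono) (auto simp: \<alpha>_def)
      have "?D = K * (1 / T * (1 / T)) + Cs * R powr (- 2 * \<sigma>) + K * Cd * (1 / T * c powr (2 * \<delta>))"
        using cR[of "2 * \<sigma>"] by simp
      also have "\<dots> \<le> K * R powr (- 2 * \<sigma>) + Cs * R powr (- 2 * \<sigma>) + K * Cd * R powr (- 2 * \<sigma>)"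
        using 1 2 \<eta>(9) Cd(1) Cs(1) by (intro add_mono mult_left_mono) auto
      also have "\<dots> = D * R powr (- 2 * \<sigma>)" by (simp add: D_def algebra_simps)
      finally have "?D \<le> D * R powr (- 2 * \<sigma>)" .
      moreover have "?D \<ge> 0" using T Cs Cd \<eta>(9) by simp
      ultimately have "?D powr (p / (p - 1)) \<le> (D * R powr (- 2 * \<sigma>)) powr (p / (p - 1))"
        using p(1) by (intro powr_mono2) auto
      then show ?thesis using T Fi
        by (intro mult_left_mono mult_right_mono mult_nonneg_nonneg) auto
    qed
    also have "\<dots> = Z * R powr e"
    proof -
      have "R powr e = T * R powr (- 2 * \<sigma> * (p / (p - 1))) * R powr ?n"
        unfolding T_def powr_add[symmetric] e_def by (simp add: algebra_simps)
      moreover have "(D * R powr (- 2 * \<sigma>)) powr (p / (p - 1)) = D powr (p / (p - 1)) * R powr (- 2 * \<sigma> * (p / (p - 1)))"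
        using D0 by (simp only: powr_mult powr_powr powr_ge_zero)
      ultimately show ?thesis unfolding Z_def by (simp only: mult_ac)
    qed
    finally show ?thesis by (simp only: c_def)
  qed
  define R where "R j = real (Suc j)" for j
  have Rlim: "filterlim R at_top sequentially"
    unfolding R_def[abs_def] by (rule filterlim_compose[OF filterlim_real_sequentially filterlim_Suc])
  \<comment> \<open>F(x / R) tends to F(0) = 1 and stays at most 1, so the data term converges to
    the full integral of u1.\<close>
  have "(\<lambda>j. LINT x|lebesgue. u1 x * F ((1 / R j) *\<^sub>R x)) \<longlonglongrightarrow> (LINT x|lebesgue. u1 x)"
  proof (rule integral_dominated_convergence[where w="\<lambda>x. norm (u1 x)"])
    have c: "continuous_on UNIV F" using fourier_rapidD(1)[OF fourier_rapid_japanese[OF q]]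
      unfolding F_def by (auto dest: continuous_on_Re)
    show "(\<lambda>x. u1 x * F ((1 / R j) *\<^sub>R x)) \<in> borel_measurable lebesgue" for j
      by (rule borel_measurable_times[OF borel_measurable_integrable[OF u1(1)]],
          intro borel_measurable_lebesgueI borel_measurable_continuous_onI continuous_on_compose2[OF c] continuous_intros) auto
    show "AE x in lebesgue. norm (u1 x * F ((1 / R j) *\<^sub>R x)) \<le> norm (u1 x)" for j
      using F0 by (intro AE_I2) (auto simp: abs_mult abs_of_pos intro!: mult_left_le)
    show "AE x in lebesgue. (\<lambda>j. u1 x * F ((1 / R j) *\<^sub>R x)) \<longlonglongrightarrow> u1 x"
    proof (intro AE_I2)
      fix x :: 'a
      have "(\<lambda>j. 1 / R j) \<longlonglongrightarrow> 0"
        unfolding R_def using LIMSEQ_inverse_real_of_nat by (simp add: inverse_eq_divide)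
      then have "(\<lambda>j. (1 / R j) *\<^sub>R x) \<longlonglongrightarrow> 0 *\<^sub>R x" by (intro tendsto_intros)
      then have "(\<lambda>j. F ((1 / R j) *\<^sub>R x)) \<longlonglongrightarrow> F (0 *\<^sub>R x)"
        by (intro continuous_on_tendsto_compose[OF c]) auto
      then have "(\<lambda>j. u1 x * F ((1 / R j) *\<^sub>R x)) \<longlonglongrightarrow> u1 x * F (0 *\<^sub>R x)" by (intro tendsto_intros)
      then show "(\<lambda>j. u1 x * F ((1 / R j) *\<^sub>R x)) \<longlonglongrightarrow> u1 x" by (simp add: F_def japanese_def)
    qed
  qed (use u1 in auto)
  moreover have "(\<lambda>j. Z * R j powr e) \<longlonglongrightarrow> Z * 0"
    by (intro tendsto_mult tendsto_const tendsto_neg_powr[OF e Rlim])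
  moreover have "(LINT x|lebesgue. u1 x * F ((1 / R j) *\<^sub>R x)) \<le> Z * R j powr e" for j
    by (rule est) (simp add: R_def)
  ultimately have "(LINT x|lebesgue. u1 x) \<le> Z * 0"
    by (intro LIMSEQ_le) auto
  with u1(2) show False by simp
qed

theorem theorem1p2:
  fixes \<sigma> \<delta> k p :: real
    and u1 :: "real ^ 'n \<Rightarrow> real"
  defines "k \<equiv> min \<sigma> (2 * \<delta>)"
  assumes "\<sigma> \<ge> 1" and "\<delta> \<in> {0..<\<sigma>}"
    and "real CARD('n) > 2 * k"
    and "integrable lebesgue u1"
    and "(LINT x|lebesgue. u1 x) > 0"
    and "p \<in> {1<..<1 + 2 * \<sigma> / (real CARD('n) - k)}"
  shows "\<not> (\<exists>u. global_sobolev_solution \<sigma> \<delta> p u1 u)"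
proof -
  \<comment> \<open>Nonnegativity of k turns n > 2k into n > k, so that the denominator n - k is
    positive.\<close>
  have "k \<ge> 0" using assms(2,3) by (auto simp: k_def)
  then have "k < real CARD('n)" using assms(4) by linarith
  moreover have "\<sigma> > 0" "0 \<le> \<delta>" "\<delta> < \<sigma>" "k \<le> \<sigma>" "k \<le> 2 * \<delta>"
    "1 < p" "p < 1 + 2 * \<sigma> / (real CARD('n) - k)"
    using assms(2,3,7) by (auto simp: k_def)
  ultimately have "\<not> global_sobolev_solution \<sigma> \<delta> p u1 u" for u
    using assms(5,6) no_global_solution[of \<sigma> \<delta> k u1 p u] by simp
  then show ?thesis by blast
qed

end
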